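(* Let $d\ge 3$, $0<R<\infty$, and let $g:\mathbb{N}\to(0,\infty)$ satisfy $g(N)\to\infty$. For any $K\in\mathcal{K}_R$ and any $\mathbf{x}\in\mathbb{T}_N$ satisfying $\tau_{\mathbf{x}}\varphi(B_R(o))\cap\varphi(B_{g(N)}(o))=\emptyset$, $$\mathbf{P}_o\big[\varphi(Y_t)\notin\tau_{\mathbf{x}}\varphi(K),\ 0\le t<T_L\big]=\mathbb{E}\big[e^{-dA\sigma_1\mathrm{Cap}(K)}\big]+o(1)\qquad\text{as }N\to\infty,$$ where the error term depends on $R$ and $g$ but is uniform in $K$ and $\mathbf{x}$.
   Context: $(Y_t)_{t\ge0}$ is the discrete-time lazy simple random walk on $\mathbb{Z}^d$: $\mathbf{P}[Y_{t+1}=y\mid Y_t=x]=1/2$ if $y=x$ and $=1/(4d)$ if $|y-x|=1$ ($|\cdot|$ the Euclidean norm); $\mathbf{P}_o$ is its law started at the origin $o$. $\mathbb{T}_N=[-N/2,N/2)^d\cap\mathbb{Z}^d$ and $\varphi=\varphi_N:\mathbb{Z}^d\to\mathbb{T}_N$ maps $x$ to the unique point of $\mathbb{T}_N$ congruent to $x$ modulo $N$ coordinatewise; $\tau_{\mathbf{x}}:\mathbb{T}_N\to\mathbb{T}_N$, $\tau_{\mathbf{x}}(\mathbf{y})=\varphi(\mathbf{y}+\mathbf{x})$, is translation of the torus by $\mathbf{x}$. $L=mN$ with $m=m(N)$ and $N$ integers, $N\to\infty$, with $L^2/N^d\to A$ for some constant $A\in(0,\infty)$. $T_L=\inf\{t\ge0:Y_t\notin(-L,L)^d\}$.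 $B_R(x)=\{y\in\mathbb{Z}^d:|y-x|<R\}$, and $\mathcal{K}_R$ is the collection of all subsets of $B_R(o)$. $\mathrm{Cap}(K)$ is the capacity of the finite set $K\subset\mathbb{Z}^d$ (with respect to simple random walk). $\sigma_1$ is the exit time from $(-1,1)^d$ of a standard $d$-dimensional Brownian motion started at $o$, and $\mathbb{E}$ is the corresponding expectation. *)

theory Defs
  imports "HOL-Probability.Probability"
begin

(* Points of Z^d are vectors int ^ 'd, with d = CARD('d). *)

definition inorm :: "int ^ 'd \<Rightarrow> real" where
  "inorm x = sqrt (\<Sum>i\<in>UNIV. (real_of_int (x $ i))\<^sup>2)"

definition zball :: "int ^ 'd \<Rightarrow> real \<Rightarrow> (int ^ 'd) set" where
  "zball x R = {y. inorm (y - x) < R}"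

definition lazy_step :: "(int ^ 'd) pmf" where
  "lazy_step = embed_pmf (\<lambda>z::int^'d. if z = 0 then 1/2
                                      else if inorm z = 1 then 1 / (4 * real CARD('d)) else 0)"

definition srw_step :: "(int ^ 'd) pmf" where
  "srw_step = embed_pmf (\<lambda>z::int^'d. if inorm z = 1 then 1 / (2 * real CARD('d)) else 0)"

definition incr_space :: "(int ^ 'd) pmf \<Rightarrow> (nat \<Rightarrow> int ^ 'd) measure" where
  "incr_space p = PiM UNIV (\<lambda>_. measure_pmf p)"

definition walk :: "int ^ 'd \<Rightarrow> (nat \<Rightarrow> int ^ 'd) \<Rightarrow> nat \<Rightarrow> int ^ 'd" where
  "walk x \<omega> t = x + (\<Sum>s<t. \<omega> s)"

definition exit_box :: "int \<Rightarrow> (nat \<Rightarrow> int ^ 'd) \<Rightarrow> enat" where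
  "exit_box L Y = (if \<exists>t. \<not> (\<forall>i. - L < Y t $ i \<and> Y t $ i < L)
                   then enat (LEAST t. \<not> (\<forall>i. - L < Y t $ i \<and> Y t $ i < L)) else \<infinity>)"

definition torus :: "nat \<Rightarrow> (int ^ 'd) set" where
  "torus N = {y. \<forall>i. - real N / 2 \<le> real_of_int (y $ i) \<and> real_of_int (y $ i) < real N / 2}"

definition phi :: "nat \<Rightarrow> int ^ 'd \<Rightarrow> int ^ 'd" where
  "phi N x = (THE y. y \<in> torus N \<and> (\<forall>i. y $ i mod int N = x $ i mod int N))"

definition tau :: "nat \<Rightarrow> int ^ 'd \<Rightarrow> int ^ 'd \<Rightarrow> int ^ 'd" where
  "tau N x y = phi N (y + x)"

definition avoid_prob :: "nat \<Rightarrow> int \<Rightarrow> (int ^ 'd) set \<Rightarrow> real" where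
  "avoid_prob N L S = measure (incr_space lazy_step)
     {\<omega>. \<forall>t. enat t < exit_box L (walk 0 \<omega>) \<longrightarrow> phi N (walk 0 \<omega> t) \<notin> S}"

definition Cap :: "(int ^ 'd) set \<Rightarrow> real" where
  "Cap K = (\<Sum>x\<in>K. measure (incr_space srw_step) {\<omega>. \<forall>t\<ge>1. walk x \<omega> t \<notin> K})"

definition std_BM :: "'w measure \<Rightarrow> (real \<Rightarrow> 'w \<Rightarrow> real ^ 'd) \<Rightarrow> bool" where
  "std_BM M B \<longleftrightarrow> prob_space M \<and>
     (\<forall>\<omega>\<in>space M. B 0 \<omega> = 0 \<and> continuous_on {0..} (\<lambda>t. B t \<omega>)) \<and>
     (\<forall>(ts :: nat \<Rightarrow> real) n. ts 0 = 0 \<and> (\<forall>k<n. ts k < ts (Suc k)) \<longrightarrow>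
        prob_space.indep_vars M (\<lambda>_. borel)
          (\<lambda>(k, i) \<omega>. (B (ts (Suc k)) \<omega> - B (ts k) \<omega>) $ i) ({..<n} \<times> UNIV) \<and>
        (\<forall>k<n. \<forall>i. distributed M lborel (\<lambda>\<omega>. (B (ts (Suc k)) \<omega> - B (ts k) \<omega>) $ i)
                         (normal_density 0 (sqrt (ts (Suc k) - ts k)))))"

definition bm_exit :: "(real \<Rightarrow> 'w \<Rightarrow> real ^ 'd) \<Rightarrow> 'w \<Rightarrow> real" where
  "bm_exit B \<omega> = Inf {t. 0 \<le> t \<and> \<not> (\<forall>i. -1 < B t \<omega> $ i \<and> B t \<omega> $ i < 1)}"

end

theory Submission
  imports Defs "HOL-Real_Asymp.Real_Asymp"
begin

text \<open>The periodic obstacles D are homogenised. Let w(x) be the probability that the walk from x avoids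
  D up to a time slightly longer than the mixing time of the torus. Then w vanishes on D, is close
  to 1 on most of the torus, and satisfies (P - 1) w = - f off D, where by mixing f is close to the
  constant rate Cap(K) / (2 N^d). The products e of cosines that vanish on the boundary of the box are
  exact eigenfunctions both of the lattice walk and of Brownian motion, and e w is almost an
  eigenfunction of the walk killed on D and outside the box, its eigenvalue being shifted by that
  rate. This determines the expected sum of e along the killed walk, and approximating 1 by linear
  combinations of such e yields the limit of the rate times the expected killing time, namely
  1 - E exp (- d A sigma Cap(K)). Since w(Y_t) plus the sum of f along the path is a martingale, this
  is also the limit of the probability of meeting D before leaving the box.\<close>

section \<open>Killed lazy walks and their occupation times\<close>

text \<open>The delicate point is the cross term of e and w. Near an obstacle w varies by order one,
  and its energy along the path is of order one. Since e has gradient 1/L and there are about L^2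
  steps, Cauchy-Schwarz bounds the cross term only by a constant. The power 3/2 of 1 - w in place of
  the square gains a weight that is small at most times, and the term becomes o(1). The rate f is
  compared with a constant \<gamma> from above only: f \<le> \<gamma> holds pointwise and the cell
  averages agree in the limit, so \<gamma> - f is small in mean, which suffices for occupation sums.
  Dimension at least three enters twice: t^(-d/2) is summable, so that late visits are rare, and the
  mixing time is short against N^d. In units of L^(-2) the rate \<gamma> is A Cap(K)/2, and a cosine
  product with frequencies \<kappa>/L decays at rate |\<kappa>|^2/(4d). Multiplied by 2d, these give
  the ratio c/(c + |\<kappa>|^2/2) with c = d A Cap(K), which is what Brownian motion yields at an
  independent exponential time of rate c.\<close>

definition lazy_op :: "(int ^ 'd \<Rightarrow> real) \<Rightarrow> int ^ 'd \<Rightarrow> real" where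
  "lazy_op f x = f x / 2 + (\<Sum>i\<in>UNIV. f (x + axis i 1) + f (x - axis i 1)) / (4 * real CARD('d))"

lemma lazy_op_mono_local:
  assumes "f x \<le> g x" "\<And>i. f (x + axis i 1) \<le> g (x + axis i 1)" "\<And>i. f (x - axis i 1) \<le> g (x - axis i 1)"
  shows "lazy_op f x \<le> lazy_op g x"
  unfolding lazy_op_def using assms
  by (intro add_mono divide_right_mono sum_mono) auto

lemma lazy_op_mono: "(\<And>y. f y \<le> g y) \<Longrightarrow> lazy_op f x \<le> lazy_op g x"
  by (rule lazy_op_mono_local)

lemma lazy_op_cong_local:
  assumes "f x = g x" "\<And>i. f (x + axis i 1) = g (x + axis i 1)" "\<And>i. f (x - axis i 1) = g (x - axis i 1)"
  shows "lazy_op f x = lazy_op g x"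
  unfolding lazy_op_def using assms by simp

lemma lazy_op_const [simp]: "lazy_op (\<lambda>_. c) x = c"
  by (simp add: lazy_op_def)

lemma lazy_op_add: "lazy_op (\<lambda>y. f y + g y) x = lazy_op f x + lazy_op g x"
  by (simp add: lazy_op_def sum.distrib add_divide_distrib)

lemma lazy_op_cmult: "lazy_op (\<lambda>y. c * f y) x = c * lazy_op f x"
  by (simp add: lazy_op_def sum_distrib_left sum_divide_distrib algebra_simps)

lemma lazy_op_diff: "lazy_op (\<lambda>y. f y - g y) x = lazy_op f x - lazy_op g x"
  using lazy_op_add[of f "\<lambda>y. (-1) * g y" x] lazy_op_cmult[of "-1" g x] by simp

lemma lazy_op_minus: "lazy_op (\<lambda>y. - f y) x = - lazy_op f x"
  using lazy_op_cmult[of "-1" f x] by simp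

lemma lazy_op_sum: "lazy_op (\<lambda>y. \<Sum>j\<in>J. f j y) x = (\<Sum>j\<in>J. lazy_op (f j) x)"
  by (induction J rule: infinite_finite_induct) (auto simp: lazy_op_add)

lemma lazy_op_nonneg: "(\<And>y. 0 \<le> f y) \<Longrightarrow> 0 \<le> lazy_op f x"
  using lazy_op_mono[of "\<lambda>_. 0" f x] by simp

lemma lazy_op_abs_le: "\<bar>lazy_op f x\<bar> \<le> lazy_op (\<lambda>y. \<bar>f y\<bar>) x"
  using lazy_op_mono[of f "\<lambda>y. \<bar>f y\<bar>" x] lazy_op_mono[of "\<lambda>y. - f y" "\<lambda>y. \<bar>f y\<bar>" x]
  by (simp add: lazy_op_minus abs_le_iff)

text \<open>In terms of the lazy walk Y, \<open>surv V n f x\<close> is the expectation of f (Y n) on the event that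
  Y 0, ..., Y n all lie in V, for the walk started at x; \<open>occ\<close> below is the expected sum of f along
  the walk up to time n, killed on leaving U.\<close>

fun surv :: "(int ^ 'd) set \<Rightarrow> nat \<Rightarrow> (int ^ 'd \<Rightarrow> real) \<Rightarrow> int ^ 'd \<Rightarrow> real" where
  "surv V 0 f x = (if x \<in> V then f x else 0)"
| "surv V (Suc n) f x = (if x \<in> V then lazy_op (surv V n f) x else 0)"

declare surv.simps(2) [simp del]
lemmas surv_Suc = surv.simps(2)

lemma surv_outside [simp]: "x \<notin> V \<Longrightarrow> surv V n f x = 0"
  by (cases n) (auto simp: surv_Suc)

lemma surv_mono: "(\<And>y. y \<in> V \<Longrightarrow> f y \<le> g y) \<Longrightarrow> surv V n f x \<le> surv V n g x"
  by (induction n arbitrary: x) (auto simp: surv_Suc intro: lazy_op_mono)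

lemma surv_add: "surv V n (\<lambda>y. f y + g y) x = surv V n f x + surv V n g x"
  by (induction n arbitrary: x) (auto simp: surv_Suc lazy_op_add[symmetric] intro!: lazy_op_cong_local)

lemma surv_cmult: "surv V n (\<lambda>y. c * f y) x = c * surv V n f x"
  by (induction n arbitrary: x) (auto simp: surv_Suc lazy_op_cmult[symmetric] intro!: lazy_op_cong_local)

lemma surv_zero [simp]: "surv V n (\<lambda>_. 0) x = 0"
  using surv_cmult[of V n 0 "\<lambda>_. 0"] by simp

lemma surv_sum: "surv V n (\<lambda>y. \<Sum>j\<in>J. f j y) x = (\<Sum>j\<in>J. surv V n (f j) x)"
  by (induction J rule: infinite_finite_induct) (auto simp: surv_add)

lemma surv_minus: "surv V n (\<lambda>y. - f y) x = - surv V n f x"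
  using surv_cmult[of V n "-1" f x] by simp

lemma surv_diff: "surv V n (\<lambda>y. f y - g y) x = surv V n f x - surv V n g x"
  using surv_add[of V n f "\<lambda>y. - g y" x] by (simp add: surv_minus)

lemma surv_nonneg: "(\<And>y. y \<in> V \<Longrightarrow> 0 \<le> f y) \<Longrightarrow> 0 \<le> surv V n f x"
  using surv_mono[of V "\<lambda>_. 0" f n x] by simp

lemma surv_set_mono:
  assumes "V \<subseteq> W" "\<And>y. 0 \<le> f y"
  shows "surv V n f x \<le> surv W n f x"
proof (induction n arbitrary: x)
  case 0
  then show ?case using assms by auto
next
  case (Suc n)
  show ?case
    using assms Suc lazy_op_mono[of "surv V n f" "surv W n f" x]
    by (auto simp: surv_Suc intro!: lazy_op_nonneg surv_nonneg)
qed

lemma surv_const_le: "0 \<le> c \<Longrightarrow> surv V n (\<lambda>_. c) x \<le> c"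
proof (induction n arbitrary: x)
  case (Suc n)
  then show ?case using lazy_op_mono[of "surv V n (\<lambda>_. c)" "\<lambda>_. c" x] by (auto simp: surv_Suc)
qed auto

lemma surv_le_const:
  assumes "\<And>y. y \<in> V \<Longrightarrow> f y \<le> c" "0 \<le> c"
  shows "surv V n f x \<le> c"
  by (rule order_trans[OF surv_mono[of V f "\<lambda>_. c"] surv_const_le]) (use assms in auto)

text \<open>The Markov property at time \<open>m\<close>; both factors check that the walk is in
  \<open>V\<close> at that time.\<close>

lemma surv_surv: "surv V (m + n) f x = surv V m (surv V n f) x"
proof (induction m arbitrary: x)
  case (Suc m)
  have "surv V (m + n) f = surv V m (surv V n f)" using Suc by auto
  then show ?case by (simp add: surv_Suc)
qed auto

lemma surv_Suc_one_le: "surv V (Suc n) (\<lambda>_. 1) x \<le> surv V n (\<lambda>_. 1) x"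
proof -
  have "surv V (Suc n) (\<lambda>_. 1) x = surv V n (surv V 1 (\<lambda>_. 1)) x"
    using surv_surv[of V n 1] by simp
  also have "\<dots> \<le> surv V n (\<lambda>_. 1) x"
    by (intro surv_mono surv_const_le) auto
  finally show ?thesis .
qed

lemma surv_abs_le: "\<bar>surv V n f x\<bar> \<le> surv V n (\<lambda>y. \<bar>f y\<bar>) x"
  using surv_mono[of V f "\<lambda>y. \<bar>f y\<bar>" n x] surv_mono[of V "\<lambda>y. - f y" "\<lambda>y. \<bar>f y\<bar>" n x]
  by (simp add: surv_minus abs_le_iff)

section \<open>Occupation sums and comparison principles\<close>

definition occ :: "(int ^ 'd) set \<Rightarrow> nat \<Rightarrow> (int ^ 'd \<Rightarrow> real) \<Rightarrow> int ^ 'd \<Rightarrow> real" where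
  "occ U n f x = (\<Sum>t<n. surv U t f x)"

lemma occ_outside [simp]: "x \<notin> U \<Longrightarrow> occ U n f x = 0"
  by (simp add: occ_def)

lemma occ_0 [simp]: "occ U 0 f x = 0"
  by (simp add: occ_def)

lemma occ_Suc: "x \<in> U \<Longrightarrow> occ U (Suc n) f x = f x + lazy_op (occ U n f) x"
  unfolding occ_def lazy_op_sum sum.lessThan_Suc_shift by (simp add: surv_Suc)

lemma occ_mono: "(\<And>y. y \<in> U \<Longrightarrow> f y \<le> g y) \<Longrightarrow> occ U n f x \<le> occ U n g x"
  unfolding occ_def by (intro sum_mono surv_mono)

lemma occ_add: "occ U n (\<lambda>y. f y + g y) x = occ U n f x + occ U n g x"
  by (simp add: occ_def surv_add sum.distrib)

lemma occ_cmult: "occ U n (\<lambda>y. c * f y) x = c * occ U n f x"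
  by (simp add: occ_def surv_cmult sum_distrib_left)

lemma occ_minus: "occ U n (\<lambda>y. - f y) x = - occ U n f x"
  by (simp add: occ_def surv_minus sum_negf)

lemma occ_diff: "occ U n (\<lambda>y. f y - g y) x = occ U n f x - occ U n g x"
  by (simp add: occ_def surv_diff sum_subtractf)

lemma occ_sum: "occ U n (\<lambda>y. \<Sum>j\<in>J. f j y) x = (\<Sum>j\<in>J. occ U n (f j) x)"
  unfolding occ_def surv_sum by (rule sum.swap)

lemma occ_const: "occ U n (\<lambda>y. c) x = c * occ U n (\<lambda>_. 1) x"
  using occ_cmult[of U n c "\<lambda>_. 1" x] by simp

lemma occ_nonneg: "(\<And>y. y \<in> U \<Longrightarrow> 0 \<le> f y) \<Longrightarrow> 0 \<le> occ U n f x"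
  unfolding occ_def by (intro sum_nonneg surv_nonneg)

lemma occ_abs_le: "\<bar>occ U n f x\<bar> \<le> occ U n (\<lambda>y. \<bar>f y\<bar>) x"
  unfolding occ_def by (intro order_trans[OF sum_abs] sum_mono surv_abs_le)

text \<open>\<open>C\<close> holds \<open>U\<close> together with all lattice neighbours of
  \<open>U\<close>. The comparison principles ask for boundary information on \<open>C\<close> only;
  this matters because the cosine products vanish on the faces of the box but not everywhere beyond
  them.\<close>

definition nbr_closed :: "(int ^ 'd) set \<Rightarrow> (int ^ 'd) set \<Rightarrow> bool" where
  "nbr_closed U C \<longleftrightarrow> U \<subseteq> C \<and> (\<forall>x\<in>U. \<forall>i. x + axis i 1 \<in> C \<and> x - axis i 1 \<in> C)"

lemma lazy_op_mono_closed:
  assumes "nbr_closed U C" "x \<in> U" "\<And>y. y \<in> C \<Longrightarrow> f y \<le> g y"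
  shows "lazy_op f x \<le> lazy_op g x"
  using assms by (intro lazy_op_mono_local) (auto simp: nbr_closed_def)

lemma lazy_op_cong_closed:
  assumes "nbr_closed U C" "x \<in> U" "\<And>y. y \<in> C \<Longrightarrow> f y = g y"
  shows "lazy_op f x = lazy_op g x"
  using assms by (intro lazy_op_cong_local) (auto simp: nbr_closed_def)

text \<open>The maximum principle: \<open>\<psi>\<close> at the current site plus the sum of
  \<open>f\<close> so far is a supermartingale, and the non-negative value of \<open>\<psi>\<close>
  at the stopping site is dropped. Truncation at \<open>n\<close> makes this an induction on the
  number of steps.\<close>

lemma occ_le_supersolution:
  assumes C: "nbr_closed U C" and nonneg: "\<And>y. y \<in> C \<Longrightarrow> 0 \<le> \<psi> y"
    and super: "\<And>y. y \<in> U \<Longrightarrow> f y \<le> \<psi> y - lazy_op \<psi> y"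
    and "x \<in> C"
  shows "occ U n f x \<le> \<psi> x"
  using \<open>x \<in> C\<close>
proof (induction n arbitrary: x)
  case 0
  then show ?case using nonneg by simp
next
  case (Suc n)
  show ?case
  proof (cases "x \<in> U")
    case True
    have "lazy_op (occ U n f) x \<le> lazy_op \<psi> x"
      by (rule lazy_op_mono_closed[OF C True]) (rule Suc.IH)
    then show ?thesis using super[OF True] by (simp add: occ_Suc True)
  qed (use Suc nonneg in auto)
qed

text \<open>Dynkin's formula. The number of steps is finite, so the paths that are still in
  \<open>U\<close> contribute the remainder \<open>surv U n \<psi> x\<close>.\<close>

lemma occ_telescope:
  assumes C: "nbr_closed U C" and zero: "\<And>y. y \<in> C \<Longrightarrow> y \<notin> U \<Longrightarrow> \<psi> y = 0"
    and g: "\<And>y. y \<in> U \<Longrightarrow> g y = \<psi> y - lazy_op \<psi> y"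
    and "x \<in> C"
  shows "\<psi> x = occ U n g x + surv U n \<psi> x"
  using \<open>x \<in> C\<close>
proof (induction n arbitrary: x)
  case 0
  then show ?case using zero by simp
next
  case (Suc n)
  show ?case
  proof (cases "x \<in> U")
    case True
    have "lazy_op \<psi> x = lazy_op (\<lambda>y. occ U n g y + surv U n \<psi> y) x"
      by (rule lazy_op_cong_closed[OF C True]) (rule Suc.IH)
    then show ?thesis using g[OF True] by (simp add: occ_Suc True surv_Suc lazy_op_add)
  qed (use Suc zero in auto)
qed

text \<open>The comparison in the other direction. A path still in \<open>U\<close> after
  \<open>n\<close> steps has no boundary value to use; there the bound by one is paid for with the
  survival probability.\<close>

lemma subsolution_le_occ:
  assumes C: "nbr_closed U C" and bdry: "\<And>y. y \<in> C \<Longrightarrow> y \<notin> U \<Longrightarrow> \<psi> y \<le> 0"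
    and one: "\<And>y. y \<in> U \<Longrightarrow> \<psi> y \<le> 1"
    and sub: "\<And>y. y \<in> U \<Longrightarrow> \<psi> y \<le> lazy_op \<psi> y + f y"
    and "x \<in> C"
  shows "\<psi> x \<le> occ U n f x + surv U n (\<lambda>_. 1) x"
  using \<open>x \<in> C\<close>
proof (induction n arbitrary: x)
  case 0
  then show ?case using bdry one by auto
next
  case (Suc n)
  show ?case
  proof (cases "x \<in> U")
    case True
    have "lazy_op \<psi> x \<le> lazy_op (\<lambda>y. occ U n f y + surv U n (\<lambda>_. 1) y) x"
      by (rule lazy_op_mono_closed[OF C True]) (rule Suc.IH)
    then show ?thesis using sub[OF True] by (simp add: occ_Suc True surv_Suc lazy_op_add)
  qed (use Suc bdry in auto)
qed

text \<open>Survival probabilities decrease in time, so each of the first \<open>n\<close> is at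
  least the one at time \<open>n\<close>.\<close>

lemma surv_one_le_occ: "real n * surv U n (\<lambda>_. 1) x \<le> occ U n (\<lambda>_. 1) x"
proof -
  have anti: "surv U n (\<lambda>_. 1) x \<le> surv U t (\<lambda>_. 1) x" if "t \<le> n" for t
    using that by (induction n rule: dec_induct) (auto intro: order_trans[OF surv_Suc_one_le])
  have "(\<Sum>t<n. surv U n (\<lambda>_. 1) x) \<le> occ U n (\<lambda>_. 1) x"
    unfolding occ_def by (intro sum_mono anti) auto
  then show ?thesis by simp
qed

text \<open>Apart from the first \<open>s\<close> terms, every value of \<open>f\<close> is seen
  \<open>s\<close> steps after some time up to which the walk was killed. Dropping the killing
  during these \<open>s\<close> steps makes the free mixing bound \<open>a\<close> available from
  every surviving position.\<close>

lemma occ_le_mixing: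
  assumes "\<And>y. 0 \<le> f y" "\<And>y. f y \<le> c" "\<And>y. surv UNIV s f y \<le> a"
  shows "occ U n f x \<le> real s * c + a * occ U n (\<lambda>_. 1) x"
proof -
  have c0: "0 \<le> c" using assms(1,2)[of 0] by linarith
  have "0 \<le> surv UNIV s f 0" using assms(1) by (intro surv_nonneg)
  with assms(3)[of 0] have a0: "0 \<le> a" by linarith
  have tail: "surv U (t + s) f x \<le> a * surv U t (\<lambda>_. 1) x" for t
  proof -
    have "surv U (t + s) f x = surv U t (surv U s f) x" by (rule surv_surv)
    also have "\<dots> \<le> surv U t (\<lambda>_. a * 1) x"
      by (intro surv_mono order_trans[OF surv_set_mono[of U UNIV]]) (use assms in auto)
    finally show ?thesis by (simp only: surv_cmult)
  qed
  have split: "(\<Sum>t<s. surv U t f x) \<le> real s * c"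
    using sum_mono[of "{..<s}" "\<lambda>t. surv U t f x" "\<lambda>_. c"] surv_le_const[of U f c] assms c0 by auto
  have one0: "0 \<le> surv U t (\<lambda>_. 1) x" for t by (intro surv_nonneg) auto
  \<comment> \<open>Enlarging the sum to \<open>s + n\<close> terms leaves exactly \<open>n\<close>
    shifted terms after the first \<open>s\<close>.\<close>
  have "occ U n f x \<le> (\<Sum>t<s + n. surv U t f x)"
    unfolding occ_def by (intro sum_mono2 surv_nonneg) (use assms in auto)
  also have "\<dots> = (\<Sum>t<s. surv U t f x) + (\<Sum>t<n. surv U (t + s) f x)"
    by (induction n) (auto simp: add.commute add.left_commute)
  also have "\<dots> \<le> real s * c + (\<Sum>t<n. a * surv U t (\<lambda>_. 1) x)"
    by (intro add_mono split sum_mono tail)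
  finally show ?thesis by (simp add: occ_def sum_distrib_left)
qed

section \<open>Boxes and quadratic barriers\<close>

definition zbox :: "int \<Rightarrow> (int ^ 'd) set" where
  "zbox l = {x. \<forall>i. - l < x $ i \<and> x $ i < l}"

definition czbox :: "int \<Rightarrow> (int ^ 'd) set" where
  "czbox l = {x. \<forall>i. - l \<le> x $ i \<and> x $ i \<le> l}"

lemma nbr_closed_zbox: "nbr_closed (zbox l - D) (czbox l)"
proof -
  have "- l \<le> (x + axis i 1) $ j \<and> (x + axis i 1) $ j \<le> l \<and> - l \<le> (x - axis i 1) $ j \<and> (x - axis i 1) $ j \<le> l"
    if "x \<in> zbox l" for x :: "int ^ 'd" and i j
    using that[unfolded zbox_def, simplified, rule_format, of j] by (auto simp: axis_def)
  then show ?thesis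
    unfolding nbr_closed_def czbox_def by (auto simp: zbox_def less_imp_le)
qed

text \<open>A given coordinate moves with probability 1/(2d) in one step, half of it in each
  direction, which gives a second difference with factor 1/(4d).\<close>

lemma lazy_op_coord:
  fixes x :: "int ^ 'd"
  shows "lazy_op (\<lambda>x. F (x $ i)) x = F (x $ i) + (F (x $ i + 1) + F (x $ i - 1) - 2 * F (x $ i)) / (4 * real CARD('d))"
proof -
  have *: "F ((x + axis j 1) $ i) + F ((x - axis j 1) $ i) =
      2 * F (x $ i) + (if j = i then F (x $ i + 1) + F (x $ i - 1) - 2 * F (x $ i) else 0)" for j
    by (auto simp: axis_def)
  show ?thesis
    unfolding lazy_op_def * by (simp add: sum.distrib field_simps)
qed

lemma occ_one_le:
  fixes x :: "int ^ 'd"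
  assumes "x \<in> czbox l"
  shows "occ (zbox l - D) n (\<lambda>_. 1) x \<le> 2 * real CARD('d) * (real_of_int l)\<^sup>2"
proof -
  \<comment> \<open>One coordinate suffices. Its square grows by 1/(2d) per step on average, hence
    the factor 2d in the barrier.\<close>
  fix i :: 'd
  let ?F = "\<lambda>y::int. 2 * real CARD('d) * ((real_of_int l)\<^sup>2 - (real_of_int y)\<^sup>2)"
  have sq: "(real_of_int (y $ i))\<^sup>2 \<le> (real_of_int l)\<^sup>2" if "y \<in> czbox l" for y :: "int ^ 'd"
  proof -
    have "\<bar>y $ i\<bar> \<le> l"
      using that[unfolded czbox_def, simplified, rule_format, of i] by linarith
    then have "\<bar>real_of_int (y $ i)\<bar> \<le> \<bar>real_of_int l\<bar>" by linarith
    then show ?thesis by (simp only: abs_le_square_iff)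
  qed
  have "occ (zbox l - D) n (\<lambda>_. 1) x \<le> ?F (x $ i)"
  proof (rule occ_le_supersolution[OF nbr_closed_zbox _ _ assms, of "\<lambda>x. ?F (x $ i)"])
    show "0 \<le> ?F (y $ i)" if "y \<in> czbox l" for y :: "int ^ 'd"
      using sq[OF that] by simp
    show "1 \<le> ?F (y $ i) - lazy_op (\<lambda>x. ?F (x $ i)) y" for y :: "int ^ 'd"
      by (subst lazy_op_coord) (simp add: field_simps power2_eq_square)
  qed
  also have "\<dots> \<le> 2 * real CARD('d) * (real_of_int l)\<^sup>2"
    by (simp add: algebra_simps)
  finally show ?thesis .
qed

text \<open>A convex barrier, zero on [-l, l] and quadratic beyond. Its negative counts visits to a
  boundary layer; the function itself bounds the chance of travelling far outside a box.\<close>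

definition excess :: "int \<Rightarrow> int \<Rightarrow> real" where
  "excess l y = (real_of_int (max 0 (\<bar>y\<bar> - l)))\<^sup>2"

lemma excess_second_difference:
  assumes "0 \<le> l"
  shows "(if l \<le> \<bar>y\<bar> then 1 else 0) \<le> excess l (y + 1) + excess l (y - 1) - 2 * excess l y"
    and "excess l (y + 1) + excess l (y - 1) - 2 * excess l y \<le> 2"
proof -
  \<comment> \<open>An integer copy, which makes the case distinction pure integer
    arithmetic.\<close>
  define E where "E z = (max 0 (\<bar>z\<bar> - l))\<^sup>2" for z
  have ex: "excess l z = real_of_int (E z)" for z by (simp add: excess_def E_def)
  consider "\<bar>y\<bar> < l" | "y = l" "l > 0" | "y = - l" "l > 0" | "y > l" | "y < - l" | "y = 0" "l = 0"
    using assms by linarith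
  then have "(if l \<le> \<bar>y\<bar> then 1 else 0) \<le> E (y + 1) + E (y - 1) - 2 * E y \<and> E (y + 1) + E (y - 1) - 2 * E y \<le> 2"
  proof cases
    case 1
    then have "E (y+1) = 0" "E (y-1) = 0" "E y = 0" by (auto simp: E_def max_def)
    then show ?thesis using 1 by simp
  next
    case 4
    then have "E (y+1) = (y + 1 - l)\<^sup>2" "E (y-1) = (y - 1 - l)\<^sup>2" "E y = (y - l)\<^sup>2"
      using assms by (auto simp: E_def max_def)
    then show ?thesis by (simp add: power2_eq_square algebra_simps)
  next
    case 5
    then have "max 0 (\<bar>y + 1\<bar> - l) = - (y + 1 + l)" "max 0 (\<bar>y - 1\<bar> - l) = - (y - 1 + l)" "max 0 (\<bar>y\<bar> - l) = - (y + l)"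
      using assms by auto
    then have "E (y+1) = (y + 1 + l)\<^sup>2" "E (y-1) = (y - 1 + l)\<^sup>2" "E y = (y + l)\<^sup>2"
      unfolding E_def by (simp_all only: power2_minus)
    then show ?thesis by (simp add: power2_eq_square algebra_simps)
  qed (auto simp: E_def max_def)
  then have "real_of_int (if l \<le> \<bar>y\<bar> then 1 else 0) \<le> real_of_int (E (y + 1) + E (y - 1) - 2 * E y)"
    and "real_of_int (E (y + 1) + E (y - 1) - 2 * E y) \<le> real_of_int 2"
    unfolding of_int_le_iff by auto
  then show "(if l \<le> \<bar>y\<bar> then 1 else 0) \<le> excess l (y + 1) + excess l (y - 1) - 2 * excess l y"
    and "excess l (y + 1) + excess l (y - 1) - 2 * excess l y \<le> 2"
    by (auto simp: ex split: if_splits)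
qed

text \<open>The bound depends on the width of the layer and not on the size of the box, since the
  barrier is constant away from the layer. It absorbs the poor approximation of 1 by cosine
  polynomials near the faces.\<close>

lemma occ_layer_le:
  fixes x :: "int ^ 'd"
  assumes "x \<in> czbox l" "0 \<le> k" "k \<le> l"
  shows "occ (zbox l - D) n (\<lambda>y. if k \<le> \<bar>y $ i\<bar> then 1 else 0) x \<le> 4 * real CARD('d) * (real_of_int (l - k))\<^sup>2"
proof -
  let ?F = "\<lambda>y::int. 4 * real CARD('d) * ((real_of_int (l - k))\<^sup>2 - excess k y)"
  have sq: "excess k (y $ i) \<le> (real_of_int (l - k))\<^sup>2" if "y \<in> czbox l" for y :: "int ^ 'd"
  proof -
    have "\<bar>y $ i\<bar> \<le> l"
      using that[unfolded czbox_def, simplified, rule_format, of i] by linarith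
    then show ?thesis unfolding excess_def using assms by (intro power_mono) auto
  qed
  have "occ (zbox l - D) n (\<lambda>y. if k \<le> \<bar>y $ i\<bar> then 1 else 0) x \<le> ?F (x $ i)"
  proof (rule occ_le_supersolution[OF nbr_closed_zbox _ _ assms(1), of "\<lambda>x. ?F (x $ i)"])
    show "0 \<le> ?F (y $ i)" if "y \<in> czbox l" for y :: "int ^ 'd"
      using sq[OF that] by simp
    show "(if k \<le> \<bar>y $ i\<bar> then 1 else 0) \<le> ?F (y $ i) - lazy_op (\<lambda>x. ?F (x $ i)) y" for y :: "int ^ 'd"
    proof -
      have "?F (y $ i) - lazy_op (\<lambda>x. ?F (x $ i)) y =
          excess k (y $ i + 1) + excess k (y $ i - 1) - 2 * excess k (y $ i)"
        by (subst lazy_op_coord) (simp add: field_simps)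
      then show ?thesis using excess_second_difference(1)[OF assms(2), of "y $ i"] by simp
    qed
  qed
  also have "\<dots> \<le> 4 * real CARD('d) * (real_of_int (l - k))\<^sup>2"
    by (simp add: excess_def)
  finally show ?thesis .
qed

section \<open>Heat kernel bound on the torus\<close>

definition pcell :: "nat \<Rightarrow> (int ^ 'd) set" where
  "pcell N = {y. \<forall>i. 0 \<le> y $ i \<and> y $ i < int N}"

definition cell_avg :: "nat \<Rightarrow> (int ^ 'd \<Rightarrow> real) \<Rightarrow> real" where
  "cell_avg N f = (\<Sum>y\<in>pcell N. f y) / real N ^ CARD('d)"

text \<open>The torus is not formed as a quotient: its functions are the periodic functions on the
  lattice, on which the walk operator already acts, and sums over it are sums over
  \<open>pcell N\<close>.\<close>

definition periodic :: "nat \<Rightarrow> (int ^ 'd \<Rightarrow> real) \<Rightarrow> bool" where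
  "periodic N f \<longleftrightarrow> (\<forall>x y. (\<forall>i. x $ i mod int N = y $ i mod int N) \<longrightarrow> f x = f y)"

lemma pcell_eq_image: "pcell N = vec_lambda ` (PiE UNIV (\<lambda>_. {0..<int N}))"
proof (intro equalityI subsetI)
  fix y :: "int ^ 'd" assume y: "y \<in> pcell N"
  have "y = vec_lambda (vec_nth y)" by simp
  then show "y \<in> vec_lambda ` (PiE UNIV (\<lambda>_. {0..<int N}))"
    using y by (intro image_eqI[where x = "vec_nth y"]) (auto simp: pcell_def)
qed (auto simp: pcell_def)

lemma finite_pcell [simp]: "finite (pcell N)"
  unfolding pcell_eq_image by (intro finite_imageI finite_PiE) auto

lemma sum_pcell_prod:
  fixes F :: "'d::finite \<Rightarrow> int \<Rightarrow> 'a::comm_semiring_1"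
  shows "(\<Sum>y\<in>pcell N. \<Prod>i\<in>UNIV. F i (y $ i)) = (\<Prod>i\<in>UNIV. \<Sum>k\<in>{0..<int N}. F i k)"
proof -
  have inj: "inj_on vec_lambda (PiE (UNIV::'d set) (\<lambda>_. {0..<int N}))"
    by (auto simp: inj_on_def vec_lambda_inject)
  have "(\<Prod>i\<in>UNIV. \<Sum>k\<in>{0..<int N}. F i k) = (\<Sum>g\<in>PiE UNIV (\<lambda>_. {0..<int N}). \<Prod>i\<in>UNIV. F i (g i))"
    by (rule prod_sum_PiE) auto
  also have "\<dots> = (\<Sum>y\<in>pcell N. \<Prod>i\<in>UNIV. F i (y $ i))"
    unfolding pcell_eq_image by (subst sum.reindex[OF inj]) simp
  finally show ?thesis by simp
qed

text \<open>A geometric sum over the powers of an N-th root of unity, which is 1 exactly if N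
  divides \<open>z\<close>.\<close>

lemma sum_cis_residues:
  assumes "N > 0"
  shows "(\<Sum>k\<in>{0..<int N}. cis (2 * pi * real_of_int k * real_of_int z / real N)) =
    (if z mod int N = 0 then of_nat N else 0)"
proof -
  define w where "w = cis (2 * pi * real_of_int z / real N)"
  have "(\<Sum>k\<in>{0..<int N}. cis (2 * pi * real_of_int k * real_of_int z / real N)) =
      (\<Sum>k<N. cis (2 * pi * real k * real_of_int z / real N))"
    by (rule sum.reindex_bij_witness[of _ int nat]) auto
  also have "\<dots> = (\<Sum>k<N. w ^ k)"
    unfolding w_def Complex.DeMoivre by (intro sum.cong refl arg_cong[where f = cis]) simp
  finally have eq: "(\<Sum>k\<in>{0..<int N}. cis (2 * pi * real_of_int k * real_of_int z / real N)) = (\<Sum>k<N. w ^ k)" .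
  show ?thesis
  proof (cases "z mod int N = 0")
    case True
    then obtain q where "z = int N * q" by (auto simp: mod_eq_0_iff_dvd elim: dvdE)
    then have "2 * pi * real_of_int z / real N = 2 * pi * of_int q" using assms by simp
    then have "w = 1" by (simp only: w_def cis_multiple_2pi[OF Ints_of_int])
    then show ?thesis using True by (simp add: eq)
  next
    case False
    have "w \<noteq> 1"
    proof
      assume "w = 1"
      then have "cos (2 * pi * real_of_int z / real N) = 1" by (simp add: w_def complex_eq_iff)
      then obtain q :: int where "2 * pi * real_of_int z / real N = of_int q * 2 * pi"
        by (auto simp: cos_one_2pi_int)
      then have "real_of_int z = real_of_int (q * int N)" using assms by (simp add: field_simps)
      then have "z = q * int N" by (simp only: of_int_eq_iff)
      then show False using False by simp
    qed
    moreover have "w ^ N = 1"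
      using assms cis_multiple_2pi[of "of_int z"] by (simp add: w_def Complex.DeMoivre)
    ultimately show ?thesis using False by (simp add: eq geometric_sum)
  qed
qed

definition dotp :: "int ^ 'd \<Rightarrow> int ^ 'd \<Rightarrow> real" where
  "dotp x y = (\<Sum>i\<in>UNIV. real_of_int (x $ i) * real_of_int (y $ i))"

lemma cis_sum: "finite A \<Longrightarrow> cis (\<Sum>i\<in>A. f i) = (\<Prod>i\<in>A. cis (f i))"
  by (induction A rule: finite_induct) (simp_all flip: cis_mult)

lemma sum_cos_pcell:
  fixes z :: "int ^ 'd"
  assumes "N > 0"
  shows "(\<Sum>y\<in>pcell N. cos (2 * pi / real N * dotp y z)) =
    (if \<forall>i. z $ i mod int N = 0 then real N ^ CARD('d) else 0)"
proof -
  have "complex_of_real (\<Sum>y\<in>pcell N. cos (2 * pi / real N * dotp y z)) =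
      complex_of_real (Re (\<Sum>y\<in>pcell N. cis (2 * pi / real N * dotp y z)))"
    by simp
  also have "(\<Sum>y\<in>pcell N. cis (2 * pi / real N * dotp y z)) =
      (\<Sum>y\<in>pcell N. \<Prod>i\<in>UNIV. cis (2 * pi * real_of_int (y $ i) * real_of_int (z $ i) / real N))"
    by (intro sum.cong refl) (simp add: dotp_def sum_distrib_left cis_sum[symmetric] mult_ac)
  also have "\<dots> = (\<Prod>i\<in>UNIV. \<Sum>k\<in>{0..<int N}. cis (2 * pi * real_of_int k * real_of_int (z $ i) / real N))"
    by (rule sum_pcell_prod)
  also have "\<dots> = (if \<forall>i. z $ i mod int N = 0 then of_nat N ^ CARD('d) else 0)"
    unfolding sum_cis_residues[OF assms] by (auto simp: prod_zero_iff)
  also have "complex_of_real (Re \<dots>) = complex_of_real (if \<forall>i. z $ i mod int N = 0 then real N ^ CARD('d) else 0)"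
    by (auto simp flip: of_nat_power)
  finally show ?thesis by (simp only: of_real_eq_iff)
qed

definition reduce :: "nat \<Rightarrow> int ^ 'd \<Rightarrow> int ^ 'd" where
  "reduce N x = (\<chi> i. x $ i mod int N)"

lemma reduce_in_pcell: "N > 0 \<Longrightarrow> reduce N x \<in> pcell N"
  by (auto simp: reduce_def pcell_def)

lemma periodic_reduce: "periodic N f \<Longrightarrow> f (reduce N x) = f x"
proof -
  assume *: "periodic N f"
  have "\<forall>i. reduce N x $ i mod int N = x $ i mod int N" by (simp add: reduce_def)
  then show ?thesis using * unfolding periodic_def by blast
qed

text \<open>Orthogonality of characters: the inner sum is N^d if \<open>y\<close> is congruent to
  \<open>x\<close> and 0 otherwise. Cosines can replace complex characters because the step
  distribution is symmetric, so that each shifted cosine is an eigenfunction by itself.\<close>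

lemma periodic_Fourier:
  fixes f :: "int ^ 'd \<Rightarrow> real"
  assumes "N > 0" "periodic N f"
  shows "f x = (\<Sum>y\<in>pcell N. f y / real N ^ CARD('d) * (\<Sum>\<xi>\<in>pcell N. cos (2 * pi / real N * dotp \<xi> (x - y))))"
proof -
  have "(\<forall>i. (x - y) $ i mod int N = 0) \<longleftrightarrow> y = reduce N x" if "y \<in> pcell N" for y
  proof -
    have "(x - y) $ i mod int N = 0 \<longleftrightarrow> y $ i = x $ i mod int N" for i
    proof -
      have "y $ i mod int N = y $ i" using that by (simp add: pcell_def)
      then show ?thesis using mod_eq_dvd_iff[of "x $ i" "int N" "y $ i"] by (auto simp: mod_eq_0_iff_dvd)
    qed
    then show ?thesis by (auto simp: reduce_def vec_eq_iff)
  qed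
  then have "(\<Sum>y\<in>pcell N. f y / real N ^ CARD('d) * (\<Sum>\<xi>\<in>pcell N. cos (2 * pi / real N * dotp \<xi> (x - y)))) =
      (\<Sum>y\<in>pcell N. if y = reduce N x then f y else 0)"
    unfolding sum_cos_pcell[OF assms(1)] using assms(1) by (intro sum.cong refl) auto
  also have "\<dots> = f x"
    using reduce_in_pcell[OF assms(1), of x] periodic_reduce[OF assms(2), of x] by (simp add: sum.delta)
  finally show ?thesis by simp
qed

text \<open>The eigenvalue of the lazy walk at the frequency \<open>\<xi>\<close>.\<close>

definition torus_symbol :: "nat \<Rightarrow> int ^ 'd \<Rightarrow> real" where
  "torus_symbol N \<xi> = 1 / 2 + (\<Sum>i\<in>UNIV. cos (2 * pi / real N * real_of_int (\<xi> $ i))) / (2 * real CARD('d))"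

lemma dotp_axis: "dotp \<xi> (x + axis i 1) = dotp \<xi> x + real_of_int (\<xi> $ i)" "dotp \<xi> (x - axis i 1) = dotp \<xi> x - real_of_int (\<xi> $ i)"
proof -
  have *: "(\<Sum>j\<in>UNIV. real_of_int (\<xi> $ j) * real_of_int (axis i 1 $ j)) = real_of_int (\<xi> $ i)"
    by (simp add: axis_def if_distrib sum.delta' cong: if_cong)
  show "dotp \<xi> (x + axis i 1) = dotp \<xi> x + real_of_int (\<xi> $ i)" "dotp \<xi> (x - axis i 1) = dotp \<xi> x - real_of_int (\<xi> $ i)"
    using * by (simp_all add: dotp_def algebra_simps sum.distrib sum_subtractf)
qed

lemma dotp_diff: "dotp \<xi> (x - y) = dotp \<xi> x - dotp \<xi> y"
  by (simp add: dotp_def algebra_simps sum_subtractf)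

lemma lazy_op_cos: "lazy_op (\<lambda>x. cos (2 * pi / real N * dotp \<xi> (x - y))) x = torus_symbol N \<xi> * cos (2 * pi / real N * dotp \<xi> (x - y))"
proof -
  define a where "a = 2 * pi / real N"
  define v where "v = cos (a * dotp \<xi> (x - y))"
  have "cos (a * dotp \<xi> (x + axis i 1 - y)) + cos (a * dotp \<xi> (x - axis i 1 - y)) = 2 * v * cos (a * real_of_int (\<xi> $ i))" for i
  proof -
    have "a * dotp \<xi> (x + axis i 1 - y) = a * dotp \<xi> (x - y) + a * real_of_int (\<xi> $ i)"
      "a * dotp \<xi> (x - axis i 1 - y) = a * dotp \<xi> (x - y) - a * real_of_int (\<xi> $ i)"
      unfolding dotp_diff[of \<xi> "x + axis i 1" y] dotp_diff[of \<xi> "x - axis i 1" y] dotp_axis[of \<xi> x i] dotp_diff[of \<xi> x y]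
      by (simp_all add: algebra_simps)
    then show ?thesis by (simp add: cos_add cos_diff v_def)
  qed
  then have "lazy_op (\<lambda>x. cos (a * dotp \<xi> (x - y))) x = v / 2 + (\<Sum>i\<in>UNIV. 2 * v * cos (a * real_of_int (\<xi> $ i))) / (4 * real CARD('a))"
    unfolding lazy_op_def by (simp add: v_def)
  also have "\<dots> = torus_symbol N \<xi> * v"
    unfolding torus_symbol_def a_def[symmetric] sum_distrib_left[symmetric] by (simp add: field_simps)
  finally show ?thesis unfolding a_def v_def .
qed

lemma surv_cos: "surv UNIV t (\<lambda>x. cos (2 * pi / real N * dotp \<xi> (x - y))) x = torus_symbol N \<xi> ^ t * cos (2 * pi / real N * dotp \<xi> (x - y))"
proof (induction t arbitrary: x)
  case (Suc t)
  have "surv UNIV t (\<lambda>x. cos (2 * pi / real N * dotp \<xi> (x - y))) = (\<lambda>x. torus_symbol N \<xi> ^ t * cos (2 * pi / real N * dotp \<xi> (x - y)))"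
    using Suc by auto
  then show ?case by (simp only: surv_Suc lazy_op_cmult lazy_op_cos) simp
qed auto

text \<open>Laziness excludes negative eigenvalues; only then can the upper bound that follows be
  raised to the power \<open>t\<close>.\<close>

lemma torus_symbol_nonneg: "0 \<le> torus_symbol N (\<xi> :: int ^ 'd)"
proof -
  have "(\<Sum>i\<in>(UNIV::'d set). - 1) \<le> (\<Sum>i\<in>UNIV. cos (2 * pi / real N * real_of_int (\<xi> $ i)))"
    by (intro sum_mono) auto
  then show ?thesis by (simp add: torus_symbol_def field_simps)
qed

text \<open>Bounding 1 + s by exp s turns the sum over coordinates into a product, so that the sum
  over all frequencies factors into one-dimensional sums.\<close>

lemma torus_symbol_le: "torus_symbol N (\<xi> :: int ^ 'd) \<le> (\<Prod>i\<in>UNIV. exp (- (1 - cos (2 * pi / real N * real_of_int (\<xi> $ i))) / (2 * real CARD('d))))"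
proof -
  have "torus_symbol N \<xi> = 1 + (\<Sum>i\<in>UNIV. - (1 - cos (2 * pi / real N * real_of_int (\<xi> $ i))) / (2 * real CARD('d)))"
    unfolding torus_symbol_def by (simp add: sum_subtractf sum_divide_distrib diff_divide_distrib)
  also have "\<dots> \<le> exp (\<Sum>i\<in>UNIV. - (1 - cos (2 * pi / real N * real_of_int (\<xi> $ i))) / (2 * real CARD('d)))"
    by (rule exp_ge_add_one_self)
  finally show ?thesis by (simp add: exp_sum)
qed

lemma surv_periodic_le_Fourier:
  fixes f :: "int ^ 'd \<Rightarrow> real"
  assumes "N > 0" "periodic N f" "\<And>y. 0 \<le> f y"
  shows "surv UNIV t f x \<le> cell_avg N f *
     (\<Sum>k\<in>{0..<int N}. exp (- real t * (1 - cos (2 * pi / real N * real_of_int k)) / (2 * real CARD('d)))) ^ CARD('d)"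
proof -
  let ?e = "\<lambda>k::int. exp (- real t * (1 - cos (2 * pi / real N * real_of_int k)) / (2 * real CARD('d)))"
  have eq: "f = (\<lambda>x. \<Sum>y\<in>pcell N. f y / real N ^ CARD('d) * (\<Sum>\<xi>\<in>pcell N. cos (2 * pi / real N * dotp \<xi> (x - y))))"
    by (rule ext) (rule periodic_Fourier[OF assms(1,2)])
  have "surv UNIV t f x = (\<Sum>y\<in>pcell N. f y / real N ^ CARD('d) * (\<Sum>\<xi>\<in>pcell N. torus_symbol N \<xi> ^ t * cos (2 * pi / real N * dotp \<xi> (x - y))))"
    by (subst eq) (simp only: surv_sum surv_cmult surv_cos)
  also have "\<dots> \<le> (\<Sum>y\<in>pcell N. f y / real N ^ CARD('d) * (\<Sum>\<xi>\<in>(pcell N :: (int ^ 'd) set). \<Prod>i\<in>UNIV. ?e (\<xi> $ i)))"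
  proof -
    have main: "torus_symbol N \<xi> ^ t * cos (2 * pi / real N * dotp \<xi> (x - y)) \<le> (\<Prod>i\<in>UNIV. ?e (\<xi> $ i))" for y \<xi> :: "int ^ 'd"
    proof -
    have "torus_symbol N \<xi> ^ t * cos (2 * pi / real N * dotp \<xi> (x - y)) \<le> torus_symbol N \<xi> ^ t * 1"
      by (intro mult_left_mono) (auto simp: torus_symbol_nonneg)
    also have "torus_symbol N \<xi> ^ t \<le> (\<Prod>i\<in>UNIV. exp (- (1 - cos (2 * pi / real N * real_of_int (\<xi> $ i))) / (2 * real CARD('d)))) ^ t"
      by (intro power_mono torus_symbol_le torus_symbol_nonneg)
    also have "\<dots> = (\<Prod>i\<in>UNIV. ?e (\<xi> $ i))"
      unfolding prod_power_distrib exp_of_nat_mult[symmetric] by (intro prod.cong refl arg_cong[where f = exp]) (simp add: field_simps)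
    finally show ?thesis by simp
    qed
    show ?thesis
      by (rule sum_mono, rule mult_left_mono, rule sum_mono, rule main, intro divide_nonneg_nonneg assms, simp)
  qed
  also have "\<dots> = cell_avg N f * (\<Prod>i\<in>(UNIV::'d set). \<Sum>k\<in>{0..<int N}. ?e k)"
    unfolding sum_pcell_prod[of "\<lambda>_. ?e"] cell_avg_def sum_distrib_right[symmetric] sum_divide_distrib[symmetric] ..
  finally show ?thesis by simp
qed

section \<open>The heat kernel bound\<close>

lemma sin_ge_half: 
  assumes "0 \<le> x" "x \<le> pi / 2"
  shows "x / 2 \<le> sin (x::real)"
proof -
  have "(\<Sum>m<3. sin_coeff m * x ^ m) = x" by (simp add: numeral_3_eq_3 sin_coeff_def)
  moreover have "inverse (fact 3) * \<bar>x\<bar> ^ 3 = x ^ 3 / 6" using assms by (simp add: fact_numeral)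
  ultimately have "\<bar>sin x - x\<bar> \<le> x ^ 3 / 6"
    using Maclaurin_sin_bound[of x 3] by simp
  moreover have "x ^ 3 / 6 \<le> x / 2"
  proof -
    have "x \<le> 1.7" using assms pi_approx by simp
    then have "x * x \<le> 1.7 * 1.7" using assms by (intro mult_mono) auto
    then have "x * (x * x) \<le> x * 3" using assms by (intro mult_left_mono) auto
    then show ?thesis by (simp add: power3_eq_cube)
  qed
  ultimately show ?thesis by linarith
qed

lemma one_minus_cos_ge:
  assumes "0 \<le> u" "u \<le> 1 / 2"
  shows "4 * u\<^sup>2 \<le> 1 - cos (2 * pi * u)"
proof -
  have "pi * u \<le> pi * (1/2)" using assms by (intro mult_left_mono) auto
  then have "pi * u / 2 \<le> sin (pi * u)" using assms by (intro sin_ge_half) auto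
  moreover have "3 * u \<le> pi * u" using assms pi_gt3 by (intro mult_right_mono) auto
  ultimately have "3 / 2 * u \<le> sin (pi * u)" by linarith
  then have "(3 / 2 * u)\<^sup>2 \<le> (sin (pi * u))\<^sup>2" using assms by (intro power_mono) auto
  then have "2 * (9 / 4 * u\<^sup>2) \<le> 1 - cos (2 * (pi * u))"
    unfolding cos_double_sin by (simp add: power_mult_distrib power2_eq_square)
  moreover have "0 \<le> u\<^sup>2" by simp
  ultimately have "4 * u\<^sup>2 \<le> 1 - cos (2 * (pi * u))" by linarith
  then show ?thesis by (simp only: mult.assoc)
qed

text \<open>Frequencies up to N/2 have the Gaussian decay exp (- 2 (r k)^2). Through x^2 \<ge> x -
  1/4 it is weakened to a geometric sequence whose sum is at most 1 / r. Frequencies above N/2 are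
  reflections of those below. The constant 4 consists of 2 from exp (1/2) \<le> 2 and 2 from the
  reflection.\<close>

lemma sum_exp_residues_le:
  assumes "N > 0" "t > 0" "dd > 0"
  shows "(\<Sum>k\<in>{0..<int N}. exp (- real t * (1 - cos (2 * pi / real N * real_of_int k)) / (2 * real dd)))
    \<le> 1 + 4 * sqrt (real dd) * real N / sqrt (real t)"
proof -
  define r where "r = sqrt (real t / real dd) / real N"
  have r0: "r > 0" using assms by (simp add: r_def)
  have r2: "r\<^sup>2 = real t / (real dd * (real N)\<^sup>2)" using assms by (simp add: r_def power_divide)
  let ?g = "\<lambda>k::nat. exp (- real t * (1 - cos (2 * pi / real N * real k)) / (2 * real dd))"
  let ?E = "\<lambda>k::nat. 2 * exp (- r) ^ k"
  have half: "?g k \<le> ?E k" if "real k \<le> real N / 2" for k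
  proof -
    have "4 * (real k / real N)\<^sup>2 \<le> 1 - cos (2 * pi * (real k / real N))"
      using that assms by (intro one_minus_cos_ge) (auto simp: field_simps)
    then have "real t / (2 * real dd) * (4 * (real k / real N)\<^sup>2) \<le> real t / (2 * real dd) * (1 - cos (2 * pi / real N * real k))"
      using assms by (intro mult_left_mono) (auto simp: mult_ac)
    moreover have "real t / (2 * real dd) * (4 * (real k / real N)\<^sup>2) = 2 * (r * real k)\<^sup>2"
      using assms by (simp add: power_mult_distrib r2 power_divide field_simps)
    moreover have "r * real k - 1/4 \<le> (r * real k)\<^sup>2"
      using zero_le_power2[of "r * real k - 1/2"] by (simp add: power2_eq_square algebra_simps)
    moreover have "0 \<le> (r * real k)\<^sup>2" by simp
    ultimately have "- (real t / (2 * real dd) * (1 - cos (2 * pi / real N * real k))) \<le> 1/2 - r * real k"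
      by linarith
    then have "- real t * (1 - cos (2 * pi / real N * real k)) / (2 * real dd) \<le> 1/2 + real k * (- r)"
      by (simp add: mult.commute)
    then have "?g k \<le> exp (1/2 + real k * (- r))" by simp
    also have "\<dots> = exp (1/2) * exp (- r) ^ k" unfolding exp_add exp_of_nat_mult ..
    also have "\<dots> \<le> 2 * exp (- r) ^ k" by (intro mult_right_mono exp_half_le2) auto
    finally show ?thesis .
  qed
  have step: "?g k \<le> ?E k + ?E (N - k)" if "k \<le> N" for k
  proof (cases "real k \<le> real N / 2")
    case True
    have "0 \<le> ?E (N - k)" by simp
    then show ?thesis using half[OF True] by linarith
  next
    case False
    then have le: "real (N - k) \<le> real N / 2" using that by (simp add: of_nat_diff)
    have "2 * pi / real N * real (N - k) = 2 * pi - 2 * pi / real N * real k"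
      using that assms by (simp add: of_nat_diff field_simps)
    then have "?g (N - k) = ?g k" by (simp add: cos_diff)
    then have "?g k \<le> ?E (N - k)" using half[OF le] by (simp only:)
    moreover have "0 \<le> ?E k" by simp
    ultimately show ?thesis by linarith
  qed
  have geo: "(\<Sum>k=1..<N. exp (- r) ^ k) \<le> 1 / r"
  proof -
    have lt: "exp (- r) < 1" using r0 by simp
    have "(\<Sum>k=1..<N. exp (- r) ^ k) \<le> (\<Sum>k. exp (- r) ^ Suc k)"
    proof -
      have "(\<Sum>k=1..<N. exp (- r) ^ k) = (\<Sum>k<N - 1. exp (- r) ^ Suc k)"
        by (rule sum.reindex_bij_witness[of _ Suc "\<lambda>k. k - 1"]) auto
      also have "\<dots> \<le> (\<Sum>k. exp (- r) ^ Suc k)"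
        using lt by (intro sum_le_suminf) (auto simp: summable_geometric summable_mult)
      finally show ?thesis .
    qed
    also have "\<dots> = exp (- r) / (1 - exp (- r))"
      using lt by (simp add: suminf_mult suminf_geometric summable_geometric)
    also have "\<dots> = 1 / (exp r - 1)" using r0 by (simp add: exp_minus field_simps)
    also have "\<dots> \<le> 1 / r"
    proof -
      have "r \<le> exp r - 1" using exp_ge_add_one_self[of r] by linarith
      then show ?thesis using r0 by (intro divide_left_mono) auto
    qed
    finally show ?thesis .
  qed
  have "(\<Sum>k\<in>{0..<int N}. exp (- real t * (1 - cos (2 * pi / real N * real_of_int k)) / (2 * real dd))) = (\<Sum>k=0..<N. ?g k)"
    by (rule sum.reindex_bij_witness[of _ int nat]) auto
  also have "\<dots> = 1 + (\<Sum>k=1..<N. ?g k)"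
    using assms by (subst sum.atLeast_Suc_lessThan) auto
  also have "\<dots> \<le> 1 + (\<Sum>k=1..<N. ?E k + ?E (N - k))"
    by (intro add_left_mono sum_mono step) auto
  also have "(\<Sum>k=1..<N. ?E k + ?E (N - k)) = (\<Sum>k=1..<N. ?E k) + (\<Sum>k=1..<N. ?E (N - k))"
    by (rule sum.distrib)
  also have "(\<Sum>k=1..<N. ?E (N - k)) = (\<Sum>k=1..<N. ?E k)"
    by (rule sum.reindex_bij_witness[of _ "\<lambda>k. N - k" "\<lambda>k. N - k"]) auto
  also have "1 + ((\<Sum>k=1..<N. ?E k) + (\<Sum>k=1..<N. ?E k)) = 1 + 4 * (\<Sum>k=1..<N. exp (- r) ^ k)"
    by (simp add: sum_distrib_left[symmetric])
  also have "\<dots> \<le> 1 + 4 * (1 / r)" using geo by simp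
  also have "1 / r = sqrt (real dd) * real N / sqrt (real t)"
    by (simp add: r_def real_sqrt_divide)
  finally show ?thesis by simp
qed

text \<open>A bound for the heat kernel of the torus relative to the uniform density N^(-d). It is
  close to one for t far beyond N^2, which expresses mixing, and of order N^d t^(-d/2) before, which
  is diffusive decay. Both regimes are used.\<close>

definition heat_bound :: "nat \<Rightarrow> nat \<Rightarrow> nat \<Rightarrow> real" where
  "heat_bound dd N t = (1 + 4 * sqrt (real dd) * real N / sqrt (real t)) ^ dd"

theorem surv_periodic_le:
  fixes f :: "int ^ 'd \<Rightarrow> real"
  assumes "N > 0" "t > 0" "periodic N f" "\<And>y. 0 \<le> f y"
  shows "surv UNIV t f x \<le> heat_bound CARD('d) N t * cell_avg N f"
proof -
  let ?S = "\<Sum>k\<in>{0..<int N}. exp (- real t * (1 - cos (2 * pi / real N * real_of_int k)) / (2 * real CARD('d)))"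
  have "surv UNIV t f x \<le> cell_avg N f * ?S ^ CARD('d)"
    by (rule surv_periodic_le_Fourier) (rule assms)+
  also have "\<dots> \<le> cell_avg N f * heat_bound CARD('d) N t"
  proof (rule mult_left_mono)
    show "0 \<le> cell_avg N f" unfolding cell_avg_def by (intro divide_nonneg_nonneg sum_nonneg assms) auto
    have "0 \<le> ?S" by (rule sum_nonneg) (rule exp_ge_zero)
    moreover have "?S \<le> 1 + 4 * sqrt (real CARD('d)) * real N / sqrt (real t)"
      by (rule sum_exp_residues_le) (use assms(1,2) in auto)
    ultimately show "?S ^ CARD('d) \<le> heat_bound CARD('d) N t"
      unfolding heat_bound_def by (rule power_mono[rotated])
  qed
  also have "\<dots> = heat_bound CARD('d) N t * cell_avg N f" by (rule mult.commute)
  finally show ?thesis .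
qed

section \<open>Periodic obstacles\<close>

definition avoid :: "(int ^ 'd) set \<Rightarrow> nat \<Rightarrow> int ^ 'd \<Rightarrow> real" where
  "avoid D n = surv (- D) n (\<lambda>_. 1)"

text \<open>For a start outside \<open>D\<close>, the probability that the first visit to
  \<open>D\<close> happens at time \<open>Suc n\<close>; zero for a start inside.\<close>

definition hit :: "(int ^ 'd) set \<Rightarrow> nat \<Rightarrow> int ^ 'd \<Rightarrow> real" where
  "hit D n x = avoid D n x - avoid D (Suc n) x"

lemma avoid_nonneg: "0 \<le> avoid D n x"
  unfolding avoid_def by (rule surv_nonneg) simp

lemma avoid_le_1: "avoid D n x \<le> 1"
  unfolding avoid_def by (rule surv_const_le) simp

lemma avoid_inside: "x \<in> D \<Longrightarrow> avoid D n x = 0"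
  by (simp add: avoid_def)

lemma avoid_0: "avoid D 0 x = (if x \<in> D then 0 else 1)"
  by (simp add: avoid_def)

lemma avoid_Suc: "avoid D (Suc n) x = (if x \<in> D then 0 else lazy_op (avoid D n) x)"
  by (simp add: avoid_def surv_Suc)

lemma hit_nonneg: "0 \<le> hit D n x"
  using surv_Suc_one_le[of "- D" n x] by (simp add: hit_def avoid_def)

lemma hit_inside: "x \<in> D \<Longrightarrow> hit D n x = 0"
  by (simp add: hit_def avoid_inside)

lemma lazy_op_avoid: "x \<notin> D \<Longrightarrow> lazy_op (avoid D n) x = avoid D n x - hit D n x"
  by (simp add: hit_def avoid_Suc)

lemma hit_Suc: "hit D (Suc n) x = (if x \<in> D then 0 else lazy_op (hit D n) x)"
proof -
  have "hit D n = (\<lambda>y. avoid D n y - avoid D (Suc n) y)" by (rule ext) (rule hit_def)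
  then have "lazy_op (hit D n) x = lazy_op (avoid D n) x - lazy_op (avoid D (Suc n)) x"
    by (simp only: lazy_op_diff)
  then show ?thesis by (simp add: hit_def[of D "Suc n"] avoid_Suc[of D n x] avoid_Suc[of D "Suc n" x])
qed

text \<open>The obstacles are ignored during the first \<open>m\<close> steps, which makes room for
  the mixing of the free walk.\<close>

lemma hit_le_surv: "hit D (m + n) x \<le> surv UNIV m (hit D n) x"
proof (induction m arbitrary: x)
  case (Suc m)
  have "lazy_op (hit D (m + n)) x \<le> lazy_op (surv UNIV m (hit D n)) x"
    by (rule lazy_op_mono) (rule Suc)
  moreover have "0 \<le> lazy_op (surv UNIV m (hit D n)) x"
    by (intro lazy_op_nonneg surv_nonneg hit_nonneg)
  ultimately show ?case by (simp add: hit_Suc surv_Suc)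
qed simp

text \<open>A first visit at time \<open>Suc n\<close> is in particular a visit at that time, and
  the free walk controls the latter.\<close>

lemma hit_le_surv_indicator: "hit D n x \<le> surv UNIV (Suc n) (indicator D) x"
proof -
  have 0: "hit D 0 y \<le> lazy_op (indicator D) y" for y
  proof (cases "y \<in> D")
    case True
    then show ?thesis by (simp add: hit_inside lazy_op_nonneg)
  next
    case False
    have "avoid D 0 = (\<lambda>z. 1 - indicator D z)" by (auto simp: avoid_0)
    then have "lazy_op (avoid D 0) y = 1 - lazy_op (indicator D) y" by (simp add: lazy_op_diff)
    then show ?thesis using False by (simp add: hit_def avoid_Suc avoid_0)
  qed
  have "hit D n x \<le> surv UNIV n (hit D 0) x" using hit_le_surv[of D n 0 x] by simp
  also have "\<dots> \<le> surv UNIV n (surv UNIV 1 (indicator D)) x"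
  proof (rule surv_mono)
    fix y :: "int ^ 'a"
    have "surv UNIV 0 (indicator D :: int ^ 'a \<Rightarrow> real) = indicator D" by auto
    then show "hit D 0 y \<le> surv UNIV 1 (indicator D) y"
      using 0[of y] by (simp add: surv_Suc)
  qed
  also have "\<dots> = surv UNIV (Suc n) (indicator D) x" using surv_surv[of UNIV n 1 "indicator D" x] by simp
  finally show ?thesis .
qed

lemma avoid_diff_le: 
  assumes "m \<le> n"
  shows "avoid D m x - avoid D n x \<le> (\<Sum>t=m..<n. surv UNIV (Suc t) (indicator D) x)"
  using assms
proof (induction n rule: dec_induct)
  case (step n)
  then show ?case using hit_le_surv_indicator[of D n x] by (simp add: hit_def)
qed simp

lemma avoid_antimono: "m \<le> n \<Longrightarrow> avoid D n x \<le> avoid D m x"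
proof (induction n rule: dec_induct)
  case (step n)
  then show ?case using hit_nonneg[of D n x] by (simp add: hit_def)
qed simp

text \<open>In \<open>n\<close> steps no coordinate changes by more than \<open>n\<close>.\<close>

lemma avoid_local:
  assumes "\<And>y. (\<forall>i. \<bar>y $ i - x $ i\<bar> \<le> int n) \<Longrightarrow> y \<in> D \<longleftrightarrow> y \<in> D'"
  shows "avoid D n x = avoid D' n x"
  using assms
proof (induction n arbitrary: x)
  case 0
  then show ?case by (simp add: avoid_0)
next
  case (Suc n)
  have x: "x \<in> D \<longleftrightarrow> x \<in> D'" by (rule Suc.prems) simp
  have near: "avoid D n z = avoid D' n z" if z: "\<forall>i. \<bar>z $ i - x $ i\<bar> \<le> 1" for z
  proof (rule Suc.IH)
    fix y :: "int ^ 'a" assume y: "\<forall>i. \<bar>y $ i - z $ i\<bar> \<le> int n"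
    show "y \<in> D \<longleftrightarrow> y \<in> D'"
    proof (rule Suc.prems, rule allI)
      fix i show "\<bar>y $ i - x $ i\<bar> \<le> int (Suc n)"
        using y[rule_format, of i] z[rule_format, of i] by simp
    qed
  qed
  have "lazy_op (avoid D n) x = lazy_op (avoid D' n) x"
    by (rule lazy_op_cong_local; rule near) (auto simp: axis_def)
  then show ?case using x by (simp add: avoid_Suc)
qed

lemma avoid_empty: "avoid {} n x = 1"
proof (induction n arbitrary: x)
  case (Suc n)
  then have "avoid {} n = (\<lambda>_::int ^ 'a. 1)" by auto
  then show ?case by (simp add: avoid_Suc)
qed (simp add: avoid_0)

lemma lazy_op_shift: "lazy_op (\<lambda>y. f (y + a)) x = lazy_op f (x + a)"
  by (simp add: lazy_op_def algebra_simps)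

lemma avoid_shift: "avoid ((\<lambda>k. k + a) ` D) n (x + a) = avoid D n x"
proof (induction n arbitrary: x)
  case 0
  then show ?case by (auto simp: avoid_0)
next
  case (Suc n)
  have "lazy_op (avoid ((\<lambda>k. k + a) ` D) n) (x + a) = lazy_op (\<lambda>y. avoid ((\<lambda>k. k + a) ` D) n (y + a)) x"
    by (rule lazy_op_shift[symmetric])
  then have "lazy_op (avoid ((\<lambda>k. k + a) ` D) n) (x + a) = lazy_op (avoid D n) x"
    using Suc by simp
  then show ?case by (auto simp: avoid_Suc)
qed

section \<open>Averages over a period cell\<close>

definition obst :: "nat \<Rightarrow> int ^ 'd \<Rightarrow> (int ^ 'd) set \<Rightarrow> (int ^ 'd) set" where
  "obst N a K = {y. \<exists>k\<in>K. \<forall>i. y $ i mod int N = (k + a) $ i mod int N}"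

lemma periodic_lazy_op: 
  assumes "periodic N f"
  shows "periodic N (lazy_op f)"
  unfolding periodic_def
proof (intro allI impI)
  fix x y :: "int ^ 'a" assume xy: "\<forall>i. x $ i mod int N = y $ i mod int N"
  have "\<forall>i. (x + v) $ i mod int N = (y + v) $ i mod int N" for v
    using xy by (auto intro: mod_add_cong)
  then have "f (x + v) = f (y + v)" for v using assms unfolding periodic_def by blast
  from this[of 0] this[of "axis _ 1"] this[of "- axis _ 1"]
  show "lazy_op f x = lazy_op f y" by (simp add: lazy_op_def)
qed

lemma periodic_diff: "periodic N f \<Longrightarrow> periodic N g \<Longrightarrow> periodic N (\<lambda>x. f x - g x)"
  unfolding periodic_def by (intro allI impI arg_cong2[where f = minus]) blast+

lemma periodic_const: "periodic N (\<lambda>_. c)"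
  by (simp add: periodic_def)

lemma mem_obst_cong: "(\<forall>i. x $ i mod int N = y $ i mod int N) \<Longrightarrow> x \<in> obst N a K \<longleftrightarrow> y \<in> obst N a K"
  by (simp add: obst_def)

lemma periodic_if_obst: "periodic N f \<Longrightarrow> periodic N g \<Longrightarrow> periodic N (\<lambda>x. if x \<in> obst N a K then f x else g x)"
  unfolding periodic_def
proof (intro allI impI)
  fix x y :: "int ^ 'a"
  assume *: "\<forall>x y. (\<forall>i. x $ i mod int N = y $ i mod int N) \<longrightarrow> f x = f y"
    "\<forall>x y. (\<forall>i. x $ i mod int N = y $ i mod int N) \<longrightarrow> g x = g y" "\<forall>i. x $ i mod int N = y $ i mod int N"
  have "f x = f y" "g x = g y" using * by blast+
  then show "(if x \<in> obst N a K then f x else g x) = (if y \<in> obst N a K then f y else g y)"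
    using mem_obst_cong[OF *(3)] by simp
qed

lemma periodic_avoid: "periodic N (avoid (obst N a K) n)"
proof (induction n)
  case 0
  then show ?case unfolding avoid_0[abs_def] by (intro periodic_if_obst periodic_const)
next
  case (Suc n)
  then show ?case unfolding avoid_Suc[abs_def] by (intro periodic_if_obst periodic_const periodic_lazy_op)
qed

lemma periodic_hit: "periodic N (hit (obst N a K) n)"
  unfolding hit_def[abs_def] by (intro periodic_diff periodic_avoid)

lemma periodic_indicator: "periodic N (indicator (obst N a K))"
  unfolding indicator_def[abs_def] of_bool_def by (intro periodic_if_obst periodic_const)

lemma reduce_pcell: "x \<in> pcell N \<Longrightarrow> reduce N x = x"
  by (auto simp: reduce_def pcell_def vec_eq_iff)

lemma reduce_add: "reduce N (reduce N x + y) = reduce N (x + y)"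
  by (auto simp: reduce_def vec_eq_iff mod_add_left_eq)

lemma sum_pcell_shift:
  assumes "N > 0" "periodic N f"
  shows "(\<Sum>y\<in>pcell N. f (y + a)) = (\<Sum>y\<in>pcell N. f y)"
proof (rule sum.reindex_bij_witness[of _ "\<lambda>y. reduce N (y + (- a))" "\<lambda>y. reduce N (y + a)"])
  fix y :: "int ^ 'a" assume y: "y \<in> pcell N"
  show "reduce N (reduce N (y + a) + - a) = y" "reduce N (reduce N (y + - a) + a) = y"
    using y by (simp_all only: reduce_add) (simp_all add: reduce_pcell)
  show "reduce N (y + a) \<in> pcell N" "reduce N (y + - a) \<in> pcell N" using reduce_in_pcell[OF assms(1)] by blast+
  show "f (reduce N (y + a)) = f (y + a)" by (rule periodic_reduce[OF assms(2)])
qed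

lemma cell_avg_diff: "cell_avg N (\<lambda>y. f y - g y) = cell_avg N f - cell_avg N g"
  by (simp add: cell_avg_def sum_subtractf diff_divide_distrib)

text \<open>The uniform distribution on the torus is invariant, since shifting a periodic function
  does not change its sum over a cell.\<close>

lemma cell_avg_lazy_op:
  fixes f :: "int ^ 'd \<Rightarrow> real"
  assumes "N > 0" "periodic N f"
  shows "cell_avg N (lazy_op f) = cell_avg N f"
proof -
  have "(\<Sum>y\<in>pcell N. \<Sum>i\<in>UNIV. f (y + axis i 1) + f (y - axis i 1)) =
      (\<Sum>i\<in>(UNIV::'d set). \<Sum>y\<in>pcell N. f (y + axis i 1) + f (y + (- axis i 1)))"
    by (subst sum.swap) simp
  also have "\<dots> = (\<Sum>i\<in>(UNIV::'d set). 2 * (\<Sum>y\<in>pcell N. f y))"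
    by (simp only: sum.distrib sum_pcell_shift[OF assms]) simp
  finally show ?thesis
    unfolding cell_avg_def lazy_op_def sum.distrib[of "\<lambda>y. f y / 2"] sum_divide_distrib[symmetric] by (simp add: field_simps)
qed

lemma card_pcell: "card (pcell N :: (int ^ 'd) set) = N ^ CARD('d)"
proof -
  have "inj_on vec_lambda (PiE (UNIV::'d set) (\<lambda>_. {0..<int N}))"
    by (auto simp: inj_on_def vec_lambda_inject)
  then show ?thesis unfolding pcell_eq_image by (simp add: card_image card_PiE)
qed

lemma cell_avg_const: "N > 0 \<Longrightarrow> cell_avg N (\<lambda>_::int ^ 'd. c) = c"
  by (simp add: cell_avg_def card_pcell)

text \<open>Distinct points of \<open>K\<close> stay distinct modulo N, so that a period cell
  contains one translate of each.\<close>

definition separated :: "nat \<Rightarrow> (int ^ 'd) set \<Rightarrow> bool" where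
  "separated N K \<longleftrightarrow> (\<forall>k\<in>K. \<forall>k'\<in>K. (\<forall>i. k $ i mod int N = k' $ i mod int N) \<longrightarrow> k = k')"

lemma sum_pcell_obst:
  fixes K :: "(int ^ 'd) set"
  assumes "N > 0" "periodic N f" "finite K" "separated N K"
  shows "(\<Sum>y\<in>pcell N. if y \<in> obst N a K then f y else 0) = (\<Sum>k\<in>K. f (k + a))"
proof -
  have mod_diff: "u mod int N = v mod int N" if "(u + w) mod int N = (v + w) mod int N" for u v w :: int
    using mod_diff_cong[OF that refl[of "w mod int N"]] by simp
  have inj: "inj_on (\<lambda>k. reduce N (k + a)) K"
  proof (rule inj_onI)
    fix k k' assume k: "k \<in> K" "k' \<in> K" "reduce N (k + a) = reduce N (k' + a)"
    have "\<forall>i. k $ i mod int N = k' $ i mod int N"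
    proof
      fix i
      have "reduce N (k + a) $ i = reduce N (k' + a) $ i" using k(3) by simp
      then have "(k $ i + a $ i) mod int N = (k' $ i + a $ i) mod int N"
        by (simp only: reduce_def vec_lambda_beta vector_add_component)
      then show "k $ i mod int N = k' $ i mod int N" by (rule mod_diff)
    qed
    then show "k = k'" using assms(4) k unfolding separated_def by blast
  qed
  have im: "pcell N \<inter> obst N a K = (\<lambda>k. reduce N (k + a)) ` K"
  proof (intro equalityI subsetI)
    fix y assume y: "y \<in> pcell N \<inter> obst N a K"
    then obtain k where k: "k \<in> K" "\<forall>i. y $ i mod int N = (k + a) $ i mod int N" by (auto simp: obst_def)
    have "reduce N y = reduce N (k + a)" using k(2) by (simp add: reduce_def)
    then show "y \<in> (\<lambda>k. reduce N (k + a)) ` K" using k y by (auto simp: reduce_pcell)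
  next
    fix y assume "y \<in> (\<lambda>k. reduce N (k + a)) ` K"
    then obtain k where k: "k \<in> K" "y = reduce N (k + a)" by auto
    then have "\<forall>i. y $ i mod int N = (k + a) $ i mod int N" by (simp add: reduce_def)
    then show "y \<in> pcell N \<inter> obst N a K" using k reduce_in_pcell[OF assms(1), of "k + a"] by (auto simp: obst_def)
  qed
  have "(\<Sum>y\<in>pcell N. if y \<in> obst N a K then f y else 0) = sum f (pcell N \<inter> obst N a K)"
    by (simp add: sum.inter_restrict)
  also have "\<dots> = (\<Sum>k\<in>K. f (reduce N (k + a)))"
    unfolding im by (subst sum.reindex[OF inj]) simp
  finally show ?thesis by (simp add: periodic_reduce[OF assms(2)])
qed

text \<open>Mass balance on the torus: \<open>avoid\<close> at time \<open>n\<close> and its image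
  under the walk operator have the same average, and that image differs from \<open>avoid\<close> at
  time \<open>Suc n\<close> only on the obstacles. Thus the hitting rate from a uniform start
  becomes a sum of escape probabilities from the obstacle, the form in which capacity
  appears.\<close>

lemma cell_avg_hit:
  fixes K :: "(int ^ 'd) set"
  assumes "N > 0" "finite K" "separated N K"
  shows "real N ^ CARD('d) * cell_avg N (hit (obst N a K) n) = (\<Sum>k\<in>K. lazy_op (avoid (obst N a K) n) (k + a))"
proof -
  let ?D = "obst N a K"
  let ?P = "lazy_op (avoid ?D n)"
  have per: "periodic N ?P" by (intro periodic_lazy_op periodic_avoid)
  have eq: "hit ?D n = (\<lambda>y. avoid ?D n y - (?P y - (if y \<in> ?D then ?P y else 0)))"
    by (rule ext) (simp add: hit_def avoid_Suc)
  have "cell_avg N (hit ?D n) = cell_avg N (avoid ?D n) - (cell_avg N ?P - cell_avg N (\<lambda>y. if y \<in> ?D then ?P y else 0))"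
    by (subst eq) (simp only: cell_avg_diff)
  also have "\<dots> = cell_avg N (\<lambda>y. if y \<in> ?D then ?P y else 0)"
    using cell_avg_lazy_op[OF assms(1) periodic_avoid[of N a K n]] by simp
  also have "\<dots> = (\<Sum>k\<in>K. ?P (k + a)) / real N ^ CARD('d)"
    unfolding cell_avg_def sum_pcell_obst[OF assms(1) per assms(2,3)] ..
  finally show ?thesis using assms(1) by simp
qed

lemma cell_avg_hit_le:
  fixes K :: "(int ^ 'd) set"
  assumes "N > 0" "finite K" "separated N K"
  shows "cell_avg N (hit (obst N a K) n) \<le> real (card K) / real N ^ CARD('d)"
proof -
  have le1: "lazy_op (avoid (obst N a K) n) y \<le> 1" for y
    using lazy_op_mono[of "avoid (obst N a K) n" "\<lambda>_. 1" y] by (simp add: avoid_le_1)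
  have "real N ^ CARD('d) * cell_avg N (hit (obst N a K) n) \<le> (\<Sum>k\<in>K. 1)"
    unfolding cell_avg_hit[OF assms] by (intro sum_mono le1)
  then show ?thesis using assms(1) by (simp add: field_simps)
qed

lemma cell_avg_indicator:
  fixes K :: "(int ^ 'd) set"
  assumes "N > 0" "finite K" "separated N K"
  shows "cell_avg N (indicator (obst N a K)) = real (card K) / real N ^ CARD('d)"
  using sum_pcell_obst[OF assms(1) periodic_const[of N 1] assms(2,3), of a]
  by (simp add: cell_avg_def indicator_def[abs_def] of_bool_def)

text \<open>A union bound over the times 0, ..., n: a uniform start meets the obstacles for the
  first time at a given time with probability at most card K / N^d.\<close>

lemma cell_avg_not_avoid:
  fixes K :: "(int ^ 'd) set"
  assumes "N > 0" "finite K" "separated N K"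
  shows "cell_avg N (\<lambda>y. 1 - avoid (obst N a K) n y) \<le> real (Suc n) * real (card K) / real N ^ CARD('d)"
proof (induction n)
  case 0
  have "(\<lambda>y. 1 - avoid (obst N a K) 0 y) = indicator (obst N a K)" by (auto simp: avoid_0)
  then show ?case using cell_avg_indicator[OF assms, of a] by simp
next
  case (Suc n)
  have "(\<lambda>y. 1 - avoid (obst N a K) (Suc n) y) = (\<lambda>y. (1 - avoid (obst N a K) n y) - (- 1 * hit (obst N a K) n y - 0))"
    by (auto simp: hit_def)
  moreover have "cell_avg N (\<lambda>y. - 1 * hit (obst N a K) n y - 0) = - cell_avg N (hit (obst N a K) n)"
    by (simp add: cell_avg_def sum_negf)
  ultimately have "cell_avg N (\<lambda>y. 1 - avoid (obst N a K) (Suc n) y) =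
      cell_avg N (\<lambda>y. 1 - avoid (obst N a K) n y) + cell_avg N (hit (obst N a K) n)"
    by (simp only: cell_avg_diff[of N "\<lambda>y. 1 - avoid (obst N a K) n y"])
  moreover have "real (Suc (Suc n)) * real (card K) / real N ^ CARD('d) =
      real (Suc n) * real (card K) / real N ^ CARD('d) + real (card K) / real N ^ CARD('d)"
    by (simp add: add_divide_distrib[symmetric] algebra_simps)
  ultimately show ?case using Suc cell_avg_hit_le[OF assms, of a n] by linarith
qed

text \<open>The power of the sum splits into a stationary part of order N^(-d) per step and a
  diffusive part t^(-d/2), weakened to t^(-3/2). The latter is summable, and its tail from
  \<open>m\<close> on, which is \<open>z m\<close>, does not depend on N.\<close>

lemma heat_tail:
  assumes "3 \<le> dd"
  obtains C :: real and z :: "nat \<Rightarrow> real" where "0 \<le> C" "z \<longlonglongrightarrow> 0"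
    "\<And>N m n. N > 0 \<Longrightarrow> (\<Sum>t=m..<n. heat_bound dd N (Suc t) / real N ^ dd) \<le> C * (real n / real N ^ dd) + z m"
proof -
  define c where "c = 4 * sqrt (real dd)"
  define u where "u t = 2 ^ dd * c ^ dd * (1 / real (Suc t) powr (3/2))" for t
  have c0: "0 \<le> c" by (simp add: c_def)
  have "summable (\<lambda>t. real (Suc t) powr (- (3/2)))"
    using summable_real_powr_iff[of "- (3/2)"] by (subst summable_Suc_iff) simp
  then have sum_u: "summable u"
    unfolding u_def by (intro summable_mult) (simp add: powr_minus_divide)
  have u0: "0 \<le> u t" for t using c0 by (simp add: u_def)
  have pw: "(a + b) ^ dd \<le> 2 ^ dd * (a ^ dd + b ^ dd)" if "0 \<le> a" "0 \<le> b" for a b :: real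
  proof -
    have "(a + b) ^ dd \<le> (2 * max a b) ^ dd" using that by (intro power_mono) auto
    also have "\<dots> = 2 ^ dd * max a b ^ dd" by (rule power_mult_distrib)
    also have "max a b ^ dd \<le> a ^ dd + b ^ dd" using that by (auto simp: max_def)
    finally show ?thesis by simp
  qed
  have summand: "heat_bound dd N (Suc t) / real N ^ dd \<le> 2 ^ dd / real N ^ dd + u t" if "N > 0" for N t
  proof -
    have "heat_bound dd N (Suc t) / real N ^ dd = (1 / real N + c / sqrt (real (Suc t))) ^ dd"
      using that unfolding heat_bound_def c_def power_divide[symmetric] by (simp add: field_simps)
    also have "\<dots> \<le> 2 ^ dd * ((1 / real N) ^ dd + (c / sqrt (real (Suc t))) ^ dd)"
      using c0 by (intro pw) auto
    also have "(c / sqrt (real (Suc t))) ^ dd \<le> c ^ dd * (1 / real (Suc t) powr (3/2))"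
    proof -
      have "real (Suc t) powr (3/2) \<le> real (Suc t) powr (real dd / 2)"
        using assms by (intro powr_mono) auto
      also have "\<dots> = sqrt (real (Suc t)) ^ dd"
        by (simp add: powr_half_sqrt[symmetric] powr_power)
      finally have le: "real (Suc t) powr (3/2) \<le> sqrt (real (Suc t)) ^ dd" .
      have "(c / sqrt (real (Suc t))) ^ dd = c ^ dd * (1 / sqrt (real (Suc t)) ^ dd)"
        by (simp add: power_divide)
      also have "\<dots> \<le> c ^ dd * (1 / real (Suc t) powr (3/2))"
        by (rule mult_left_mono[OF divide_left_mono[OF le]]) (use c0 in auto)
      finally show ?thesis .
    qed
    finally have "heat_bound dd N (Suc t) / real N ^ dd \<le> 2 ^ dd * ((1 / real N) ^ dd + c ^ dd * (1 / real (Suc t) powr (3/2)))"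
      by simp
    also have "\<dots> = 2 ^ dd / real N ^ dd + u t"
      unfolding u_def distrib_left power_divide by simp
    finally show ?thesis .
  qed
  show thesis
  proof (rule that[of "2 ^ dd" "\<lambda>m. \<Sum>t. u (t + m)"])
    show "(\<lambda>m. \<Sum>t. u (t + m)) \<longlonglongrightarrow> 0" by (rule suminf_exist_split2[OF sum_u])
    fix N m n :: nat assume N: "N > 0"
    have "(\<Sum>t=m..<n. heat_bound dd N (Suc t) / real N ^ dd) \<le> (\<Sum>t=m..<n. 2 ^ dd / real N ^ dd + u t)"
      by (intro sum_mono summand N)
    also have "\<dots> = real (n - m) * (2 ^ dd / real N ^ dd) + (\<Sum>t=m..<n. u t)" by (simp add: sum.distrib)
    also have "real (n - m) * (2 ^ dd / real N ^ dd) \<le> real n * (2 ^ dd / real N ^ dd)" by (intro mult_right_mono) auto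
    also have "(\<Sum>t=m..<n. u t) = (\<Sum>t<n - m. u (t + m))"
      by (rule sum.reindex_bij_witness[of _ "\<lambda>t. t + m" "\<lambda>t. t - m"]) auto
    also have "\<dots> \<le> (\<Sum>t. u (t + m))" by (rule sum_le_suminf) (use sum_u u0 in \<open>auto simp: summable_iff_shift\<close>)
    finally show "(\<Sum>t=m..<n. heat_bound dd N (Suc t) / real N ^ dd) \<le> 2 ^ dd * (real n / real N ^ dd) + (\<Sum>t. u (t + m))"
      by (simp add: mult_ac)
  qed simp
qed

section \<open>The walk, its escape probability, and capacity\<close>

definition srw_op :: "(int ^ 'd \<Rightarrow> real) \<Rightarrow> int ^ 'd \<Rightarrow> real" where
  "srw_op f x = (\<Sum>i\<in>UNIV. f (x + axis i 1) + f (x - axis i 1)) / (2 * real CARD('d))"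

lemma lazy_op_srw_op: "lazy_op f x = (f x + srw_op f x) / 2"
  by (simp add: lazy_op_def srw_op_def field_simps)

lemma srw_op_mono: "(\<And>y. f y \<le> g y) \<Longrightarrow> srw_op f x \<le> srw_op g x"
  unfolding srw_op_def by (intro divide_right_mono sum_mono add_mono) auto

definition unit_steps :: "(int ^ 'd) set" where
  "unit_steps = range (\<lambda>i. axis i 1) \<union> range (\<lambda>i. - axis i 1)"

lemma inorm_axis: "inorm (axis i 1) = 1" "inorm (- axis i 1) = 1"
proof -
  have "(\<Sum>j\<in>UNIV. (real_of_int (axis i 1 $ j))\<^sup>2) = (\<Sum>j\<in>UNIV. if j = i then 1 else 0)"
    by (intro sum.cong) (auto simp: axis_def)
  then show "inorm (axis i 1) = 1" "inorm (- axis i 1) = 1" by (simp_all add: inorm_def)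
qed

lemma inorm_eq_1_iff: "inorm z = 1 \<longleftrightarrow> z \<in> unit_steps"
proof
  assume "inorm z = 1"
  then have "(\<Sum>i\<in>UNIV. (real_of_int (z $ i))\<^sup>2) = 1" by (simp add: inorm_def)
  then have "real_of_int (\<Sum>i\<in>UNIV. (z $ i)\<^sup>2) = real_of_int 1" by simp
  then have sum1: "(\<Sum>i\<in>UNIV. (z $ i)\<^sup>2) = 1" by (simp only: of_int_eq_iff)
  have "\<exists>i. z $ i \<noteq> 0"
  proof (rule ccontr)
    assume "\<nexists>i. z $ i \<noteq> 0"
    then have "(\<Sum>i\<in>UNIV. (z $ i)\<^sup>2) = 0" by simp
    then show False using sum1 by linarith
  qed
  then obtain i where i: "z $ i \<noteq> 0" by blast
  have "(\<Sum>j\<in>UNIV. (z $ j)\<^sup>2) = (z $ i)\<^sup>2 + (\<Sum>j\<in>UNIV - {i}. (z $ j)\<^sup>2)" by (rule sum.remove) auto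
  moreover have "1 \<le> (z $ i)\<^sup>2" using i by (simp add: int_one_le_iff_zero_less)
  moreover have nn: "0 \<le> (\<Sum>j\<in>UNIV - {i}. (z $ j)\<^sup>2)" by (intro sum_nonneg) auto
  ultimately have zi: "(z $ i)\<^sup>2 = 1" and "(\<Sum>j\<in>UNIV - {i}. (z $ j)\<^sup>2) = 0" using sum1 by linarith+
  then have rest: "z $ j = 0" if "j \<noteq> i" for j using that by (subst (asm) sum_nonneg_eq_0_iff) auto
  have "z $ i = 1 \<or> z $ i = - 1" using zi by (simp add: power2_eq_1_iff)
  then have "z = axis i 1 \<or> z = - axis i 1" using rest by (auto simp: vec_eq_iff axis_def)
  then show "z \<in> unit_steps" by (auto simp: unit_steps_def)
next
  assume "z \<in> unit_steps"
  then show "inorm z = 1" by (auto simp: unit_steps_def inorm_axis)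
qed

lemma zero_notin_unit_steps: "0 \<notin> unit_steps"
  using inorm_eq_1_iff[of 0] by (simp add: inorm_def)

lemma finite_unit_steps [simp]: "finite (unit_steps :: (int ^ 'd) set)"
  by (simp add: unit_steps_def)

lemma sum_unit_steps:
  fixes f :: "int ^ 'd \<Rightarrow> 'a::comm_monoid_add"
  shows "(\<Sum>z\<in>unit_steps. f z) = (\<Sum>i\<in>UNIV. f (axis i 1) + f (- axis i 1))"
proof -
  have inj: "inj (\<lambda>i. axis i 1 :: int ^ 'd)" "inj (\<lambda>i. - axis i 1 :: int ^ 'd)"
    by (auto intro!: injI simp: axis_eq_axis)
  have "range (\<lambda>i. axis i 1 :: int ^ 'd) \<inter> range (\<lambda>i. - axis i 1) = {}"
  proof -
    have "axis i 1 \<noteq> (- axis j 1 :: int ^ 'd)" for i j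
    proof
      assume "axis i 1 = (- axis j 1 :: int ^ 'd)"
      then have "axis i 1 $ i = (- axis j 1 :: int ^ 'd) $ i" by simp
      then show False by (simp add: axis_def split: if_splits)
    qed
    then show ?thesis by auto
  qed
  then have "(\<Sum>z\<in>unit_steps. f z) = sum f (range (\<lambda>i. axis i 1)) + sum f (range (\<lambda>i. - axis i 1))"
    unfolding unit_steps_def by (intro sum.union_disjoint) auto
  also have "\<dots> = (\<Sum>i\<in>UNIV. f (axis i 1)) + (\<Sum>i\<in>UNIV. f (- axis i 1))"
    using inj by (simp add: sum.reindex)
  finally show ?thesis by (simp add: sum.distrib)
qed

lemma pmf_srw_step: "pmf (srw_step :: (int ^ 'd) pmf) z = (if inorm z = 1 then 1 / (2 * real CARD('d)) else 0)"
  unfolding srw_step_def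
proof (rule pmf_embed_pmf)
  let ?f = "\<lambda>z::int ^ 'd. if inorm z = 1 then 1 / (2 * real CARD('d)) else 0"
  have "(\<integral>\<^sup>+ z. ennreal (?f z) \<partial>count_space UNIV) = (\<Sum>z\<in>unit_steps. ennreal (?f z))"
    by (rule nn_integral_count_space') (auto simp: inorm_eq_1_iff)
  also have "\<dots> = ennreal (\<Sum>z\<in>unit_steps. ?f z)" by (rule sum_ennreal) simp
  also have "(\<Sum>z\<in>unit_steps. ?f z) = 1"
    unfolding sum_unit_steps by (simp add: inorm_axis)
  finally show "(\<integral>\<^sup>+ z. ennreal (?f z) \<partial>count_space UNIV) = 1" by simp
qed simp

lemma pmf_lazy_step: "pmf (lazy_step :: (int ^ 'd) pmf) z =
    (if z = 0 then 1/2 else if inorm z = 1 then 1 / (4 * real CARD('d)) else 0)"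
  unfolding lazy_step_def
proof (rule pmf_embed_pmf)
  let ?f = "\<lambda>z::int ^ 'd. if z = 0 then 1/2 else if inorm z = 1 then 1 / (4 * real CARD('d)) else 0"
  have nz: "axis i 1 \<noteq> (0::int ^ 'd)" "- axis i 1 \<noteq> (0::int ^ 'd)" for i by (auto simp: axis_eq_0_iff)
  have "(\<integral>\<^sup>+ z. ennreal (?f z) \<partial>count_space UNIV) = (\<Sum>z\<in>insert 0 unit_steps. ennreal (?f z))"
    by (rule nn_integral_count_space') (auto simp: inorm_eq_1_iff)
  also have "\<dots> = ennreal (\<Sum>z\<in>insert 0 unit_steps. ?f z)" by (rule sum_ennreal) simp
  also have "(\<Sum>z\<in>insert 0 unit_steps. ?f z) = ?f 0 + (\<Sum>z\<in>unit_steps. ?f z)"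
    by (rule sum.insert) (auto simp: zero_notin_unit_steps)
  also have "(\<Sum>z\<in>unit_steps. ?f z) = 1/2"
    unfolding sum_unit_steps using nz by (simp add: inorm_axis)
  finally show "(\<integral>\<^sup>+ z. ennreal (?f z) \<partial>count_space UNIV) = 1" by simp
qed simp

lemma expectation_srw_step:
  fixes f :: "int ^ 'd \<Rightarrow> real"
  shows "(\<integral>z. f (x + z) \<partial>measure_pmf srw_step) = srw_op f x"
proof -
  have "(\<integral>z. f (x + z) \<partial>measure_pmf srw_step) = (\<Sum>z\<in>unit_steps. f (x + z) * pmf srw_step z)"
    by (rule integral_measure_pmf_real) (auto simp: set_pmf_iff pmf_srw_step inorm_eq_1_iff split: if_splits)
  then show ?thesis
    unfolding sum_unit_steps by (simp add: srw_op_def pmf_srw_step inorm_axis sum_divide_distrib add_divide_distrib)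
qed

lemma expectation_lazy_step:
  fixes f :: "int ^ 'd \<Rightarrow> real"
  shows "(\<integral>z. f (x + z) \<partial>measure_pmf lazy_step) = lazy_op f x"
proof -
  have nz: "axis i 1 \<noteq> (0::int ^ 'd)" for i by (auto simp: axis_eq_0_iff)
  have "(\<integral>z. f (x + z) \<partial>measure_pmf lazy_step) = (\<Sum>z\<in>insert 0 unit_steps. f (x + z) * pmf lazy_step z)"
    by (rule integral_measure_pmf_real) (auto simp: set_pmf_iff pmf_lazy_step inorm_eq_1_iff split: if_splits)
  also have "\<dots> = f x / 2 + (\<Sum>z\<in>unit_steps. f (x + z) * pmf lazy_step z)"
    by (subst sum.insert) (auto simp: zero_notin_unit_steps pmf_lazy_step)
  finally show ?thesis
    unfolding sum_unit_steps using nz by (simp add: lazy_op_def pmf_lazy_step inorm_axis sum_divide_distrib add_divide_distrib)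
qed

lemma sequence_space_pmf: "sequence_space (measure_pmf p)"
  by (simp add: sequence_space_def product_prob_space_def product_prob_space_axioms_def product_sigma_finite_def
      prob_space_measure_pmf prob_space_imp_sigma_finite)

lemma prob_space_incr: "prob_space (incr_space p)"
proof -
  interpret sequence_space "measure_pmf p" by (rule sequence_space_pmf)
  show ?thesis unfolding incr_space_def by (rule P.prob_space_axioms)
qed

lemma space_incr [simp]: "space (incr_space p) = UNIV"
  by (auto simp: incr_space_def space_PiM)

lemma measurable_incr_component [measurable]: "(\<lambda>\<omega>. \<omega> t) \<in> measurable (incr_space p) (count_space UNIV)"
proof -
  have "(\<lambda>\<omega>. \<omega> t) \<in> measurable (incr_space p) (measure_pmf p)"
    unfolding incr_space_def by (rule measurable_component_singleton) simp
  then show ?thesis by (simp cong: measurable_cong_sets)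
qed

lemma measurable_walk [measurable]: "(\<lambda>\<omega>. walk x \<omega> t) \<in> measurable (incr_space p) (count_space UNIV)"
proof (induction t)
  case 0
  then show ?case by (simp add: walk_def)
next
  case (Suc t)
  have "(\<lambda>\<omega>. walk x \<omega> t + \<omega> t) \<in> measurable (incr_space p) (count_space UNIV)"
    by (rule measurable_compose_countable[OF _ Suc, of "\<lambda>i \<omega>. i + \<omega> t"]) measurable
  then show ?case by (simp add: walk_def add.assoc)
qed

lemma walk_case_nat: "walk x (case_nat z \<omega>) = case_nat x (walk (x + z) \<omega>)"
proof
  fix t show "walk x (case_nat z \<omega>) t = case_nat x (walk (x + z) \<omega>) t"
    by (cases t) (simp_all add: walk_def sum.lessThan_Suc_shift add.assoc del: sum.lessThan_Suc)
qed

definition walk_prob :: "(int ^ 'd) pmf \<Rightarrow> ((nat \<Rightarrow> int ^ 'd) \<Rightarrow> bool) \<Rightarrow> int ^ 'd \<Rightarrow> real" where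
  "walk_prob p \<Phi> x = measure (incr_space p) {\<omega>. \<Phi> (walk x \<omega>)}"

lemma walk_prob_nonneg: "0 \<le> walk_prob p \<Phi> x" by (simp add: walk_prob_def)

lemma walk_prob_le_1: "walk_prob p \<Phi> x \<le> 1"
proof -
  interpret prob_space "incr_space p" by (rule prob_space_incr)
  show ?thesis by (simp add: walk_prob_def)
qed

text \<open>The Markov property at time one: prepending an independent increment preserves the
  product measure (\<open>PiM_iter\<close>), and the walk with a prepended increment
  \<open>z\<close> is the start followed by a walk from \<open>x + z\<close>.\<close>

lemma first_step:
  assumes meas: "{\<omega>. \<Phi> (walk x \<omega>)} \<in> sets (incr_space p)"
  shows "walk_prob p \<Phi> x = (\<integral>z. walk_prob p (\<lambda>Y. \<Phi> (case_nat x Y)) (x + z) \<partial>measure_pmf p)"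
proof -
  interpret sequence_space "measure_pmf p" by (rule sequence_space_pmf)
  interpret I: prob_space "incr_space p" by (rule prob_space_incr)
  have S: "S = incr_space p" by (simp add: incr_space_def)
  let ?E = "{\<omega>. \<Phi> (walk x \<omega>)}"
  let ?T = "\<lambda>(s, \<omega>). case_nat s \<omega> :: nat \<Rightarrow> int ^ 'a"
  have T: "?T \<in> measurable (measure_pmf p \<Otimes>\<^sub>M incr_space p) (incr_space p)"
    unfolding S[symmetric] by measurable
  have "emeasure (incr_space p) ?E = emeasure (distr (measure_pmf p \<Otimes>\<^sub>M incr_space p) (incr_space p) ?T) ?E"
    using PiM_iter by (simp only: S)
  also have "\<dots> = emeasure (measure_pmf p \<Otimes>\<^sub>M incr_space p) (?T -` ?E \<inter> space (measure_pmf p \<Otimes>\<^sub>M incr_space p))"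
    by (rule emeasure_distr[OF T meas])
  also have "\<dots> = (\<integral>\<^sup>+z. emeasure (incr_space p) (Pair z -` (?T -` ?E \<inter> space (measure_pmf p \<Otimes>\<^sub>M incr_space p))) \<partial>measure_pmf p)"
    by (rule I.emeasure_pair_measure_alt[OF measurable_sets[OF T meas]])
  also have "\<dots> = (\<integral>\<^sup>+z. ennreal (walk_prob p (\<lambda>Y. \<Phi> (case_nat x Y)) (x + z)) \<partial>measure_pmf p)"
    by (intro nn_integral_cong) (simp add: walk_prob_def I.emeasure_eq_measure space_pair_measure vimage_def walk_case_nat)
  also have "\<dots> = ennreal (\<integral>z. walk_prob p (\<lambda>Y. \<Phi> (case_nat x Y)) (x + z) \<partial>measure_pmf p)"
    by (intro nn_integral_eq_integral measure_pmf.integrable_const_bound[where B = 1])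
      (auto simp: walk_prob_nonneg walk_prob_le_1)
  finally show ?thesis
    by (simp add: I.emeasure_eq_measure walk_prob_def integral_nonneg)
qed

lemma walk_prob_True: "walk_prob p (\<lambda>_. True) x = 1"
proof -
  interpret I: prob_space "incr_space p" by (rule prob_space_incr)
  show ?thesis using I.prob_space by (simp add: walk_prob_def)
qed

lemma walk_prob_False: "walk_prob p (\<lambda>_. False) x = 0"
  by (simp add: walk_prob_def)

section \<open>The escape probability\<close>

text \<open>The condition that t precedes the exit time is written as the requirement that all
  positions up to t lie in the box. A path that never leaves the box has to avoid \<open>D\<close>
  forever.\<close>

definition escape :: "int \<Rightarrow> (int ^ 'd) set \<Rightarrow> int ^ 'd \<Rightarrow> real" where
  "escape L D = walk_prob lazy_step (\<lambda>Y. \<forall>t. (\<forall>s\<le>t. Y s \<in> zbox L) \<longrightarrow> Y t \<notin> D)"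

lemma all_nat_split: "(\<forall>t. P t) \<longleftrightarrow> P 0 \<and> (\<forall>t. P (Suc t))"
  by (metis not0_implies_Suc)

text \<open>The box is tested before the obstacles: a walk started outside has exit time zero and
  avoids \<open>D\<close> vacuously, even if it starts in \<open>D\<close>.\<close>

lemma escape_step: "escape L D x = (if x \<notin> zbox L then 1 else if x \<in> D then 0 else lazy_op (escape L D) x)"
proof -
  let ?\<Phi> = "\<lambda>Y. \<forall>t. (\<forall>s\<le>t. Y s \<in> zbox L) \<longrightarrow> Y t \<notin> D"
  have "{\<omega> \<in> space (incr_space lazy_step). ?\<Phi> (walk x \<omega>)} \<in> sets (incr_space lazy_step)"
    by measurable
  then have "escape L D x = (\<integral>z. walk_prob lazy_step (\<lambda>Y. ?\<Phi> (case_nat x Y)) (x + z) \<partial>measure_pmf lazy_step)"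
    unfolding escape_def by (intro first_step) simp
  also have "(\<lambda>Y. ?\<Phi> (case_nat x Y)) = (\<lambda>Y. x \<notin> zbox L \<or> (x \<notin> D \<and> ?\<Phi> Y))"
  proof
    fix Y :: "nat \<Rightarrow> int ^ 'a"
    have "(\<forall>s\<le>Suc t. case_nat x Y s \<in> zbox L) \<longleftrightarrow> x \<in> zbox L \<and> (\<forall>s\<le>t. Y s \<in> zbox L)" for t
      by (subst all_nat_split) auto
    then show "?\<Phi> (case_nat x Y) \<longleftrightarrow> x \<notin> zbox L \<or> (x \<notin> D \<and> ?\<Phi> Y)"
      by (subst all_nat_split) auto
  qed
  finally show ?thesis
    by (auto simp: walk_prob_True walk_prob_False expectation_lazy_step[symmetric] escape_def measure_pmf.prob_space)
qed

lemma escape_bounds: "0 \<le> escape L D x" "escape L D x \<le> 1"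
  by (simp_all add: escape_def walk_prob_nonneg walk_prob_le_1)

lemma exit_box_iff: "enat t < exit_box L Y \<longleftrightarrow> (\<forall>s\<le>t. Y s \<in> zbox L)"
proof -
  let ?P = "\<lambda>t. \<not> (\<forall>i. - L < Y t $ i \<and> Y t $ i < L)"
  have P: "?P s \<longleftrightarrow> Y s \<notin> zbox L" for s by (auto simp: zbox_def)
  show ?thesis
  proof (cases "\<exists>t. ?P t")
    case True
    then have "exit_box L Y = enat (LEAST t. ?P t)" unfolding exit_box_def by (rule if_P)
    moreover have "t < (LEAST t. ?P t) \<longleftrightarrow> (\<forall>s\<le>t. \<not> ?P s)"
      using LeastI_ex[OF True] Least_le[of ?P] not_less_Least[of _ ?P]
      by (meson leD le_less_linear le_trans)
    ultimately show ?thesis by (simp add: zbox_def)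
  next
    case False
    then have "exit_box L Y = \<infinity>" unfolding exit_box_def by (rule if_not_P)
    then show ?thesis using False P by simp
  qed
qed

lemma avoid_prob_eq: "avoid_prob N L S = escape L {y. phi N y \<in> S} 0"
  unfolding avoid_prob_def escape_def walk_prob_def exit_box_iff by simp

section \<open>The simple walk and capacity\<close>

primrec srw_avoid :: "(int ^ 'd) set \<Rightarrow> nat \<Rightarrow> int ^ 'd \<Rightarrow> real" where
  "srw_avoid K 0 = (\<lambda>x. if x \<in> K then 0 else 1)"
| "srw_avoid K (Suc n) = (\<lambda>x. if x \<in> K then 0 else srw_op (srw_avoid K n) x)"

lemma srw_avoid_walk_prob: "srw_avoid K n x = walk_prob srw_step (\<lambda>Y. \<forall>t\<le>n. Y t \<notin> K) x"
proof (induction n arbitrary: x)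
  case 0
  have "(\<lambda>\<omega>. walk x \<omega> 0 \<notin> K) = (\<lambda>\<omega>::nat \<Rightarrow> int ^ 'a. x \<notin> K)" by (simp add: walk_def)
  then show ?case using walk_prob_True[of srw_step x] by (simp add: walk_prob_def walk_def)
next
  case (Suc n)
  have "{\<omega> \<in> space (incr_space srw_step). \<forall>t\<le>Suc n. walk x \<omega> t \<notin> K} \<in> sets (incr_space srw_step)"
    by measurable
  then have "walk_prob srw_step (\<lambda>Y. \<forall>t\<le>Suc n. Y t \<notin> K) x =
      (\<integral>z. walk_prob srw_step (\<lambda>Y. \<forall>t\<le>Suc n. case_nat x Y t \<notin> K) (x + z) \<partial>measure_pmf srw_step)"
    by (intro first_step) simp
  also have "(\<lambda>Y. \<forall>t\<le>Suc n. case_nat x Y t \<notin> K) = (\<lambda>Y. x \<notin> K \<and> (\<forall>t\<le>n. Y t \<notin> K))"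
    by (rule ext, subst all_nat_split) auto
  finally have eq: "walk_prob srw_step (\<lambda>Y. \<forall>t\<le>Suc n. Y t \<notin> K) x =
      (\<integral>z. walk_prob srw_step (\<lambda>Y. x \<notin> K \<and> (\<forall>t\<le>n. Y t \<notin> K)) (x + z) \<partial>measure_pmf srw_step)" .
  have "srw_avoid K n = walk_prob srw_step (\<lambda>Y. \<forall>t\<le>n. Y t \<notin> K)" using Suc by auto
  then show ?case using eq by (auto simp: walk_prob_False expectation_srw_step[symmetric])
qed

definition srw_escape :: "(int ^ 'd) set \<Rightarrow> int ^ 'd \<Rightarrow> real" where
  "srw_escape K = walk_prob srw_step (\<lambda>Y. \<forall>t. Y t \<notin> K)"

lemma srw_avoid_tendsto: "(\<lambda>n. srw_avoid K n x) \<longlonglongrightarrow> srw_escape K x"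
proof -
  interpret I: prob_space "incr_space srw_step" by (rule prob_space_incr)
  let ?A = "\<lambda>n. {\<omega>::nat \<Rightarrow> int ^ 'a. \<forall>t\<le>n. walk x \<omega> t \<notin> K}"
  have "(\<lambda>n. measure (incr_space srw_step) (?A n)) \<longlonglongrightarrow> measure (incr_space srw_step) (\<Inter>n. ?A n)"
  proof (rule I.finite_Lim_measure_decseq)
    have "{\<omega> \<in> space (incr_space srw_step). \<forall>t\<le>n. walk x \<omega> t \<notin> K} \<in> sets (incr_space srw_step)" for n
      by measurable
    then show "range ?A \<subseteq> sets (incr_space srw_step)" by auto
    show "decseq ?A" by (auto simp: decseq_def)
  qed
  moreover have "(\<Inter>n. ?A n) = {\<omega>. \<forall>t. walk x \<omega> t \<notin> K}" by auto
  ultimately show ?thesis by (simp add: srw_avoid_walk_prob srw_escape_def walk_prob_def)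
qed

lemma srw_op_tendsto: "(\<And>y. (\<lambda>n. f n y) \<longlonglongrightarrow> g y) \<Longrightarrow> (\<lambda>n. srw_op (f n) x) \<longlonglongrightarrow> srw_op g x"
  unfolding srw_op_def by (intro tendsto_intros) auto

lemma lazy_op_tendsto: "(\<And>y. (\<lambda>n. f n y) \<longlonglongrightarrow> g y) \<Longrightarrow> (\<lambda>n. lazy_op (f n) x) \<longlonglongrightarrow> lazy_op g x"
  unfolding lazy_op_def by (intro tendsto_intros) auto

lemma srw_escape_step: "srw_escape K x = (if x \<in> K then 0 else srw_op (srw_escape K) x)"
proof -
  have "(\<lambda>n. srw_avoid K (Suc n) x) \<longlonglongrightarrow> srw_escape K x"
    by (rule LIMSEQ_Suc[OF srw_avoid_tendsto])
  moreover have "(\<lambda>n. srw_avoid K (Suc n) x) \<longlonglongrightarrow> (if x \<in> K then 0 else srw_op (srw_escape K) x)"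
    using srw_op_tendsto[of "srw_avoid K" "srw_escape K" x] srw_avoid_tendsto[of K] by simp
  ultimately show ?thesis by (rule LIMSEQ_unique)
qed

text \<open>Both limits are the largest solution bounded by one of the same Dirichlet problem,
  which does not see the laziness.\<close>

lemma avoid_tendsto: "(\<lambda>n. avoid K n x) \<longlonglongrightarrow> srw_escape K x"
proof -
  have conv: "\<exists>w. (\<lambda>n. avoid K n y) \<longlonglongrightarrow> w" for y
  proof -
    have "decseq (\<lambda>n. avoid K n y)" by (simp add: decseq_def avoid_antimono)
    then obtain w where "(\<lambda>n. avoid K n y) \<longlonglongrightarrow> w"
      by (rule decseq_convergent[of _ 0]) (auto simp: avoid_nonneg)
    then show ?thesis by blast
  qed
  define W where "W y = lim (\<lambda>n. avoid K n y)" for y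
  have W: "(\<lambda>n. avoid K n y) \<longlonglongrightarrow> W y" for y
    using conv[of y] unfolding W_def by (auto simp: convergent_LIMSEQ_iff[symmetric] convergent_def)
  have W_le_1: "W y \<le> 1" for y by (rule LIMSEQ_le_const2[OF W]) (auto intro: avoid_le_1)
  have W_step: "W y = (if y \<in> K then 0 else lazy_op W y)" for y
  proof -
    have "(\<lambda>n. avoid K (Suc n) y) \<longlonglongrightarrow> W y" by (rule LIMSEQ_Suc[OF W])
    moreover have "(\<lambda>n. avoid K (Suc n) y) \<longlonglongrightarrow> (if y \<in> K then 0 else lazy_op W y)"
      using lazy_op_tendsto[of "avoid K" W y] W by (simp add: avoid_Suc)
    ultimately show ?thesis by (rule LIMSEQ_unique)
  qed
  have esc_le_1: "srw_escape K y \<le> 1" for y by (simp add: srw_escape_def walk_prob_le_1)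
  have le1: "srw_escape K y \<le> avoid K n y" for n y
  proof (induction n arbitrary: y)
    case 0
    then show ?case using esc_le_1[of y] by (simp add: avoid_0 srw_escape_step[of K y] split: if_splits)
  next
    case (Suc n)
    have "srw_escape K y = (if y \<in> K then 0 else lazy_op (srw_escape K) y)"
      using srw_escape_step[of K y] by (simp add: lazy_op_srw_op)
    then show ?case using lazy_op_mono[of "srw_escape K" "avoid K n" y] Suc by (simp add: avoid_Suc)
  qed
  have le2: "W y \<le> srw_avoid K n y" for n y
  proof (induction n arbitrary: y)
    case 0
    then show ?case using W_le_1[of y] W_step[of y] by auto
  next
    case (Suc n)
    have "W y = (if y \<in> K then 0 else srw_op W y)"
    proof (cases "y \<in> K")
      case False
      then have "W y = (W y + srw_op W y) / 2" using W_step[of y] by (simp only: lazy_op_srw_op if_False)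
      moreover have "a = b" if "a = (a + b) / 2" for a b :: real using that by (simp add: field_simps)
      ultimately have "W y = srw_op W y" by blast
      then show ?thesis using False by (simp only: if_False)
    qed (use W_step[of y] in simp)
    then show ?case using srw_op_mono[of W "srw_avoid K n" y] Suc by simp
  qed
  have "srw_escape K x \<le> W x" by (rule LIMSEQ_le_const[OF W]) (auto intro: le1)
  moreover have "W x \<le> srw_escape K x" by (rule LIMSEQ_le_const[OF srw_avoid_tendsto]) (auto intro: le2)
  ultimately show ?thesis using W[of x] by simp
qed

text \<open>The event in \<open>Cap\<close> looks at the path from time one on, so after the first
  step it is avoidance at all times for the walk from the new site.\<close>

lemma Cap_eq: "Cap K = (\<Sum>x\<in>K. srw_op (srw_escape K) x)"
  unfolding Cap_def
proof (intro sum.cong refl)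
  fix x assume "x \<in> K"
  have "{\<omega> \<in> space (incr_space srw_step). \<forall>t\<ge>1. walk x \<omega> t \<notin> K} \<in> sets (incr_space srw_step)"
    by measurable
  then have "walk_prob srw_step (\<lambda>Y. \<forall>t\<ge>1. Y t \<notin> K) x =
      (\<integral>z. walk_prob srw_step (\<lambda>Y. \<forall>t\<ge>1. case_nat x Y t \<notin> K) (x + z) \<partial>measure_pmf srw_step)"
    by (intro first_step) simp
  also have "(\<lambda>Y. \<forall>t\<ge>1. case_nat x Y t \<notin> K) = (\<lambda>Y. \<forall>t. Y t \<notin> K)"
    by (rule ext, subst all_nat_split) auto
  finally show "measure (incr_space srw_step) {\<omega>. \<forall>t\<ge>1. walk x \<omega> t \<notin> K} = srw_op (srw_escape K) x"
    by (simp only: srw_escape_def[symmetric] expectation_srw_step) (simp add: walk_prob_def)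
qed

text \<open>From a site of \<open>K\<close> the lazy walk stays put with probability 1/2 and is then
  still in \<open>K\<close>. This halves the escape probability of the simple walk.\<close>

theorem lazy_avoid_tendsto_Cap: "(\<lambda>n. \<Sum>k\<in>K. lazy_op (avoid K n) k) \<longlonglongrightarrow> Cap K / 2"
proof -
  have "(\<lambda>n. \<Sum>k\<in>K. lazy_op (avoid K n) k) \<longlonglongrightarrow> (\<Sum>k\<in>K. lazy_op (srw_escape K) k)"
    by (intro tendsto_sum lazy_op_tendsto avoid_tendsto)
  also have "(\<Sum>k\<in>K. lazy_op (srw_escape K) k) = (\<Sum>k\<in>K. srw_op (srw_escape K) k / 2)"
    by (intro sum.cong refl) (simp add: lazy_op_srw_op srw_escape_step[of K])
  finally show ?thesis by (simp add: Cap_eq sum_divide_distrib)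
qed

lemma Cap_nonneg: "0 \<le> Cap K"
  unfolding Cap_def by (intro sum_nonneg) simp

section \<open>The projection to the torus\<close>

lemma torus_unique:
  assumes "N > 0" "y \<in> torus N" "y' \<in> torus N" "\<forall>i. y $ i mod int N = y' $ i mod int N"
  shows "y = y'"
  unfolding vec_eq_iff
proof
  fix i
  have "- real N / 2 \<le> real_of_int (y $ i)" "real_of_int (y $ i) < real N / 2"
    "- real N / 2 \<le> real_of_int (y' $ i)" "real_of_int (y' $ i) < real N / 2"
    using assms(2,3) by (auto simp: torus_def)
  then have "\<bar>real_of_int (y $ i - y' $ i)\<bar> < real N" by (simp add: abs_if)
  then have "\<bar>y $ i - y' $ i\<bar> < int N" by linarith
  moreover have "int N dvd y $ i - y' $ i" using assms(4) by (simp add: mod_eq_dvd_iff)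
  ultimately show "y $ i = y' $ i"
    using zdvd_not_zless[of "\<bar>y $ i - y' $ i\<bar>" "int N"] by fastforce
qed

lemma phi_props:
  assumes "N > 0"
  shows "phi N x \<in> torus N" "\<forall>i. phi N x $ i mod int N = x $ i mod int N"
proof -
  \<comment> \<open>Reduction to [0, N) after a shift by the rounded-down half of N; for either
    parity this lands in the half-open cell [-N/2, N/2).\<close>
  define y where "y = (\<chi> i. (x $ i + int N div 2) mod int N - int N div 2)"
  have y: "y \<in> torus N"
    unfolding torus_def
  proof (rule CollectI, rule allI)
    fix i
    have r: "0 \<le> (x $ i + int N div 2) mod int N" "(x $ i + int N div 2) mod int N < int N" using assms by auto
    have "2 * (int N div 2) \<le> int N" "int N \<le> 2 * (int N div 2) + 1" by linarith+
    then have "- int N \<le> 2 * y $ i" "2 * y $ i < int N" using r by (simp_all add: y_def)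
    then show "- real N / 2 \<le> real_of_int (y $ i) \<and> real_of_int (y $ i) < real N / 2" by linarith
  qed
  have ym: "\<forall>i. y $ i mod int N = x $ i mod int N"
    by (simp add: y_def mod_diff_left_eq)
  have "\<exists>!y. y \<in> torus N \<and> (\<forall>i. y $ i mod int N = x $ i mod int N)"
  proof (intro ex1I[of _ y])
    fix z assume z: "z \<in> torus N \<and> (\<forall>i. z $ i mod int N = x $ i mod int N)"
    show "z = y" by (rule torus_unique[OF assms]) (use z y ym in auto)
  qed (use y ym in auto)
  from theI'[OF this] show "phi N x \<in> torus N" "\<forall>i. phi N x $ i mod int N = x $ i mod int N"
    unfolding phi_def by auto
qed

lemma phi_eq_iff: "N > 0 \<Longrightarrow> phi N x = phi N y \<longleftrightarrow> (\<forall>i. x $ i mod int N = y $ i mod int N)"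
  using phi_props[of N x] phi_props[of N y] torus_unique[of N "phi N x" "phi N y"] by metis

text \<open>Reducing modulo N before or after translating gives the same class, so meeting the
  translated set on the torus means meeting a periodic set on the lattice.\<close>

lemma phi_mem_obst:
  assumes "N > 0"
  shows "phi N y \<in> tau N a ` phi N ` K \<longleftrightarrow> y \<in> obst N a K"
proof -
  have "phi N y = tau N a (phi N k) \<longleftrightarrow> (\<forall>i. y $ i mod int N = (k + a) $ i mod int N)" for k
  proof -
    have "(phi N k + a) $ i mod int N = (k + a) $ i mod int N" for i
      using phi_props(2)[OF assms, of k] by (auto intro: mod_add_cong)
    then show ?thesis unfolding tau_def phi_eq_iff[OF assms] by simp
  qed
  then show ?thesis unfolding obst_def by auto
qed

lemma component_le_inorm: "\<bar>real_of_int (x $ i)\<bar> \<le> inorm x"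
proof -
  have "(real_of_int (x $ i))\<^sup>2 \<le> (\<Sum>j\<in>UNIV. (real_of_int (x $ j))\<^sup>2)"
    by (rule member_le_sum) auto
  then show ?thesis unfolding inorm_def using real_le_rsqrt by (metis abs_le_square_iff power2_abs real_sqrt_abs real_sqrt_le_iff)
qed

lemma inorm_le:
  fixes x :: "int ^ 'd"
  assumes "\<And>i. \<bar>x $ i\<bar> \<le> int n"
  shows "inorm x \<le> sqrt (real CARD('d)) * real n"
proof -
  have "(\<Sum>j\<in>UNIV. (real_of_int (x $ j))\<^sup>2) \<le> (\<Sum>j\<in>(UNIV::'d set). (real n)\<^sup>2)"
  proof (intro sum_mono)
    fix j show "(real_of_int (x $ j))\<^sup>2 \<le> (real n)\<^sup>2"
      using assms[of j] by (intro abs_le_square_iff[THEN iffD1]) linarith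
  qed
  then have "inorm x \<le> sqrt (real CARD('d) * (real n)\<^sup>2)" unfolding inorm_def by simp
  then show ?thesis by (simp add: real_sqrt_mult)
qed

section \<open>Eigenfunctions of the box and the cross term\<close>

definition eig :: "('d \<Rightarrow> real) \<Rightarrow> int ^ 'd \<Rightarrow> real" where
  "eig c x = (\<Prod>i\<in>UNIV. cos (c i * real_of_int (x $ i)))"

text \<open>One minus the eigenvalue of \<open>eig c\<close> under the lazy walk.\<close>

definition eig_rate :: "('d::finite \<Rightarrow> real) \<Rightarrow> real" where
  "eig_rate c = (\<Sum>i\<in>UNIV. 1 - cos (c i)) / (2 * real CARD('d))"

lemma eig_split: "eig c x = cos (c i * real_of_int (x $ i)) * (\<Prod>j\<in>UNIV - {i}. cos (c j * real_of_int (x $ j)))"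
  unfolding eig_def by (rule prod.remove) auto

lemma eig_axis:
  "eig c (x + axis i 1) = cos (c i * real_of_int (x $ i) + c i) * (\<Prod>j\<in>UNIV - {i}. cos (c j * real_of_int (x $ j)))"
  "eig c (x - axis i 1) = cos (c i * real_of_int (x $ i) - c i) * (\<Prod>j\<in>UNIV - {i}. cos (c j * real_of_int (x $ j)))"
  unfolding eig_split[of c _ i]
  by (auto simp: axis_def distrib_left right_diff_distrib intro!: arg_cong2[where f = "(*)"] prod.cong)

lemma lazy_op_eig: "lazy_op (eig c) x = (1 - eig_rate c) * eig c (x :: int ^ 'd)"
proof -
  have *: "eig c (x + axis i 1) + eig c (x - axis i 1) = 2 * cos (c i) * eig c x" for i
    unfolding eig_axis eig_split[of c x i] by (simp add: cos_add cos_diff algebra_simps)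
  have **: "(\<Sum>i\<in>UNIV. 1 - cos (c i)) = real CARD('d) - (\<Sum>i\<in>UNIV. cos (c i))" by (simp add: sum_subtractf)
  show ?thesis
    unfolding lazy_op_def * eig_rate_def ** sum_distrib_right[symmetric] sum_distrib_left[symmetric]
    by (simp add: field_simps)
qed

lemma abs_prod_cos_le: "\<bar>\<Prod>i\<in>A. cos (f i :: real)\<bar> \<le> 1"
  unfolding abs_prod by (rule prod_le_1) auto

lemma eig_abs_le: "\<bar>eig c x\<bar> \<le> 1"
  unfolding eig_def by (rule abs_prod_cos_le)

lemma abs_cos_diff_le: "\<bar>cos (a + h) - cos a\<bar> \<le> \<bar>h::real\<bar>"
proof -
  have "cos (a + h) - cos a = 2 * sin ((a + h + a) / 2) * sin ((a - (a + h)) / 2)"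
    by (rule cos_diff_cos)
  then have "\<bar>cos (a + h) - cos a\<bar> = 2 * (\<bar>sin ((a + h + a) / 2)\<bar> * \<bar>sin ((a - (a + h)) / 2)\<bar>)"
    by (simp add: abs_mult)
  also have "\<dots> \<le> 2 * (1 * \<bar>(a - (a + h)) / 2\<bar>)"
    by (intro mult_left_mono mult_mono abs_sin_x_le_abs_x) auto
  finally show ?thesis by simp
qed

lemma eig_diff_le: 
  "\<bar>eig c (x + axis i 1) - eig c x\<bar> \<le> \<bar>c i\<bar>" "\<bar>eig c (x - axis i 1) - eig c x\<bar> \<le> \<bar>c i\<bar>"
proof -
  let ?r = "\<Prod>j\<in>UNIV - {i}. cos (c j * real_of_int (x $ j))"
  have *: "\<bar>cos (a + h) * ?r - cos a * ?r\<bar> \<le> \<bar>h\<bar>" for a h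
  proof -
    have "\<bar>cos (a + h) * ?r - cos a * ?r\<bar> = \<bar>cos (a + h) - cos a\<bar> * \<bar>?r\<bar>"
      by (simp add: abs_mult left_diff_distrib[symmetric])
    also have "\<dots> \<le> \<bar>h\<bar> * 1" by (intro mult_mono abs_cos_diff_le abs_prod_cos_le) auto
    finally show ?thesis by simp
  qed
  show "\<bar>eig c (x + axis i 1) - eig c x\<bar> \<le> \<bar>c i\<bar>"
    unfolding eig_axis eig_split[of c x i] by (rule *)
  show "\<bar>eig c (x - axis i 1) - eig c x\<bar> \<le> \<bar>c i\<bar>"
    unfolding eig_axis eig_split[of c x i] using *[of "c i * real_of_int (x $ i)" "- c i"] by simp
qed

definition odd_freq :: "('d \<Rightarrow> nat) \<Rightarrow> int \<Rightarrow> 'd \<Rightarrow> real" where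
  "odd_freq k l i = (2 * real (k i) + 1) * pi / 2 / real_of_int l"

lemma cos_odd_multiple: "cos ((2 * real k + 1) * pi / 2) = 0"
proof -
  have "(2 * real k + 1) * pi / 2 = real k * pi + pi / 2" by (simp add: field_simps)
  then show ?thesis by (simp only: cos_add) simp
qed

lemma eig_boundary:
  assumes "l > 0" "x \<in> czbox l" "x \<notin> zbox l"
  shows "eig (odd_freq k l) x = 0"
proof -
  obtain i where i: "\<not> (- l < x $ i \<and> x $ i < l)" using assms(3) by (auto simp: zbox_def)
  have "x $ i = l \<or> x $ i = - l" using i assms(2)[unfolded czbox_def, simplified, rule_format, of i] by linarith
  then have "cos (odd_freq k l i * real_of_int (x $ i)) = 0"
    using assms(1) cos_odd_multiple[of "k i"] by (auto simp: odd_freq_def)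
  then show ?thesis using eig_split[of _ x i] by simp
qed

lemma eig_zero [simp]: "eig c 0 = 1"
  by (simp add: eig_def)

section \<open>Estimates for the cross term\<close>

text \<open>For \<phi>(s) = s powr (3/2) the factor of \<open>q\<close> is the Bregman divergence
  \<phi>(b^2) - \<phi>(a^2) - \<phi>'(a^2) (b^2 - a^2), which equals (b - a)^2 (b + a/2). Half of (b
  - a)^2 (a + b) is kept, and the inequality of arithmetic and geometric means with weight
  \<open>q\<close> gives |b - a| (a + b).\<close>

lemma bregman_bound:
  fixes a b q :: real
  assumes "0 \<le> a" "0 \<le> b" "0 < q"
  shows "\<bar>b\<^sup>2 - a\<^sup>2\<bar> \<le> q * (b ^ 3 - a ^ 3 - 3 / 2 * a * (b\<^sup>2 - a\<^sup>2)) + (a + b) / (2 * q)"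
proof (cases "a + b = 0")
  case True
  then have "a = 0" "b = 0" using assms by auto
  then show ?thesis by simp
next
  case False
  then have ab: "0 < a + b" using assms by linarith
  define h where "h = \<bar>b - a\<bar>"
  have eq: "b ^ 3 - a ^ 3 - 3 / 2 * a * (b\<^sup>2 - a\<^sup>2) = h\<^sup>2 * (b + a / 2)"
    by (simp add: h_def power2_eq_square power3_eq_cube field_simps)
  have "h\<^sup>2 * ((a + b) / 2) \<le> h\<^sup>2 * (b + a / 2)"
    using assms by (intro mult_left_mono) auto
  then have 1: "q * (h\<^sup>2 * ((a + b) / 2)) \<le> q * (h\<^sup>2 * (b + a / 2))"
    using assms by (intro mult_left_mono) auto
  have "0 \<le> (a + b) / (2 * q) * (q * h - 1)\<^sup>2" using ab assms by simp
  also have "\<dots> = q * (h\<^sup>2 * ((a + b) / 2)) - h * (a + b) + (a + b) / (2 * q)"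
    using assms by (simp add: power2_eq_square field_simps)
  finally have 2: "h * (a + b) \<le> q * (h\<^sup>2 * ((a + b) / 2)) + (a + b) / (2 * q)" by linarith
  have "b\<^sup>2 - a\<^sup>2 = (b - a) * (a + b)" by (simp add: power2_eq_square algebra_simps)
  then have "\<bar>b\<^sup>2 - a\<^sup>2\<bar> = h * (a + b)" using ab by (simp add: h_def abs_mult)
  then show ?thesis using 1 2 unfolding eq by linarith
qed

text \<open>The tangent of the square root at 4 \<eta>^2. Being affine in \<open>v\<close>, it
  reduces expected sums of square roots to those of \<open>v\<close>.\<close>

lemma sqrt_le_affine: "0 \<le> v \<Longrightarrow> 0 < \<eta> \<Longrightarrow> sqrt v \<le> \<eta> + v / (4 * \<eta>)"
proof -
  assume v: "0 \<le> v" "0 < \<eta>"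
  have "0 \<le> (sqrt v - 2 * \<eta>)\<^sup>2 / (4 * \<eta>)" using v by simp
  also have "\<dots> = v / (4 * \<eta>) - sqrt v + \<eta>" using v by (simp add: power2_eq_square field_simps)
  finally show ?thesis by linarith
qed

lemma lazy_op_abs_diff_le:
  fixes v :: "int ^ 'd \<Rightarrow> real"
  assumes v: "\<And>y. 0 \<le> v y" and q: "0 < q" "0 < \<eta>" and f: "lazy_op v x = v x + f" "0 \<le> f"
  shows "lazy_op (\<lambda>y. \<bar>v y - v x\<bar>) x \<le>
     q * (lazy_op (\<lambda>y. sqrt (v y) ^ 3) x - sqrt (v x) ^ 3) + (2 * \<eta> + (2 * v x + f) / (4 * \<eta>)) / (2 * q)"
proof -
  let ?a = "sqrt (v x)"
  have "lazy_op (\<lambda>y. \<bar>v y - v x\<bar>) x \<le>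
      lazy_op (\<lambda>y. q * (sqrt (v y) ^ 3 - ?a ^ 3 - 3 / 2 * ?a * (v y - v x)) + (?a + sqrt (v y)) * (1 / (2 * q))) x"
  proof (rule lazy_op_mono)
    fix y
    show "\<bar>v y - v x\<bar> \<le> q * (sqrt (v y) ^ 3 - ?a ^ 3 - 3 / 2 * ?a * (v y - v x)) + (?a + sqrt (v y)) * (1 / (2 * q))"
      using bregman_bound[of ?a "sqrt (v y)" q] v q by simp
  qed
  also have "\<dots> = q * (lazy_op (\<lambda>y. sqrt (v y) ^ 3) x - ?a ^ 3 - 3 / 2 * ?a * (lazy_op v x - v x)) +
      (?a + lazy_op (\<lambda>y. sqrt (v y)) x) * (1 / (2 * q))"
    unfolding lazy_op_add lazy_op_cmult lazy_op_diff mult.commute[of "_ + _" "1 / (2 * q)"] lazy_op_const ..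
  also have "q * (lazy_op (\<lambda>y. sqrt (v y) ^ 3) x - ?a ^ 3 - 3 / 2 * ?a * (lazy_op v x - v x)) \<le>
      q * (lazy_op (\<lambda>y. sqrt (v y) ^ 3) x - ?a ^ 3)"
    using f v q by (intro mult_left_mono) auto
  also have "(?a + lazy_op (\<lambda>y. sqrt (v y)) x) * (1 / (2 * q)) \<le> (2 * \<eta> + (2 * v x + f) / (4 * \<eta>)) * (1 / (2 * q))"
  proof (rule mult_right_mono)
    have "lazy_op (\<lambda>y. sqrt (v y)) x \<le> lazy_op (\<lambda>y. \<eta> + 1 / (4 * \<eta>) * v y) x"
      using sqrt_le_affine[OF v q(2)] by (intro lazy_op_mono) simp
    also have "\<dots> = \<eta> + 1 / (4 * \<eta>) * (v x + f)" by (simp only: lazy_op_add lazy_op_const lazy_op_cmult f)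
    finally have "lazy_op (\<lambda>y. sqrt (v y)) x \<le> \<eta> + (v x + f) / (4 * \<eta>)" by simp
    moreover have "(2 * v x + f) / (4 * \<eta>) = v x / (4 * \<eta>) + (v x + f) / (4 * \<eta>)"
      by (simp add: add_divide_distrib[symmetric])
    ultimately show "?a + lazy_op (\<lambda>y. sqrt (v y)) x \<le> 2 * \<eta> + (2 * v x + f) / (4 * \<eta>)"
      using sqrt_le_affine[OF v[of x] q(2)] by linarith
  qed (use q in auto)
  finally show ?thesis by simp
qed

text \<open>The discrete product rule. The last term is the covariance of the two increments over
  one step.\<close>

lemma lazy_op_prod:
  "lazy_op (\<lambda>y. e y * w y) x = e x * lazy_op w x + w x * lazy_op e x - e x * w x
     + lazy_op (\<lambda>y. (e y - e x) * (w y - w x)) x"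
proof -
  have "(\<lambda>y. (e y - e x) * (w y - w x)) = (\<lambda>y. e y * w y - e x * w y - (w x * e y - e x * w x))"
    by (auto simp: algebra_simps)
  then show ?thesis by (simp only: lazy_op_diff lazy_op_cmult lazy_op_const)
qed

text \<open>The cross term is controlled by the Bregman divergence of the function v powr (3/2), where
  v = 1 - w: its expected sum along the path is at most one, since v is a bounded submartingale, and
  the weight sqrt v that it gains over the quadratic variation is small on average.\<close>

lemma occ_cross_le:
  fixes w f :: "int ^ 'd \<Rightarrow> real" and D l
  defines "U \<equiv> zbox l - D"
  assumes l: "0 \<le> l" and w: "\<And>y. 0 \<le> w y" "\<And>y. w y \<le> 1"
    and f: "\<And>y. 0 \<le> f y" "\<And>y. y \<notin> D \<Longrightarrow> lazy_op w y = w y - f y"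
    and q: "0 < q" "0 < \<eta>" and \<delta>: "\<And>i. \<bar>c i\<bar> \<le> \<delta>"
  shows "occ U n (\<lambda>x. \<bar>lazy_op (\<lambda>y. (eig c y - eig c x) * (w y - w x)) x\<bar>) 0 \<le>
     \<delta> * (q + (2 * \<eta> * occ U n (\<lambda>_. 1) 0 + (2 * occ U n (\<lambda>y. 1 - w y) 0 + occ U n f 0) / (4 * \<eta>)) / (2 * q))"
proof -
  define v where "v y = 1 - w y" for y
  let ?\<phi> = "\<lambda>y. sqrt (v y) ^ 3"
  have v: "0 \<le> v y" "v y \<le> 1" for y using w[of y] by (auto simp: v_def)
  have \<delta>0: "0 \<le> \<delta>" using \<delta>[of undefined] by linarith
  have Pv: "lazy_op v y = v y + f y" if "y \<in> U" for y
  proof -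
    have "lazy_op v y = 1 - lazy_op w y" unfolding v_def[abs_def] by (simp only: lazy_op_diff lazy_op_const)
    then show ?thesis using f(2)[of y] that by (simp add: U_def v_def)
  qed
  have cross: "\<bar>lazy_op (\<lambda>y. (eig c y - eig c x) * (w y - w x)) x\<bar> \<le>
     \<delta> * (q * (lazy_op ?\<phi> x - ?\<phi> x) + (2 * \<eta> + (2 * v x + f x) / (4 * \<eta>)) / (2 * q))" if "x \<in> U" for x
  proof -
    have "\<bar>lazy_op (\<lambda>y. (eig c y - eig c x) * (w y - w x)) x\<bar> \<le> lazy_op (\<lambda>y. \<bar>(eig c y - eig c x) * (w y - w x)\<bar>) x"
      by (rule lazy_op_abs_le)
    also have "\<dots> \<le> lazy_op (\<lambda>y. \<delta> * \<bar>v y - v x\<bar>) x"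
    proof (rule lazy_op_mono_local)
      have *: "\<bar>(eig c y - eig c x) * (w y - w x)\<bar> \<le> \<delta> * \<bar>v y - v x\<bar>" if "\<bar>eig c y - eig c x\<bar> \<le> \<delta>" for y
        using mult_right_mono[OF that, of "\<bar>w y - w x\<bar>"] by (simp add: abs_mult v_def abs_minus_commute)
      show "\<bar>(eig c x - eig c x) * (w x - w x)\<bar> \<le> \<delta> * \<bar>v x - v x\<bar>" by simp
      fix i
      show "\<bar>(eig c (x + axis i 1) - eig c x) * (w (x + axis i 1) - w x)\<bar> \<le> \<delta> * \<bar>v (x + axis i 1) - v x\<bar>"
        by (rule *) (rule order_trans[OF eig_diff_le(1) \<delta>])
      show "\<bar>(eig c (x - axis i 1) - eig c x) * (w (x - axis i 1) - w x)\<bar> \<le> \<delta> * \<bar>v (x - axis i 1) - v x\<bar>"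
        by (rule *) (rule order_trans[OF eig_diff_le(2) \<delta>])
    qed
    also have "\<dots> = \<delta> * lazy_op (\<lambda>y. \<bar>v y - v x\<bar>) x" by (rule lazy_op_cmult)
    also have "\<dots> \<le> \<delta> * (q * (lazy_op ?\<phi> x - ?\<phi> x) + (2 * \<eta> + (2 * v x + f x) / (4 * \<eta>)) / (2 * q))"
      by (rule mult_left_mono[OF lazy_op_abs_diff_le[OF v(1) q Pv[OF that] f(1)] \<delta>0])
    finally show ?thesis .
  qed
  have \<phi>: "0 \<le> ?\<phi> y" "?\<phi> y \<le> 1" for y
    using v[of y] by (auto intro!: power_le_one)
  have energy: "occ U n (\<lambda>x. lazy_op ?\<phi> x - ?\<phi> x) 0 \<le> 1"
  proof -
    have "occ U n (\<lambda>x. lazy_op ?\<phi> x - ?\<phi> x) 0 \<le> 1 - ?\<phi> 0"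
      unfolding U_def
    proof (rule occ_le_supersolution[OF nbr_closed_zbox, of l "\<lambda>y. 1 - ?\<phi> y"])
      show "lazy_op ?\<phi> y - ?\<phi> y \<le> 1 - ?\<phi> y - lazy_op (\<lambda>y. 1 - ?\<phi> y) y" for y
        by (simp only: lazy_op_diff lazy_op_const)
      show "0 \<in> czbox l" using l by (simp add: czbox_def)
    qed (use \<phi> in simp)
    then show ?thesis using \<phi>(1)[of 0] by linarith
  qed
  have "occ U n (\<lambda>x. \<bar>lazy_op (\<lambda>y. (eig c y - eig c x) * (w y - w x)) x\<bar>) 0 \<le>
      occ U n (\<lambda>x. \<delta> * (q * (lazy_op ?\<phi> x - ?\<phi> x) + 1 / (2 * q) * (2 * \<eta> * 1 + 1 / (4 * \<eta>) * (2 * v x + f x)))) 0"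
    using cross by (intro occ_mono) simp
  also have "\<dots> = \<delta> * (q * occ U n (\<lambda>x. lazy_op ?\<phi> x - ?\<phi> x) 0 +
      1 / (2 * q) * (2 * \<eta> * occ U n (\<lambda>_. 1) 0 + 1 / (4 * \<eta>) * (2 * occ U n v 0 + occ U n f 0)))"
    by (simp only: occ_cmult occ_add)
  also have "\<dots> \<le> \<delta> * (q * 1 + 1 / (2 * q) * (2 * \<eta> * occ U n (\<lambda>_. 1) 0 + 1 / (4 * \<eta>) * (2 * occ U n v 0 + occ U n f 0)))"
    using energy q \<delta>0 by (intro mult_left_mono add_right_mono) auto
  finally show ?thesis unfolding v_def[abs_def] by simp
qed

text \<open>Dynkin's formula for the product of \<open>eig c\<close> and \<open>w\<close>, whose
  value at the origin is \<open>w 0\<close>. The summands on the right pay, in this order, for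
  replacing \<open>f\<close> by \<open>\<gamma>\<close>, for replacing \<open>w\<close> by 1 in the
  eigenvalue term, for the cross term, and for the paths that survive \<open>n\<close>
  steps.\<close>

lemma box_main:
  fixes w f :: "int ^ 'd \<Rightarrow> real" and D l k
  defines "U \<equiv> zbox l - D" and "c \<equiv> odd_freq k l"
  assumes l: "0 < l" and w: "\<And>y. 0 \<le> w y" "\<And>y. w y \<le> 1" "\<And>y. y \<in> D \<Longrightarrow> w y = 0"
    and f: "\<And>y. 0 \<le> f y" "\<And>y. f y \<le> \<gamma>" "\<And>y. y \<notin> D \<Longrightarrow> lazy_op w y = w y - f y"
    and q: "0 < q" "0 < \<eta>" and \<delta>: "\<And>i. \<bar>c i\<bar> \<le> \<delta>"
  shows "\<bar>w 0 - (\<gamma> + eig_rate c) * occ U n (eig c) 0\<bar> \<le>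
     occ U n (\<lambda>y. \<gamma> - f y) 0 + eig_rate c * occ U n (\<lambda>y. 1 - w y) 0
     + \<delta> * (q + (2 * \<eta> * occ U n (\<lambda>_. 1) 0 + (2 * occ U n (\<lambda>y. 1 - w y) 0 + occ U n f 0) / (4 * \<eta>)) / (2 * q))
     + surv U n (\<lambda>_. 1) 0"
proof -
  let ?e = "eig c" and ?\<mu> = "eig_rate c"
  let ?cr = "\<lambda>x. lazy_op (\<lambda>y. (?e y - ?e x) * (w y - w x)) x"
  have rate0: "0 \<le> ?\<mu>" unfolding eig_rate_def by (intro divide_nonneg_nonneg sum_nonneg) auto
  have tel: "?e 0 * w 0 = occ U n (\<lambda>x. ((\<gamma> + ?\<mu>) * ?e x - ?e x * (\<gamma> - f x)) - (?\<mu> * (?e x * (1 - w x)) + ?cr x)) 0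
      + surv U n (\<lambda>y. ?e y * w y) 0"
  proof (rule occ_telescope[of U "czbox l"])
    show "nbr_closed U (czbox l)" unfolding U_def by (rule nbr_closed_zbox)
    show "0 \<in> czbox l" using l by (simp add: czbox_def)
    \<comment> \<open>On the faces of the box the cosine product vanishes, on \<open>D\<close> the
      function \<open>w\<close> does.\<close>
    show "?e y * w y = 0" if "y \<in> czbox l" "y \<notin> U" for y
      using that w(3)[of y] eig_boundary[OF l that(1), of k] by (auto simp: U_def c_def)
    show "((\<gamma> + ?\<mu>) * ?e x - ?e x * (\<gamma> - f x)) - (?\<mu> * (?e x * (1 - w x)) + ?cr x) =
        ?e x * w x - lazy_op (\<lambda>y. ?e y * w y) x" if "x \<in> U" for x
    proof -
      have "lazy_op w x = w x - f x" using that by (intro f(3)) (simp add: U_def)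
      then show ?thesis by (simp only: lazy_op_prod[of ?e w] lazy_op_eig) (simp add: algebra_simps)
    qed
  qed
  have e1: "\<bar>?e y * z\<bar> \<le> z" if "0 \<le> z" for y z
    using mult_right_mono[OF eig_abs_le[of c y], of z] that by (simp add: abs_mult)
  have b1: "\<bar>occ U n (\<lambda>x. ?e x * (\<gamma> - f x)) 0\<bar> \<le> occ U n (\<lambda>y. \<gamma> - f y) 0"
    using f by (intro order_trans[OF occ_abs_le] occ_mono e1) simp
  have b2: "\<bar>occ U n (\<lambda>x. ?e x * (1 - w x)) 0\<bar> \<le> occ U n (\<lambda>y. 1 - w y) 0"
    using w by (intro order_trans[OF occ_abs_le] occ_mono e1) simp
  have b3: "\<bar>occ U n ?cr 0\<bar> \<le> \<delta> * (q + (2 * \<eta> * occ U n (\<lambda>_. 1) 0 + (2 * occ U n (\<lambda>y. 1 - w y) 0 + occ U n f 0) / (4 * \<eta>)) / (2 * q))"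
    unfolding U_def using l w f q \<delta> by (intro order_trans[OF occ_abs_le] occ_cross_le) auto
  have b4: "\<bar>surv U n (\<lambda>y. ?e y * w y) 0\<bar> \<le> surv U n (\<lambda>_. 1) 0"
  proof (intro order_trans[OF surv_abs_le] surv_mono)
    fix y show "\<bar>?e y * w y\<bar> \<le> 1" using e1[of "w y" y] w(1,2)[of y] by linarith
  qed
  have b2': "\<bar>?\<mu> * occ U n (\<lambda>x. ?e x * (1 - w x)) 0\<bar> \<le> ?\<mu> * occ U n (\<lambda>y. 1 - w y) 0"
    using mult_left_mono[OF b2 rate0] rate0 by (simp add: abs_mult)
  have "w 0 = ((\<gamma> + ?\<mu>) * occ U n ?e 0 - occ U n (\<lambda>x. ?e x * (\<gamma> - f x)) 0)
      - (?\<mu> * occ U n (\<lambda>x. ?e x * (1 - w x)) 0 + occ U n ?cr 0) + surv U n (\<lambda>y. ?e y * w y) 0"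
    using tel by (simp only: occ_diff occ_add occ_cmult eig_zero mult_1)
  then show ?thesis using b1 b2' b3 b4 by linarith
qed

section \<open>Approximating one by odd cosine polynomials\<close>

text \<open>The Taylor coefficients of (1 - z) powr (-1/2) at zero.\<close>

definition invsqrt_coeff :: "nat \<Rightarrow> real" where
  "invsqrt_coeff i = (- 1) ^ i * ((- 1 / 2) gchoose i)"

text \<open>Negating the upper index absorbs the sign and leaves a product of the positive factors i
  - 1/2 - j with j < i.\<close>

lemma invsqrt_coeff_nonneg: "0 \<le> invsqrt_coeff i"
proof -
  have "invsqrt_coeff i = (real i - 1 / 2) gchoose i"
    unfolding invsqrt_coeff_def using gbinomial_negated_upper[of "- 1 / 2 :: real" i]
    by (simp add: mult.assoc[symmetric] power_add[symmetric] mult_2[symmetric])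
  also have "\<dots> = (\<Prod>j = 0..<i. real i - 1 / 2 - real j) / fact i" by (rule gbinomial_prod_rev)
  also have "\<dots> \<ge> 0" by (intro divide_nonneg_nonneg prod_nonneg) auto
  finally show ?thesis .
qed

lemma invsqrt_coeff_sums:
  assumes "0 < cos \<theta>"
  shows "(\<lambda>i. invsqrt_coeff i * sin \<theta> ^ (2 * i)) sums (1 / cos \<theta>)"
proof -
  have c: "(cos \<theta>)\<^sup>2 = 1 + (- (sin \<theta>)\<^sup>2)" by (simp add: cos_squared_eq)
  have "(sin \<theta>)\<^sup>2 < 1" using assms c by (smt (verit) zero_less_power)
  then have "(\<lambda>n. ((- 1 / 2) gchoose n) * (- (sin \<theta>)\<^sup>2) ^ n) sums (1 + (- (sin \<theta>)\<^sup>2)) powr (- 1 / 2)"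
    by (intro gen_binomial_real) simp
  moreover have "(1 + (- (sin \<theta>)\<^sup>2)) powr (- 1 / 2) = 1 / cos \<theta>"
    unfolding c[symmetric] using assms by (simp add: powr_minus_divide powr_half_sqrt)
  moreover have "((- 1 / 2) gchoose n) * (- (sin \<theta>)\<^sup>2) ^ n = invsqrt_coeff n * sin \<theta> ^ (2 * n)" for n
    unfolding invsqrt_coeff_def power_minus[of "(sin \<theta>)\<^sup>2"] by (simp add: power_mult)
  ultimately show ?thesis by simp
qed

text \<open>The product of cos and the truncated series of 1 / cos, since cos is the root of 1 -
  sin^2. Non-negative coefficients make it increase to 1 while it stays in [0, 1] wherever cos is
  non-negative. The factor cos leaves only odd frequencies, and these are the ones whose cosines
  vanish at the end points of [-pi/2, pi/2].\<close>

definition qpoly :: "nat \<Rightarrow> real \<Rightarrow> real" where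
  "qpoly j \<theta> = cos \<theta> * (\<Sum>i<j. invsqrt_coeff i * sin \<theta> ^ (2 * i))"

lemma sin_even_power_nonneg: "0 \<le> sin \<theta> ^ (2 * i)" for \<theta> :: real
  by (simp add: power_mult)

lemma qpoly_nonneg: "0 \<le> cos \<theta> \<Longrightarrow> 0 \<le> qpoly j \<theta>"
  unfolding qpoly_def by (intro mult_nonneg_nonneg sum_nonneg invsqrt_coeff_nonneg sin_even_power_nonneg) auto

lemma qpoly_le_1: "0 \<le> cos \<theta> \<Longrightarrow> qpoly j \<theta> \<le> 1"
proof (cases "cos \<theta> = 0")
  case False
  assume "0 \<le> cos \<theta>"
  then have pos: "0 < cos \<theta>" using False by simp
  have "(\<Sum>i<j. invsqrt_coeff i * sin \<theta> ^ (2 * i)) \<le> 1 / cos \<theta>"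
    using invsqrt_coeff_sums[OF pos] sum_le_suminf[OF sums_summable[OF invsqrt_coeff_sums[OF pos]], of "{..<j}"]
    by (simp add: sums_iff invsqrt_coeff_nonneg sin_even_power_nonneg)
  then show ?thesis using pos by (simp add: qpoly_def field_simps)
qed (simp add: qpoly_def)

lemma qpoly_tendsto: "0 < cos \<theta> \<Longrightarrow> (\<lambda>j. qpoly j \<theta>) \<longlonglongrightarrow> 1"
proof -
  assume pos: "0 < cos \<theta>"
  have "(\<lambda>j. qpoly j \<theta>) \<longlonglongrightarrow> cos \<theta> * (1 / cos \<theta>)"
    unfolding qpoly_def using invsqrt_coeff_sums[OF pos] unfolding sums_def by (intro tendsto_intros)
  then show ?thesis using pos by simp
qed

text \<open>The omitted tail is a power series in sin^2 with non-negative coefficients, hence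
  largest where the cosine is smallest.\<close>

lemma qpoly_uniform:
  assumes "0 < cos \<theta>0" "cos \<theta>0 \<le> cos \<theta>"
  shows "1 - qpoly j \<theta> \<le> (1 - qpoly j \<theta>0) / cos \<theta>0"
proof -
  have pos: "0 < cos \<theta>" using assms by linarith
  have s: "sin \<theta> ^ (2 * i) \<le> sin \<theta>0 ^ (2 * i)" for i
  proof -
    have "(cos \<theta>0)\<^sup>2 \<le> (cos \<theta>)\<^sup>2" using assms by (intro power_mono) auto
    then have "(sin \<theta>)\<^sup>2 \<le> (sin \<theta>0)\<^sup>2" by (simp add: cos_squared_eq)
    from power_mono[OF this, of i] show ?thesis by (simp add: power_mult)
  qed
  have tail: "(\<lambda>i. invsqrt_coeff (i + j) * sin t ^ (2 * (i + j))) sums (1 / cos t - (\<Sum>i<j. invsqrt_coeff i * sin t ^ (2 * i)))" if "0 < cos t" for t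
    using sums_split_initial_segment[OF invsqrt_coeff_sums[OF that], of j] .
  have "1 / cos \<theta> - (\<Sum>i<j. invsqrt_coeff i * sin \<theta> ^ (2 * i)) \<le> 1 / cos \<theta>0 - (\<Sum>i<j. invsqrt_coeff i * sin \<theta>0 ^ (2 * i))"
    by (rule sums_le[OF _ tail[OF pos] tail[OF assms(1)]]) (intro mult_left_mono s invsqrt_coeff_nonneg)
  then have "cos \<theta> * (1 / cos \<theta> - (\<Sum>i<j. invsqrt_coeff i * sin \<theta> ^ (2 * i))) \<le> 1 * (1 / cos \<theta>0 - (\<Sum>i<j. invsqrt_coeff i * sin \<theta>0 ^ (2 * i)))"
    using pos qpoly_le_1[of \<theta> j] by (intro mult_mono) (auto simp: qpoly_def field_simps)
  moreover have "cos \<theta> * (1 / cos \<theta> - (\<Sum>i<j. invsqrt_coeff i * sin \<theta> ^ (2 * i))) = 1 - qpoly j \<theta>"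
    using pos by (simp add: qpoly_def right_diff_distrib)
  moreover have "1 / cos \<theta>0 - (\<Sum>i<j. invsqrt_coeff i * sin \<theta>0 ^ (2 * i)) = (1 - qpoly j \<theta>0) / cos \<theta>0"
    using assms by (simp add: qpoly_def diff_divide_distrib)
  ultimately show ?thesis by simp
qed

section \<open>Odd cosine polynomials\<close>

text \<open>A span defined by closure rules, so that stability under multiplication by sin^2 needs a
  computation for the basis functions only. Coefficients are recovered in
  \<open>oddcos_expansion\<close>.\<close>

inductive oddcos :: "(real \<Rightarrow> real) \<Rightarrow> bool" where
  basis: "oddcos (\<lambda>\<theta>. cos ((2 * real k + 1) * \<theta>))"
| add: "oddcos f \<Longrightarrow> oddcos g \<Longrightarrow> oddcos (\<lambda>\<theta>. f \<theta> + g \<theta>)"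
| scale: "oddcos f \<Longrightarrow> oddcos (\<lambda>\<theta>. c * f \<theta>)"

lemma oddcos_sin_squared: "oddcos f \<Longrightarrow> oddcos (\<lambda>\<theta>. f \<theta> * (sin \<theta>)\<^sup>2)"
proof (induction rule: oddcos.induct)
  case (basis k)
  \<comment> \<open>For \<open>k\<close> = 0 the lower frequency is -1, which is 1 again because the
    cosine is even.\<close>
  have low: "oddcos (\<lambda>\<theta>. cos ((2 * real k - 1) * \<theta>))"
  proof (cases k)
    case 0
    then show ?thesis using oddcos.basis[of 0] by simp
  next
    case (Suc m)
    then show ?thesis using oddcos.basis[of m] by (simp add: algebra_simps)
  qed
  have id: "cos ((2 * real k + 1) * \<theta>) * (sin \<theta>)\<^sup>2 =
      1 / 2 * cos ((2 * real k + 1) * \<theta>) + (- 1 / 4) * (cos ((2 * real (Suc k) + 1) * \<theta>) + cos ((2 * real k - 1) * \<theta>))" for \<theta>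
  proof -
    define a where "a = (2 * real k + 1) * \<theta>"
    have "(2 * real (Suc k) + 1) * \<theta> = a + 2 * \<theta>" "(2 * real k - 1) * \<theta> = a - 2 * \<theta>"
      by (simp_all add: a_def algebra_simps)
    moreover have "cos a * (sin \<theta>)\<^sup>2 = 1 / 2 * cos a + (- 1 / 4) * (cos (a + 2 * \<theta>) + cos (a - 2 * \<theta>))"
      unfolding cos_add cos_diff cos_double_sin by (simp add: algebra_simps)
    ultimately show ?thesis unfolding a_def[symmetric] by simp
  qed
  show ?case unfolding id by (intro oddcos.add oddcos.scale oddcos.basis low)
next
  case (add f g)
  then show ?case by (simp add: distrib_right oddcos.add)
next
  case (scale f c)
  then show ?case by (simp add: mult.assoc oddcos.scale)
qed

lemma oddcos_zero: "oddcos (\<lambda>_. 0)"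
  using oddcos.scale[OF oddcos.basis[of 0], of 0] by simp

lemma oddcos_sum: "(\<And>i. i \<in> A \<Longrightarrow> oddcos (f i)) \<Longrightarrow> oddcos (\<lambda>\<theta>. \<Sum>i\<in>A. f i \<theta>)"
  by (induction A rule: infinite_finite_induct) (auto intro: oddcos.add oddcos_zero)

lemma oddcos_qpoly: "oddcos (qpoly j)"
proof -
  have *: "oddcos (\<lambda>\<theta>. cos \<theta> * sin \<theta> ^ (2 * i))" for i
  proof (induction i)
    case 0
    then show ?case using oddcos.basis[of 0] by simp
  next
    case (Suc i)
    then show ?case using oddcos_sin_squared[OF Suc] by (simp add: power2_eq_square mult_ac)
  qed
  have "qpoly j = (\<lambda>\<theta>. \<Sum>i<j. invsqrt_coeff i * (cos \<theta> * sin \<theta> ^ (2 * i)))"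
    by (auto simp: qpoly_def sum_distrib_left mult_ac)
  then show ?thesis by (simp only:) (intro oddcos_sum oddcos.scale *)
qed

lemma oddcos_expansion: "oddcos f \<Longrightarrow> \<exists>J b. \<forall>\<theta>. f \<theta> = (\<Sum>k<J. b k * cos ((2 * real k + 1) * \<theta>))"
proof (induction rule: oddcos.induct)
  case (basis k)
  have "\<forall>\<theta>. cos ((2 * real k + 1) * \<theta>) = (\<Sum>m<Suc k. (if m = k then 1 else 0) * cos ((2 * real m + 1) * \<theta>))"
    by (simp add: if_distrib[of "\<lambda>x. x * _"] cong: if_cong)
  then show ?case by (intro exI[of _ "Suc k"] exI[of _ "\<lambda>m. if m = k then 1 else 0"])
next
  case (add f g)
  then obtain J b J' b' where f: "\<forall>\<theta>. f \<theta> = (\<Sum>k<J. b k * cos ((2 * real k + 1) * \<theta>))"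
    and g: "\<forall>\<theta>. g \<theta> = (\<Sum>k<J'. b' k * cos ((2 * real k + 1) * \<theta>))" by blast
  have pad: "(\<Sum>k<J. b k * cos ((2 * real k + 1) * \<theta>)) =
      (\<Sum>k<J''. (if k < J then b k else 0) * cos ((2 * real k + 1) * \<theta>))" if "J \<le> J''" for J J'' b \<theta>
  proof -
    have "(\<Sum>k<J''. (if k < J then b k else 0) * cos ((2 * real k + 1) * \<theta>)) =
        (\<Sum>k<J. (if k < J then b k else 0) * cos ((2 * real k + 1) * \<theta>))"
      by (rule sum.mono_neutral_right) (use that in auto)
    then show ?thesis by simp
  qed
  have "\<forall>\<theta>. f \<theta> + g \<theta> = (\<Sum>k<max J J'. ((if k < J then b k else 0) + (if k < J' then b' k else 0)) * cos ((2 * real k + 1) * \<theta>))"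
    using f g pad[of J "max J J'" b] pad[of J' "max J J'" b'] by (simp add: distrib_right sum.distrib)
  then show ?case by (intro exI)
next
  case (scale f c)
  then obtain J b where "\<forall>\<theta>. f \<theta> = (\<Sum>k<J. b k * cos ((2 * real k + 1) * \<theta>))" by blast
  then have "\<forall>\<theta>. c * f \<theta> = (\<Sum>k<J. (c * b k) * cos ((2 * real k + 1) * \<theta>))" by (simp add: sum_distrib_left mult.assoc)
  then show ?case by (intro exI)
qed

text \<open>The scaling by pi/2 puts common zeros of the cosines at u = 1 and u = -1, the faces of
  the cube.\<close>

lemma prod_qpoly_expansion:
  obtains \<Lambda> :: "('d::finite \<Rightarrow> nat) set" and b where "finite \<Lambda>"
    "\<And>u. (\<Prod>i\<in>UNIV. qpoly j (pi / 2 * u i)) = (\<Sum>k\<in>\<Lambda>. b k * (\<Prod>i\<in>UNIV. cos ((2 * real (k i) + 1) * pi / 2 * u i)))"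
proof -
  obtain J b where b: "\<And>\<theta>. qpoly j \<theta> = (\<Sum>k<J. b k * cos ((2 * real k + 1) * \<theta>))"
    using oddcos_expansion[OF oddcos_qpoly] by blast
  show thesis
  proof (rule that[of "PiE UNIV (\<lambda>_. {..<J})" "\<lambda>k. \<Prod>i\<in>UNIV. b (k i)"])
    fix u :: "'d \<Rightarrow> real"
    have "(\<Prod>i\<in>UNIV. qpoly j (pi / 2 * u i)) = (\<Prod>i\<in>UNIV. \<Sum>k<J. b k * cos ((2 * real k + 1) * pi / 2 * u i))"
      unfolding b by (simp add: mult_ac)
    also have "\<dots> = (\<Sum>k\<in>PiE UNIV (\<lambda>_. {..<J}). \<Prod>i\<in>UNIV. b (k i) * cos ((2 * real (k i) + 1) * pi / 2 * u i))"
      by (rule prod_sum_PiE) auto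
    finally show "(\<Prod>i\<in>UNIV. qpoly j (pi / 2 * u i)) =
        (\<Sum>k\<in>PiE UNIV (\<lambda>_. {..<J}). (\<Prod>i\<in>UNIV. b (k i)) * (\<Prod>i\<in>UNIV. cos ((2 * real (k i) + 1) * pi / 2 * u i)))"
      by (simp add: prod.distrib)
  qed (auto intro: finite_PiE)
qed

section \<open>The exit time of Brownian motion\<close>

text \<open>Freezing an independent variable: the joint law is a product, and the inner integral
  over \<open>H\<close> is taken with the value of \<open>G\<close> held fixed.\<close>

lemma (in prob_space) indep_integral:
  fixes \<Psi> :: "'b \<Rightarrow> 'b \<Rightarrow> real"
  assumes ind: "indep_var S G T H" and \<Psi> [measurable]: "case_prod \<Psi> \<in> borel_measurable (S \<Otimes>\<^sub>M T)"
    and bd: "\<And>g h. \<bar>\<Psi> g h\<bar> \<le> C" and \<phi>: "\<And>g. g \<in> space S \<Longrightarrow> (\<integral>\<omega>. \<Psi> g (H \<omega>) \<partial>M) = \<phi> g"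
  shows "(\<integral>\<omega>. \<Psi> (G \<omega>) (H \<omega>) \<partial>M) = (\<integral>\<omega>. \<phi> (G \<omega>) \<partial>M)"
proof -
  have G [measurable]: "G \<in> measurable M S" and H [measurable]: "H \<in> measurable M T"
    and eq: "distr M S G \<Otimes>\<^sub>M distr M T H = distr M (S \<Otimes>\<^sub>M T) (\<lambda>\<omega>. (G \<omega>, H \<omega>))"
    using ind unfolding indep_var_distribution_eq by auto
  interpret D1: prob_space "distr M S G" by (rule prob_space_distr) (rule G)
  interpret D2: prob_space "distr M T H" by (rule prob_space_distr) (rule H)
  interpret P: pair_prob_space "distr M S G" "distr M T H" ..
  have int: "integrable (distr M S G \<Otimes>\<^sub>M distr M T H) (case_prod \<Psi>)"
    by (rule P.integrable_const_bound[of _ C]) (auto simp: bd split: prod.split)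
  have "(\<integral>\<omega>. \<Psi> (G \<omega>) (H \<omega>) \<partial>M) = (\<integral>p. case_prod \<Psi> p \<partial>distr M (S \<Otimes>\<^sub>M T) (\<lambda>\<omega>. (G \<omega>, H \<omega>)))"
    by (subst integral_distr) auto
  also have "\<dots> = (\<integral>g. \<integral>h. \<Psi> g h \<partial>distr M T H \<partial>distr M S G)"
    unfolding eq[symmetric] by (rule P.integral_fst[symmetric, OF int, simplified])
  also have "\<dots> = (\<integral>\<omega>. \<integral>h. \<Psi> (G \<omega>) h \<partial>distr M T H \<partial>M)"
    by (rule integral_distr) measurable
  also have "\<dots> = (\<integral>\<omega>. \<phi> (G \<omega>) \<partial>M)"
  proof (rule Bochner_Integration.integral_cong[OF refl])
    fix \<omega> assume "\<omega> \<in> space M"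
    then have g: "G \<omega> \<in> space S" by (rule measurable_space[OF G])
    have "(\<integral>h. \<Psi> (G \<omega>) h \<partial>distr M T H) = (\<integral>\<omega>'. \<Psi> (G \<omega>) (H \<omega>') \<partial>M)"
      using g by (intro integral_distr) measurable
    then show "(\<integral>h. \<Psi> (G \<omega>) h \<partial>distr M T H) = \<phi> (G \<omega>)" using \<phi>[OF g] by simp
  qed
  finally show ?thesis .
qed

text \<open>The characteristic function of the normal law is real, so the sine part has mean zero
  and the phase contributes only cos a.\<close>

lemma (in prob_space) normal_expectation_cos:
  assumes X: "distributed M lborel X (normal_density 0 s)" and s: "0 < s"
  shows "(\<integral>\<omega>. cos (a + k * X \<omega>) \<partial>M) = cos a * exp (- (k\<^sup>2 * s\<^sup>2) / 2)"
proof -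
  have X_meas [measurable]: "X \<in> borel_measurable M" using distributed_measurable[OF X] by simp
  define Z where "Z \<omega> = X \<omega> / s" for \<omega>
  have Zm [measurable]: "Z \<in> borel_measurable M" unfolding Z_def by measurable
  have "distributed M lborel (\<lambda>\<omega>. (X \<omega> - 0) / s) std_normal_density"
    using normal_standard_normal_convert[OF s, of X 0] X by simp
  then have "distr M lborel Z = density lborel std_normal_density"
    unfolding Z_def[abs_def] by (simp add: distributed_def)
  then have dZ: "distr M borel Z = std_normal_distribution"
    by (metis distr_cong sets_lborel)
  let ?t = "k * s"
  have "(CLINT \<omega>|M. iexp (?t * Z \<omega>)) = char std_normal_distribution ?t"
    unfolding char_def dZ[symmetric] by (subst integral_distr) auto
  also have "\<dots> = complex_of_real (exp (- (?t\<^sup>2) / 2))" by (simp add: char_std_normal_distribution)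
  finally have ch: "(CLINT \<omega>|M. iexp (?t * Z \<omega>)) = complex_of_real (exp (- (?t\<^sup>2) / 2))" .
  have int: "integrable M (\<lambda>\<omega>. iexp (?t * Z \<omega>))"
    by (rule integrable_iexp) auto
  have "(\<integral>\<omega>. Re (iexp (?t * Z \<omega>)) \<partial>M) = exp (- (?t\<^sup>2) / 2)"
    using integral_Re[OF int] ch by simp
  moreover have "(\<integral>\<omega>. Im (iexp (?t * Z \<omega>)) \<partial>M) = 0"
    using integral_Im[OF int] ch by simp
  moreover have "Re (iexp y) = cos y" "Im (iexp y) = sin y" for y
    by (simp_all add: Re_exp Im_exp)
  ultimately have c: "(\<integral>\<omega>. cos (?t * Z \<omega>) \<partial>M) = exp (- (?t\<^sup>2) / 2)" and sn: "(\<integral>\<omega>. sin (?t * Z \<omega>) \<partial>M) = 0"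
    by (simp_all only:)
  have "k * X \<omega> = ?t * Z \<omega>" for \<omega> using s by (simp add: Z_def)
  then have "(\<integral>\<omega>. cos (a + k * X \<omega>) \<partial>M) = (\<integral>\<omega>. cos a * cos (?t * Z \<omega>) - sin a * sin (?t * Z \<omega>) \<partial>M)"
    by (simp only: cos_add)
  also have "\<dots> = (\<integral>\<omega>. cos a * cos (?t * Z \<omega>) \<partial>M) - (\<integral>\<omega>. sin a * sin (?t * Z \<omega>) \<partial>M)"
    by (rule Bochner_Integration.integral_diff)
      (auto intro!: integrable_const_bound[of _ 1] simp: abs_mult mult_le_one)
  also have "\<dots> = cos a * exp (- (k\<^sup>2 * s\<^sup>2) / 2)"
    using c sn by (simp add: power_mult_distrib)
  finally show ?thesis .
qed

lemma sum_lessThan_telescope_diff: "(\<Sum>m<k. f (Suc m) - f m) = f k - (f 0 :: 'a::ab_group_add)"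
  by (induction k) auto

definition cospr :: "('d \<Rightarrow> real) \<Rightarrow> ('d::finite \<Rightarrow> real) \<Rightarrow> real" where
  "cospr \<kappa> y = (\<Prod>i\<in>UNIV. cos (\<kappa> i * y i))"

definition inbox :: "real \<Rightarrow> ('d::finite \<Rightarrow> real) \<Rightarrow> real" where
  "inbox r y = (\<Prod>i\<in>UNIV. indicator {- r<..<r} (y i))"

lemma inbox_eq: "inbox r y = (if \<forall>i. \<bar>y i\<bar> < r then 1 else 0)"
proof (cases "\<forall>i. \<bar>y i\<bar> < r")
  case True
  then have "y i \<in> {- r<..<r}" for i by (auto simp: abs_less_iff minus_less_iff)
  then show ?thesis using True by (simp add: inbox_def)
next
  case False
  then obtain i where "\<not> \<bar>y i\<bar> < r" by blast
  then have "y i \<notin> {- r<..<r}" by auto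
  then have "(\<Prod>i\<in>UNIV. indicat_real {- r<..<r} (y i)) = 0"
    by (intro prod_zero bexI[of _ i]) (simp_all add: indicator_def)
  then show ?thesis unfolding if_not_P[OF False] inbox_def .
qed

lemma cospr_abs_le: "\<bar>cospr \<kappa> y\<bar> \<le> 1"
  unfolding cospr_def by (rule abs_prod_cos_le)

section \<open>Brownian motion on a grid\<close>

locale bm = prob_space M for M :: "'w measure" +
  fixes B :: "real \<Rightarrow> 'w \<Rightarrow> real ^ 'd"
  assumes BM: "std_BM M B"
begin

lemma B_0: "\<omega> \<in> space M \<Longrightarrow> B 0 \<omega> = 0"
  and B_cont: "\<omega> \<in> space M \<Longrightarrow> continuous_on {0..} (\<lambda>t. B t \<omega>)"
  using BM by (auto simp: std_BM_def)

lemma B_indep: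
  assumes "ts 0 = 0" "\<And>k. k < n \<Longrightarrow> ts k < ts (Suc k)"
  shows "indep_vars (\<lambda>_. borel) (\<lambda>(k, i) \<omega>. (B (ts (Suc k)) \<omega> - B (ts k) \<omega>) $ i) ({..<n} \<times> UNIV)"
    and "k < n \<Longrightarrow> distributed M lborel (\<lambda>\<omega>. (B (ts (Suc k)) \<omega> - B (ts k) \<omega>) $ i) (normal_density 0 (sqrt (ts (Suc k) - ts k)))"
  using BM assms unfolding std_BM_def by blast+

lemma B_distributed: 
  assumes "0 < t"
  shows "distributed M lborel (\<lambda>\<omega>. B t \<omega> $ i) (normal_density 0 (sqrt t))"
proof -
  have "distributed M lborel (\<lambda>\<omega>. (B (real (Suc 0) * t) \<omega> - B (real 0 * t) \<omega>) $ i)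
      (normal_density 0 (sqrt (real (Suc 0) * t - real 0 * t)))"
    by (rule B_indep(2)[of "\<lambda>k. real k * t" 1 0]) (use assms in auto)
  then have *: "distributed M lborel (\<lambda>\<omega>. (B t \<omega> - B 0 \<omega>) $ i) (normal_density 0 (sqrt t))" by simp
  then have m: "(\<lambda>\<omega>. (B t \<omega> - B 0 \<omega>) $ i) \<in> borel_measurable M" using distributed_measurable by fastforce
  have "distr M lborel (\<lambda>\<omega>. (B t \<omega> - B 0 \<omega>) $ i) = distr M lborel (\<lambda>\<omega>. B t \<omega> $ i)"
    by (rule distr_cong) (auto simp: B_0)
  moreover have "(\<lambda>\<omega>. B t \<omega> $ i) \<in> borel_measurable M"
    using m by (subst measurable_cong[where g = "\<lambda>\<omega>. (B t \<omega> - B 0 \<omega>) $ i"]) (auto simp: B_0)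
  ultimately show ?thesis using * by (simp add: distributed_def)
qed

lemma B_measurable [measurable]:
  assumes "0 \<le> t"
  shows "(\<lambda>\<omega>. B t \<omega> $ i) \<in> borel_measurable M"
proof (cases "t = 0")
  case True
  then show ?thesis by (subst measurable_cong[where g = "\<lambda>_. 0"]) (auto simp: B_0)
next
  case False
  then show ?thesis using B_distributed[of t i] assms distributed_measurable by fastforce
qed

definition bpath :: "real \<Rightarrow> nat \<Rightarrow> nat \<Rightarrow> 'w \<Rightarrow> 'd \<Rightarrow> real" where
  "bpath t n k \<omega> i = B (real k * t / real n) \<omega> $ i"

text \<open>An indicator written as a product: measurability reduces to the factors, and the last
  time splits off.\<close>

definition good :: "real \<Rightarrow> real \<Rightarrow> nat \<Rightarrow> nat \<Rightarrow> 'w \<Rightarrow> real" where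
  "good r t n k \<omega> = (\<Prod>j\<le>k. inbox r (bpath t n j \<omega>))"

lemma bpath_measurable [measurable]: "0 \<le> t \<Longrightarrow> (\<lambda>\<omega>. bpath t n k \<omega> i) \<in> borel_measurable M"
  unfolding bpath_def by (rule B_measurable) simp

lemma cospr_measurable [measurable]: "0 \<le> t \<Longrightarrow> (\<lambda>\<omega>. cospr \<kappa> (bpath t n k \<omega>)) \<in> borel_measurable M"
  unfolding cospr_def by (intro borel_measurable_prod) simp

lemma good_measurable [measurable]: "0 \<le> t \<Longrightarrow> good r t n k \<in> borel_measurable M"
  unfolding good_def[abs_def] inbox_def
  by (intro borel_measurable_prod borel_measurable_indicator' ) auto

lemma good_eq: "good r t n k \<omega> = (if \<forall>j\<le>k. \<forall>i. \<bar>bpath t n j \<omega> i\<bar> < r then 1 else 0)"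
proof (cases "\<forall>j\<le>k. \<forall>i. \<bar>bpath t n j \<omega> i\<bar> < r")
  case True
  then show ?thesis by (simp add: good_def inbox_eq)
next
  case False
  then obtain j where "j \<le> k" "\<not> (\<forall>i. \<bar>bpath t n j \<omega> i\<bar> < r)" by blast
  then have "j \<le> k" "inbox r (bpath t n j \<omega>) = 0" by (simp_all only: inbox_eq if_False)
  then have "(\<Prod>j\<le>k. inbox r (bpath t n j \<omega>)) = 0" by (intro prod_zero) auto
  then show ?thesis unfolding if_not_P[OF False] good_def .
qed

text \<open>Given the past increments, those of the next step are independent Gaussians, one for
  each coordinate, and averaging multiplies each cosine by exp (- \<kappa>^2 h / 2) with h = t / n.
  The indicator \<open>good\<close> at \<open>k\<close> depends on the past alone.\<close>

lemma grid_step: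
  assumes t: "0 < t" and k: "k < n"
  shows "(\<integral>\<omega>. good r t n k \<omega> * cospr \<kappa> (bpath t n (Suc k) \<omega>) \<partial>M) =
    exp (- (\<Sum>i\<in>UNIV. (\<kappa> i)\<^sup>2) / 2 * (t / real n)) * (\<integral>\<omega>. good r t n k \<omega> * cospr \<kappa> (bpath t n k \<omega>) \<partial>M)"
proof -
  define ts where "ts j = real j * t / real n" for j
  have n: "0 < n" using k by simp
  have ts0: "ts 0 = 0" by (simp add: ts_def)
  have tsd: "ts (Suc j) - ts j = t / real n" for j
    by (simp add: ts_def add_divide_distrib distrib_right)
  have tsinc: "ts j < ts (Suc j)" for j
  proof -
    have "0 < t / real n" using t n by simp
    then show ?thesis using tsd[of j] by linarith
  qed
  define X where "X = (\<lambda>(k, i) \<omega>. (B (ts (Suc k)) \<omega> - B (ts k) \<omega>) $ i)"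
  let ?J = "{..<k} \<times> (UNIV :: 'd set)" and ?K = "{k} \<times> (UNIV :: 'd set)"
  define G where "G \<omega> = restrict (\<lambda>p. X p \<omega>) ?J" for \<omega>
  define H where "H \<omega> = restrict (\<lambda>p. X p \<omega>) ?K" for \<omega>
  have indX: "indep_vars (\<lambda>_. borel) X ({..<n} \<times> UNIV)"
    unfolding X_def using B_indep(1)[OF ts0 tsinc, of n] by simp
  have ind: "indep_var (PiM ?J (\<lambda>_. borel)) G (PiM ?K (\<lambda>_. borel)) H"
    unfolding G_def H_def by (rule indep_var_restrict[OF indX]) (use k in auto)
  \<comment> \<open>Positions are rebuilt as partial sums of increments, which exhibits
    \<open>good\<close> as a function of the past \<open>G\<close>.\<close>
  define x where "x g j i = (\<Sum>m<j. g (m, i))" for g :: "nat \<times> 'd \<Rightarrow> real" and j i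
  have x: "x (G \<omega>) j i = bpath t n j \<omega> i" if "j \<le> k" "\<omega> \<in> space M" for j i \<omega>
  proof -
    have "x (G \<omega>) j i = (\<Sum>m<j. B (ts (Suc m)) \<omega> $ i - B (ts m) \<omega> $ i)"
      unfolding x_def using that by (intro sum.cong refl) (auto simp: G_def X_def)
    also have "\<dots> = B (ts j) \<omega> $ i - B (ts 0) \<omega> $ i" by (rule sum_lessThan_telescope_diff)
    finally show ?thesis using that by (simp add: ts0 B_0 bpath_def ts_def)
  qed
  have h: "H \<omega> (k, i) = bpath t n (Suc k) \<omega> i - bpath t n k \<omega> i" for \<omega> i
    by (simp add: H_def X_def bpath_def ts_def)
  define A where "A g = (\<Prod>j\<le>k. inbox r (x g j))" for g
  define \<Psi> where "\<Psi> g h = A g * (\<Prod>i\<in>UNIV. cos (\<kappa> i * x g k i + \<kappa> i * h (k, i)))" for g and h :: "nat \<times> 'd \<Rightarrow> real"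
  have xm: "(\<lambda>g. x g j i) \<in> borel_measurable (PiM ?J (\<lambda>_. borel))" if "j \<le> k" for j i
    unfolding x_def by (intro borel_measurable_sum measurable_component_singleton) (use that in auto)
  have Am: "A \<in> borel_measurable (PiM ?J (\<lambda>_. borel))"
    unfolding A_def[abs_def] inbox_def
    by (intro borel_measurable_prod measurable_compose[OF xm borel_measurable_indicator]) auto
  have hm: "(\<lambda>h. h (k, i)) \<in> borel_measurable (PiM ?K (\<lambda>_. borel :: real measure))" for i
    by (intro measurable_component_singleton) auto
  have \<Psi>m: "case_prod \<Psi> \<in> borel_measurable (PiM ?J (\<lambda>_. borel) \<Otimes>\<^sub>M PiM ?K (\<lambda>_. borel))"
  proof -
    note [measurable] = Am xm[OF order_refl] hm
    show ?thesis unfolding \<Psi>_def[abs_def] by measurable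
  qed
  have A01: "A g = 0 \<or> A g = 1" for g
    unfolding A_def inbox_eq by (induction k) auto
  have bd: "\<bar>\<Psi> g h\<bar> \<le> 1" for g h
    using A01[of g] abs_prod_cos_le[of "\<lambda>i. \<kappa> i * x g k i + \<kappa> i * h (k, i)" UNIV] by (auto simp: \<Psi>_def)
  have inner: "(\<integral>\<omega>. \<Psi> g (H \<omega>) \<partial>M) = A g * (\<Prod>i\<in>UNIV. cos (\<kappa> i * x g k i) * exp (- ((\<kappa> i)\<^sup>2 * (t / real n)) / 2))" for g
  proof -
    have "indep_vars (\<lambda>_. borel) (\<lambda>p \<omega>. cos (\<kappa> (snd p) * x g k (snd p) + \<kappa> (snd p) * X p \<omega>)) ({..<n} \<times> UNIV)"
      by (rule indep_vars_compose2[OF indX]) measurable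
    then have "indep_vars (\<lambda>_. borel) (\<lambda>p \<omega>. cos (\<kappa> (snd p) * x g k (snd p) + \<kappa> (snd p) * X p \<omega>)) ?K"
      by (rule indep_vars_subset) (use k in auto)
    then have "(\<integral>\<omega>. (\<Prod>p\<in>?K. cos (\<kappa> (snd p) * x g k (snd p) + \<kappa> (snd p) * X p \<omega>)) \<partial>M) =
        (\<Prod>p\<in>?K. \<integral>\<omega>. cos (\<kappa> (snd p) * x g k (snd p) + \<kappa> (snd p) * X p \<omega>) \<partial>M)"
    proof (intro indep_vars_lebesgue_integral)
      fix p assume "p \<in> ?K"
      then have "X p \<in> borel_measurable M" using indX k unfolding indep_vars_def2 by auto
      then show "integrable M (\<lambda>\<omega>. cos (\<kappa> (snd p) * x g k (snd p) + \<kappa> (snd p) * X p \<omega>))"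
        by (intro integrable_const_bound[of _ 1]) auto
    qed auto
    also have "\<dots> = (\<Prod>p\<in>?K. cos (\<kappa> (snd p) * x g k (snd p)) * exp (- ((\<kappa> (snd p))\<^sup>2 * (t / real n)) / 2))"
    proof (intro prod.cong refl)
      fix p assume p: "p \<in> ?K"
      have "distributed M lborel (X p) (normal_density 0 (sqrt (t / real n)))"
        using B_indep(2)[OF ts0 tsinc k, of "snd p"] p tsd[of k] by (auto simp: X_def)
      from normal_expectation_cos[OF this, of "\<kappa> (snd p) * x g k (snd p)" "\<kappa> (snd p)"] t n
      show "(\<integral>\<omega>. cos (\<kappa> (snd p) * x g k (snd p) + \<kappa> (snd p) * X p \<omega>) \<partial>M) =
          cos (\<kappa> (snd p) * x g k (snd p)) * exp (- ((\<kappa> (snd p))\<^sup>2 * (t / real n)) / 2)"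
        by simp
    qed
    finally have eq: "(\<integral>\<omega>. (\<Prod>p\<in>?K. cos (\<kappa> (snd p) * x g k (snd p) + \<kappa> (snd p) * X p \<omega>)) \<partial>M) =
      (\<Prod>p\<in>?K. cos (\<kappa> (snd p) * x g k (snd p)) * exp (- ((\<kappa> (snd p))\<^sup>2 * (t / real n)) / 2))" .
    have re: "(\<Prod>p\<in>?K. F p) = (\<Prod>i\<in>UNIV. F (k, i))" for F :: "nat \<times> 'd \<Rightarrow> real"
      by (rule prod.reindex_bij_witness[of _ "\<lambda>i. (k, i)" snd]) auto
    have "(\<integral>\<omega>. \<Psi> g (H \<omega>) \<partial>M) = A g * (\<integral>\<omega>. (\<Prod>i\<in>UNIV. cos (\<kappa> i * x g k i + \<kappa> i * X (k, i) \<omega>)) \<partial>M)"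
      unfolding \<Psi>_def H_def by simp
    then show ?thesis using eq unfolding re by simp
  qed
  have "(\<integral>\<omega>. good r t n k \<omega> * cospr \<kappa> (bpath t n (Suc k) \<omega>) \<partial>M) = (\<integral>\<omega>. \<Psi> (G \<omega>) (H \<omega>) \<partial>M)"
  proof (rule Bochner_Integration.integral_cong[OF refl])
    fix \<omega> assume \<omega>: "\<omega> \<in> space M"
    have "A (G \<omega>) = good r t n k \<omega>"
      unfolding A_def good_def using x[OF _ \<omega>] by (intro prod.cong refl arg_cong[where f = "inbox r"]) auto
    moreover have "(\<Prod>i\<in>UNIV. cos (\<kappa> i * x (G \<omega>) k i + \<kappa> i * H \<omega> (k, i))) = cospr \<kappa> (bpath t n (Suc k) \<omega>)"
      unfolding cospr_def h using x[OF order_refl \<omega>] by (simp add: algebra_simps)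
    ultimately show "good r t n k \<omega> * cospr \<kappa> (bpath t n (Suc k) \<omega>) = \<Psi> (G \<omega>) (H \<omega>)" by (simp add: \<Psi>_def)
  qed
  also have "\<dots> = (\<integral>\<omega>. A (G \<omega>) * (\<Prod>i\<in>UNIV. cos (\<kappa> i * x (G \<omega>) k i) * exp (- ((\<kappa> i)\<^sup>2 * (t / real n)) / 2)) \<partial>M)"
    by (rule indep_integral[OF ind \<Psi>m bd, of "\<lambda>g. A g * (\<Prod>i\<in>UNIV. cos (\<kappa> i * x g k i) * exp (- ((\<kappa> i)\<^sup>2 * (t / real n)) / 2))"])
      (rule inner)
  also have "\<dots> = (\<integral>\<omega>. exp (- (\<Sum>i\<in>UNIV. (\<kappa> i)\<^sup>2) / 2 * (t / real n)) * (good r t n k \<omega> * cospr \<kappa> (bpath t n k \<omega>)) \<partial>M)"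
  proof (rule Bochner_Integration.integral_cong[OF refl])
    fix \<omega> assume \<omega>: "\<omega> \<in> space M"
    have "A (G \<omega>) = good r t n k \<omega>"
      unfolding A_def good_def using x[OF _ \<omega>] by (intro prod.cong refl arg_cong[where f = "inbox r"]) auto
    moreover have "(\<Prod>i\<in>UNIV. cos (\<kappa> i * x (G \<omega>) k i)) = cospr \<kappa> (bpath t n k \<omega>)"
      unfolding cospr_def using x[OF order_refl \<omega>] by simp
    moreover have "(\<Prod>i\<in>UNIV. exp (- ((\<kappa> i)\<^sup>2 * (t / real n)) / 2)) = exp (- (\<Sum>i\<in>UNIV. (\<kappa> i)\<^sup>2) / 2 * (t / real n))"
    proof -
      have "(\<Sum>i\<in>UNIV. - ((\<kappa> i)\<^sup>2 * (t / real n)) / 2) = - (\<Sum>i\<in>UNIV. (\<kappa> i)\<^sup>2) / 2 * (t / real n)"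
        by (simp add: sum_negf sum_divide_distrib[symmetric] sum_distrib_right[symmetric])
      then show ?thesis by (simp only: exp_sum[OF finite, symmetric])
    qed
    ultimately show "A (G \<omega>) * (\<Prod>i\<in>UNIV. cos (\<kappa> i * x (G \<omega>) k i) * exp (- ((\<kappa> i)\<^sup>2 * (t / real n)) / 2)) =
        exp (- (\<Sum>i\<in>UNIV. (\<kappa> i)\<^sup>2) / 2 * (t / real n)) * (good r t n k \<omega> * cospr \<kappa> (bpath t n k \<omega>))"
      by (simp add: prod.distrib)
  qed
  finally show ?thesis by simp
qed


lemma good_Suc: "good r t n (Suc k) \<omega> = good r t n k \<omega> * inbox r (bpath t n (Suc k) \<omega>)"
  by (simp add: good_def)

lemma good_range: "0 \<le> good r t n k \<omega>" "good r t n k \<omega> \<le> 1"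
  by (simp_all add: good_eq)

definition osc :: "real \<Rightarrow> nat \<Rightarrow> 'w \<Rightarrow> real" where
  "osc t n \<omega> = Max ((\<lambda>p. \<bar>bpath t n (Suc (fst p)) \<omega> (snd p) - bpath t n (fst p) \<omega> (snd p)\<bar>) ` ({..<n} \<times> UNIV))"

lemma osc_measurable [measurable]: "0 \<le> t \<Longrightarrow> osc t n \<in> borel_measurable M"
  unfolding osc_def[abs_def] by (intro borel_measurable_Max) auto

lemma osc_ge: "k < n \<Longrightarrow> \<bar>bpath t n (Suc k) \<omega> i - bpath t n k \<omega> i\<bar> \<le> osc t n \<omega>"
  unfolding osc_def by (rule Max_ge) (auto intro!: image_eqI[where x = "(k, i)"])

lemma osc_nonneg: "0 < n \<Longrightarrow> 0 \<le> osc t n \<omega>"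
  using osc_ge[of 0 n t \<omega> undefined] by (simp add: order_trans[OF abs_ge_zero])

text \<open>Some coordinate passes from below \<open>r\<close> in absolute value to at least
  \<open>r\<close>, hence its absolute value is within 1 - r plus the oscillation of 1. The
  corresponding cosine vanishes at 1 and has Lipschitz constant at most \<open>C\<close>.\<close>

lemma cospr_exit_le:
  assumes \<kappa>: "\<And>i. 0 \<le> \<kappa> i" "\<And>i. cos (\<kappa> i) = 0" "\<And>i. \<kappa> i \<le> C" and r: "r \<le> 1" and k: "k < n"
    and g: "good r t n k \<omega> = 1" "inbox r (bpath t n (Suc k) \<omega>) = 0"
  shows "\<bar>cospr \<kappa> (bpath t n (Suc k) \<omega>)\<bar> \<le> C * ((1 - r) + osc t n \<omega>)"
proof -
  let ?x = "bpath t n (Suc k) \<omega>" and ?y = "bpath t n k \<omega>"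
  obtain i where i: "r \<le> \<bar>?x i\<bar>" using g(2) by (auto simp: inbox_eq not_less split: if_splits)
  have y: "\<bar>?y i\<bar> < r" using g(1) by (auto simp: good_eq split: if_splits)
  have C: "0 \<le> C" using \<kappa>(1,3)[of i] by linarith
  have "\<bar>cospr \<kappa> ?x\<bar> = \<bar>cos (\<kappa> i * ?x i)\<bar> * \<bar>\<Prod>j\<in>UNIV - {i}. cos (\<kappa> j * ?x j)\<bar>"
    unfolding cospr_def by (subst prod.remove[of _ i]) (auto simp: abs_mult)
  also have "\<dots> \<le> \<bar>cos (\<kappa> i * ?x i)\<bar> * 1" by (intro mult_left_mono abs_prod_cos_le) auto
  also have "cos (\<kappa> i * ?x i) = cos (\<kappa> i * \<bar>?x i\<bar>)"
    by (cases "0 \<le> ?x i") (auto simp: abs_if)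
  also have "\<bar>cos (\<kappa> i * \<bar>?x i\<bar>)\<bar> = \<bar>cos (\<kappa> i + \<kappa> i * (\<bar>?x i\<bar> - 1)) - cos (\<kappa> i)\<bar>"
    using \<kappa>(2)[of i] by (simp add: algebra_simps)
  also have "\<dots> \<le> \<bar>\<kappa> i * (\<bar>?x i\<bar> - 1)\<bar>" by (rule abs_cos_diff_le)
  also have "\<dots> = \<kappa> i * \<bar>\<bar>?x i\<bar> - 1\<bar>" using \<kappa>(1)[of i] by (simp add: abs_mult)
  also have "\<dots> \<le> C * ((1 - r) + osc t n \<omega>)"
  proof (rule mult_mono[OF \<kappa>(3) _ C])
    have "\<bar>?x i - ?y i\<bar> \<le> osc t n \<omega>" by (rule osc_ge[OF k])
    then show "\<bar>\<bar>?x i\<bar> - 1\<bar> \<le> (1 - r) + osc t n \<omega>" using i y r by linarith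
  qed simp
  finally show ?thesis by simp
qed

lemma integrable_bounded: 
  assumes "f \<in> borel_measurable M" "\<And>\<omega>. \<bar>f \<omega>\<bar> \<le> (C::real)"
  shows "integrable M f"
  by (rule integrable_const_bound[of _ C]) (use assms in auto)

lemma abs_mult_le_one: "\<bar>a\<bar> \<le> 1 \<Longrightarrow> \<bar>b\<bar> \<le> 1 \<Longrightarrow> \<bar>a * b :: real\<bar> \<le> 1"
  by (simp add: abs_mult mult_le_one)

text \<open>Relative to \<open>grid_step\<close>, an error arises only at the step that leaves the
  cube of radius \<open>r\<close>. Leaving at different steps are disjoint events, so that the
  errors add up to at most one exit error instead of \<open>n\<close> of them. The minimum with 1
  provides a bounded majorant for the passage to fine grids.\<close>

lemma grid_bound:
  assumes t: "0 < t" and n: "0 < n" and \<kappa>: "\<And>i. 0 \<le> \<kappa> i" "\<And>i. cos (\<kappa> i) = 0" "\<And>i. \<kappa> i \<le> C" and r: "0 < r" "r \<le> 1"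
  shows "\<bar>(\<integral>\<omega>. good r t n n \<omega> * cospr \<kappa> (bpath t n n \<omega>) \<partial>M) - exp (- (\<Sum>i\<in>UNIV. (\<kappa> i)\<^sup>2) / 2 * t)\<bar>
    \<le> (\<integral>\<omega>. min 1 (C * ((1 - r) + osc t n \<omega>)) \<partial>M)"
proof -
  define a where "a k = (\<integral>\<omega>. good r t n k \<omega> * cospr \<kappa> (bpath t n k \<omega>) \<partial>M)" for k
  define q where "q = exp (- (\<Sum>i\<in>UNIV. (\<kappa> i)\<^sup>2) / 2 * (t / real n))"
  define \<eta> where "\<eta> \<omega> = min 1 (C * ((1 - r) + osc t n \<omega>))" for \<omega>
  define d where "d k = (\<integral>\<omega>. (good r t n k \<omega> - good r t n (Suc k) \<omega>) * \<eta> \<omega> \<partial>M)" for k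
  have t0: "0 \<le> t" using t by simp
  have C: "0 \<le> C" using \<kappa>(1,3)[of undefined] by linarith
  note [measurable] = good_measurable[OF t0] cospr_measurable[OF t0] osc_measurable[OF t0]
  have \<eta>01: "0 \<le> \<eta> \<omega>" "\<eta> \<omega> \<le> 1" for \<omega> using C r osc_nonneg[OF n] by (auto simp: \<eta>_def)
  have \<eta>m [measurable]: "\<eta> \<in> borel_measurable M" unfolding \<eta>_def[abs_def] by measurable
  have q01: "0 \<le> q" "q \<le> 1" using t by (auto simp: q_def sum_nonneg intro!: divide_nonneg_nonneg mult_nonneg_nonneg)
  have gc: "\<bar>good r t n j \<omega> * cospr \<kappa> (bpath t n k \<omega>)\<bar> \<le> 1" for j k \<omega>
    using good_range[of r t n j \<omega>] cospr_abs_le[of \<kappa>] by (intro abs_mult_le_one) auto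
  have dI: "integrable M (\<lambda>\<omega>. (good r t n k \<omega> - good r t n j \<omega>) * \<eta> \<omega>)" for k j
  proof (rule integrable_bounded[of _ 1])
    fix \<omega>
    have "\<bar>good r t n k \<omega> - good r t n j \<omega>\<bar> \<le> 1" using good_range[of r t n k \<omega>] good_range[of r t n j \<omega>] by linarith
    then show "\<bar>(good r t n k \<omega> - good r t n j \<omega>) * \<eta> \<omega>\<bar> \<le> 1" using \<eta>01[of \<omega>] by (intro abs_mult_le_one) auto
  qed measurable
  have step: "\<bar>a (Suc k) - q * a k\<bar> \<le> d k" if k: "k < n" for k
  proof -
    have "q * a k = (\<integral>\<omega>. good r t n k \<omega> * cospr \<kappa> (bpath t n (Suc k) \<omega>) \<partial>M)"
      unfolding a_def q_def by (rule grid_step[OF t k, symmetric])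
    then have "a (Suc k) - q * a k =
        (\<integral>\<omega>. good r t n (Suc k) \<omega> * cospr \<kappa> (bpath t n (Suc k) \<omega>) - good r t n k \<omega> * cospr \<kappa> (bpath t n (Suc k) \<omega>) \<partial>M)"
      unfolding a_def by (simp only:) (rule Bochner_Integration.integral_diff[symmetric]; rule integrable_bounded[of _ 1, OF _ gc]; measurable)
    then have "\<bar>a (Suc k) - q * a k\<bar> \<le>
        (\<integral>\<omega>. \<bar>good r t n (Suc k) \<omega> * cospr \<kappa> (bpath t n (Suc k) \<omega>) - good r t n k \<omega> * cospr \<kappa> (bpath t n (Suc k) \<omega>)\<bar> \<partial>M)"
      by (simp only: integral_abs_bound)
    also have "\<dots> \<le> d k"
      unfolding d_def
    proof (rule integral_mono)
      show "integrable M (\<lambda>\<omega>. \<bar>good r t n (Suc k) \<omega> * cospr \<kappa> (bpath t n (Suc k) \<omega>) - good r t n k \<omega> * cospr \<kappa> (bpath t n (Suc k) \<omega>)\<bar>)"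
        by (intro integrable_abs Bochner_Integration.integrable_diff; rule integrable_bounded[of _ 1, OF _ gc]; measurable)
      show "integrable M (\<lambda>\<omega>. (good r t n k \<omega> - good r t n (Suc k) \<omega>) * \<eta> \<omega>)" by (rule dI)
      fix \<omega>
      show "\<bar>good r t n (Suc k) \<omega> * cospr \<kappa> (bpath t n (Suc k) \<omega>) - good r t n k \<omega> * cospr \<kappa> (bpath t n (Suc k) \<omega>)\<bar>
          \<le> (good r t n k \<omega> - good r t n (Suc k) \<omega>) * \<eta> \<omega>"
      proof (cases "good r t n k \<omega> = 1 \<and> inbox r (bpath t n (Suc k) \<omega>) = 0")
        case True
        then have "\<bar>cospr \<kappa> (bpath t n (Suc k) \<omega>)\<bar> \<le> \<eta> \<omega>"
          unfolding \<eta>_def using cospr_exit_le[OF \<kappa> r(2) k, of t \<omega>] cospr_abs_le[of \<kappa>] by simp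
        then show ?thesis using True by (simp add: good_Suc)
      next
        case False
        then have "good r t n k \<omega> = 0 \<or> inbox r (bpath t n (Suc k) \<omega>) = 1"
          by (auto simp: good_eq inbox_eq split: if_splits)
        then show ?thesis by (auto simp: good_Suc)
      qed
    qed
    finally show ?thesis .
  qed
  have acc: "\<bar>a k - q ^ k\<bar> \<le> (\<Sum>j<k. d j)" if "k \<le> n" for k
    using that
  proof (induction k)
    case 0
    have "(\<integral>\<omega>. good r t n 0 \<omega> * cospr \<kappa> (bpath t n 0 \<omega>) \<partial>M) = (\<integral>\<omega>. 1 \<partial>M)"
      by (rule Bochner_Integration.integral_cong[OF refl]) (use r in \<open>simp add: good_eq cospr_def bpath_def B_0\<close>)
    then show ?case by (simp add: a_def prob_space)
  next
    case (Suc k)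
    have "\<bar>q * (a k - q ^ k)\<bar> \<le> 1 * \<bar>a k - q ^ k\<bar>"
      using q01 unfolding abs_mult by (intro mult_right_mono) auto
    moreover have "a (Suc k) - q ^ Suc k = (a (Suc k) - q * a k) + q * (a k - q ^ k)" by (simp add: algebra_simps)
    ultimately have "\<bar>a (Suc k) - q ^ Suc k\<bar> \<le> \<bar>a (Suc k) - q * a k\<bar> + \<bar>a k - q ^ k\<bar>"
      using abs_triangle_ineq[of "a (Suc k) - q * a k" "q * (a k - q ^ k)"] by simp
    then show ?case using step[of k] Suc by simp
  qed
  have "(\<Sum>j<n. d j) = (\<integral>\<omega>. (\<Sum>j<n. (good r t n j \<omega> - good r t n (Suc j) \<omega>) * \<eta> \<omega>) \<partial>M)"
    unfolding d_def by (rule Bochner_Integration.integral_sum[symmetric]) (rule dI)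
  also have "\<dots> = (\<integral>\<omega>. (good r t n 0 \<omega> - good r t n n \<omega>) * \<eta> \<omega> \<partial>M)"
  proof -
    have "(\<Sum>j<n. good r t n j \<omega> - good r t n (Suc j) \<omega>) = good r t n 0 \<omega> - good r t n n \<omega>" for \<omega>
      by (rule sum_lessThan_telescope'[of "\<lambda>j. good r t n j \<omega>"])
    then show ?thesis by (simp only: sum_distrib_right[symmetric])
  qed
  also have "\<dots> \<le> (\<integral>\<omega>. \<eta> \<omega> \<partial>M)"
  proof (rule integral_mono[OF dI])
    show "integrable M \<eta>" by (rule integrable_bounded[of _ 1]) (use \<eta>01 in auto)
    fix \<omega>
    have "good r t n 0 \<omega> - good r t n n \<omega> \<le> 1" using good_range[of r t n 0 \<omega>] good_range[of r t n n \<omega>] by linarith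
    from mult_right_mono[OF this \<eta>01(1)[of \<omega>]] show "(good r t n 0 \<omega> - good r t n n \<omega>) * \<eta> \<omega> \<le> \<eta> \<omega>" by simp
  qed
  finally have "\<bar>a n - q ^ n\<bar> \<le> (\<integral>\<omega>. \<eta> \<omega> \<partial>M)" using acc[of n] by simp
  moreover have "q ^ n = exp (- (\<Sum>i\<in>UNIV. (\<kappa> i)\<^sup>2) / 2 * t)"
    using n unfolding q_def exp_of_nat_mult[symmetric] by simp
  ultimately show ?thesis unfolding a_def \<eta>_def by simp
qed

text \<open>The path is uniformly continuous on the compact interval [0, t].\<close>

lemma osc_tendsto:
  assumes t: "0 < t" and \<omega>: "\<omega> \<in> space M"
  shows "(\<lambda>m. osc t (2 ^ m) \<omega>) \<longlonglongrightarrow> 0"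
proof (rule LIMSEQ_I)
  fix e :: real assume e: "0 < e"
  have "uniformly_continuous_on {0..t} (\<lambda>s. B s \<omega>)"
    by (intro compact_uniformly_continuous continuous_on_subset[OF B_cont[OF \<omega>]]) auto
  then obtain dl where dl: "0 < dl" "\<And>s s'. s \<in> {0..t} \<Longrightarrow> s' \<in> {0..t} \<Longrightarrow> dist s' s < dl \<Longrightarrow> dist (B s' \<omega>) (B s \<omega>) < e"
    using e unfolding uniformly_continuous_on_def by meson
  have "(\<lambda>m. t * (1 / 2) ^ m) \<longlonglongrightarrow> t * 0" by (intro tendsto_intros LIMSEQ_power_zero) auto
  then obtain m0 where m0: "\<And>m. m \<ge> m0 \<Longrightarrow> t * (1 / 2) ^ m < dl"
    using dl(1) order_tendstoD(2)[of "\<lambda>m. t * (1 / 2) ^ m" 0 sequentially dl] unfolding eventually_sequentially by auto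
  show "\<exists>no. \<forall>m\<ge>no. norm (osc t (2 ^ m) \<omega> - 0) < e"
  proof (intro exI allI impI)
    fix m assume m: "m0 \<le> m"
    have "osc t (2 ^ m) \<omega> < e"
      unfolding osc_def
    proof (subst Max_less_iff; (intro ballI)?)
      fix z assume "z \<in> (\<lambda>p. \<bar>bpath t (2 ^ m) (Suc (fst p)) \<omega> (snd p) - bpath t (2 ^ m) (fst p) \<omega> (snd p)\<bar>) ` ({..<2 ^ m} \<times> UNIV)"
      then obtain k i where k: "k < 2 ^ m" and z: "z = \<bar>bpath t (2 ^ m) (Suc k) \<omega> i - bpath t (2 ^ m) k \<omega> i\<bar>" by auto
      let ?s = "real k * t / real (2 ^ m)" and ?s' = "real (Suc k) * t / real (2 ^ m)"
      have bound: "real j * t / real (2 ^ m) \<in> {0..t}" if "j \<le> 2 ^ m" for j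
      proof -
        have "real j \<le> real (2 ^ m)" using that by (simp only: of_nat_le_iff)
        then have "real j * t \<le> real (2 ^ m) * t" using t by (intro mult_right_mono) auto
        then show ?thesis using t by (simp add: field_simps)
      qed
      have "dist ?s' ?s = t * (1 / 2) ^ m"
        using t by (simp add: dist_real_def diff_divide_distrib[symmetric] algebra_simps power_one_over)
      then have "dist (B ?s' \<omega>) (B ?s \<omega>) < e" using m0[OF m] bound[of k] bound[of "Suc k"] k by (intro dl(2)) auto
      moreover have "\<bar>(B ?s' \<omega> - B ?s \<omega>) $ i\<bar> \<le> norm (B ?s' \<omega> - B ?s \<omega>)" by (rule component_le_norm_cart)
      ultimately show "z < e" unfolding z bpath_def by (simp add: dist_norm)
    qed (auto simp: lessThan_empty_iff)
    then show "norm (osc t (2 ^ m) \<omega> - 0) < e" using osc_nonneg[of "2 ^ m" t \<omega>] by simp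
  qed
qed

section \<open>Staying in the cube\<close>

definition stay :: "real \<Rightarrow> 'w \<Rightarrow> bool" where
  "stay t \<omega> \<longleftrightarrow> (\<forall>s\<in>{0..t}. \<forall>i. \<bar>B s \<omega> $ i\<bar> < 1)"

definition dyadic_good :: "real \<Rightarrow> real \<Rightarrow> 'w \<Rightarrow> bool" where
  "dyadic_good r t \<omega> \<longleftrightarrow> (\<forall>m. good r t (2 ^ m) (2 ^ m) \<omega> = 1)"

text \<open>The points of the coarse grid belong to the fine one, so along dyadic grids
  \<open>good\<close> decreases and has a limit.\<close>

lemma good_refine: "good r t (2 ^ Suc m) (2 ^ Suc m) \<omega> = 1 \<Longrightarrow> good r t (2 ^ m) (2 ^ m) \<omega> = 1"
proof -
  assume "good r t (2 ^ Suc m) (2 ^ Suc m) \<omega> = 1"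
  then have *: "\<bar>bpath t (2 ^ Suc m) j \<omega> i\<bar> < r" if "j \<le> 2 ^ Suc m" for j i
    using that by (auto simp: good_eq split: if_splits)
  have "\<bar>bpath t (2 ^ m) j \<omega> i\<bar> < r" if "j \<le> 2 ^ m" for j i
  proof -
    have "bpath t (2 ^ m) j \<omega> i = bpath t (2 ^ Suc m) (2 * j) \<omega> i" by (simp add: bpath_def)
    then show ?thesis using *[of "2 * j" i] that by simp
  qed
  then show ?thesis by (simp add: good_eq)
qed

lemma good_tendsto: "(\<lambda>m. good r t (2 ^ m) (2 ^ m) \<omega>) \<longlonglongrightarrow> (if dyadic_good r t \<omega> then 1 else 0)"
proof (cases "dyadic_good r t \<omega>")
  case True
  then show ?thesis by (simp add: dyadic_good_def)
next
  case False
  then obtain m0 where m0: "good r t (2 ^ m0) (2 ^ m0) \<omega> \<noteq> 1" by (auto simp: dyadic_good_def)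
  have "good r t (2 ^ m) (2 ^ m) \<omega> \<noteq> 1" if "m0 \<le> m" for m
    using that by (induction m rule: dec_induct) (use m0 good_refine in blast)+
  then have "good r t (2 ^ m) (2 ^ m) \<omega> = 0" if "m0 \<le> m" for m
    using that by (metis good_eq)
  then show ?thesis using False by (intro tendsto_eventually) (auto simp: eventually_sequentially)
qed

text \<open>A continuous path attains its maximum over [0, t], so staying in the open cube means
  staying in some smaller cube, which dyadic times can test. A strict bound by 1 at the dyadic times
  alone would allow the path to touch a face in between.\<close>

lemma stay_iff:
  assumes t: "0 < t" and \<omega>: "\<omega> \<in> space M"
  shows "stay t \<omega> \<longleftrightarrow> (\<exists>j::nat. dyadic_good (1 - 1 / real (j + 2)) t \<omega>)"
proof
  assume st: "stay t \<omega>"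
  have cont: "continuous_on {0..t} (\<lambda>s. \<bar>B s \<omega> $ i\<bar>)" for i
    by (intro continuous_intros continuous_on_subset[OF B_cont[OF \<omega>]]) auto
  have "\<exists>c<1. \<forall>s\<in>{0..t}. \<bar>B s \<omega> $ i\<bar> \<le> c" for i
  proof -
    obtain s where "s \<in> {0..t}" "\<forall>s'\<in>{0..t}. \<bar>B s' \<omega> $ i\<bar> \<le> \<bar>B s \<omega> $ i\<bar>"
      using continuous_attains_sup[OF _ _ cont[of i]] t by auto
    then show ?thesis using st unfolding stay_def by (intro exI[of _ "\<bar>B s \<omega> $ i\<bar>"]) auto
  qed
  then obtain c where c: "\<And>i. c i < 1" "\<And>i s. s \<in> {0..t} \<Longrightarrow> \<bar>B s \<omega> $ i\<bar> \<le> c i" by metis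
  define c0 where "c0 = Max (range c)"
  have c0: "c0 < 1" "\<And>i. c i \<le> c0" unfolding c0_def using c(1) by (auto intro: Max_ge)
  obtain j :: nat where j: "1 / (1 - c0) < real j" using reals_Archimedean2 by blast
  have "1 / real (j + 2) < 1 - c0"
  proof -
    have "1 < real j * (1 - c0)" using j c0(1) by (simp add: field_simps)
    also have "\<dots> \<le> real (j + 2) * (1 - c0)" using c0(1) by (intro mult_right_mono) auto
    finally show ?thesis by (simp add: field_simps)
  qed
  then have lt: "c0 < 1 - 1 / real (j + 2)" by linarith
  have "\<bar>bpath t (2 ^ m) k \<omega> i\<bar> < 1 - 1 / real (j + 2)" if "k \<le> 2 ^ m" for m k i
  proof -
    have "real k \<le> real (2 ^ m)" using that by (simp only: of_nat_le_iff)
    then have "real k * t \<le> real (2 ^ m) * t" using t by (intro mult_right_mono) auto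
    then have "real k * t / real (2 ^ m) \<in> {0..t}" using t by (simp add: field_simps)
    from c(2)[OF this, of i] c0(2)[of i] lt show ?thesis unfolding bpath_def by linarith
  qed
  then have "dyadic_good (1 - 1 / real (j + 2)) t \<omega>" by (simp add: dyadic_good_def good_eq)
  then show "\<exists>j::nat. dyadic_good (1 - 1 / real (j + 2)) t \<omega>" by blast
next
  assume "\<exists>j::nat. dyadic_good (1 - 1 / real (j + 2)) t \<omega>"
  then obtain j :: nat where "dyadic_good (1 - 1 / real (j + 2)) t \<omega>" by blast
  then have g: "\<bar>bpath t (2 ^ m) k \<omega> i\<bar> < 1 - 1 / real (j + 2)" if "k \<le> 2 ^ m" for m k i
    using that by (auto simp: dyadic_good_def good_eq split: if_splits)
  show "stay t \<omega>"
    unfolding stay_def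
  proof (intro ballI allI)
    fix s i assume s: "s \<in> {0..t}"
    \<comment> \<open>The dyadic grid point at or just below \<open>s\<close>; these points converge
      to \<open>s\<close> and stay in [0, t].\<close>
    define k where "k m = nat \<lfloor>s / t * 2 ^ m\<rfloor>" for m
    define u where "u m = real (k m) * t / real (2 ^ m)" for m :: nat
    have k_le: "real (k m) \<le> s / t * 2 ^ m" "s / t * 2 ^ m < real (k m) + 1" for m
      using s t by (auto simp: k_def of_nat_nat)
    have u_le: "u m \<le> s" "s - t * (1 / 2) ^ m \<le> u m" for m
    proof -
      show "u m \<le> s" using k_le(1)[of m] t by (simp add: u_def field_simps)
      have "s / t * 2 ^ m * (t / 2 ^ m) \<le> (real (k m) + 1) * (t / 2 ^ m)"
        using k_le(2)[of m] t by (intro mult_right_mono) auto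
      moreover have "s / t * 2 ^ m * (t / 2 ^ m) = s" using t by simp
      moreover have "(real (k m) + 1) * (t / 2 ^ m) = u m + t * (1 / 2) ^ m"
        by (simp add: u_def distrib_right power_one_over add_divide_distrib)
      ultimately show "s - t * (1 / 2) ^ m \<le> u m" by linarith
    qed
    have k2: "k m \<le> 2 ^ m" for m
    proof -
      have "real (k m) \<le> 1 * 2 ^ m" using k_le(1)[of m] s t
        by (intro order_trans[OF k_le(1)] mult_right_mono) auto
      then show ?thesis by (metis mult_1 of_nat_le_iff of_nat_numeral of_nat_power)
    qed
    have lim: "u \<longlonglongrightarrow> s"
    proof (rule tendsto_sandwich)
      show "(\<lambda>m. s - t * (1 / 2) ^ m) \<longlonglongrightarrow> s"
        by (rule tendsto_eq_intros LIMSEQ_power_zero refl)+ auto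
      show "(\<lambda>_. s) \<longlonglongrightarrow> s" by simp
    qed (use u_le in auto)
    have "(\<lambda>m. \<bar>B (u m) \<omega> $ i\<bar>) \<longlonglongrightarrow> \<bar>B s \<omega> $ i\<bar>"
    proof (intro tendsto_intros)
      have u0: "u m \<in> {0..}" for m using t by (simp add: u_def)
      have "((\<lambda>s. B s \<omega>) \<longlongrightarrow> B s \<omega>) (at s within {0..})"
        using B_cont[OF \<omega>] s unfolding continuous_on_def by auto
      then show "(\<lambda>m. B (u m) \<omega>) \<longlonglongrightarrow> B s \<omega>"
        using B_cont[OF \<omega>] lim u0 s unfolding continuous_on_sequentially o_def by auto
    qed
    moreover have "\<bar>B (u m) \<omega> $ i\<bar> \<le> 1 - 1 / real (j + 2)" for m
      using g[OF k2[of m], of i] by (simp add: bpath_def u_def)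
    ultimately have "\<bar>B s \<omega> $ i\<bar> \<le> 1 - 1 / real (j + 2)" by (intro LIMSEQ_le_const2) auto
    also have "\<dots> < 1" by simp
    finally show "\<bar>B s \<omega> $ i\<bar> < 1" .
  qed
qed

lemma dyadic_good_mono: "r \<le> r' \<Longrightarrow> dyadic_good r t \<omega> \<Longrightarrow> dyadic_good r' t \<omega>"
  by (auto simp: dyadic_good_def good_eq split: if_splits) (meson less_le_trans)+

lemma dyadic_good_tendsto:
  assumes t: "0 < t" and \<omega>: "\<omega> \<in> space M"
  shows "(\<lambda>j. if dyadic_good (1 - 1 / real (j + 2)) t \<omega> then 1 else 0 :: real) \<longlonglongrightarrow> (if stay t \<omega> then 1 else 0)"
proof (cases "stay t \<omega>")
  case True
  then obtain j0 :: nat where j0: "dyadic_good (1 - 1 / real (j0 + 2)) t \<omega>" using stay_iff[OF assms] by blast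
  have "dyadic_good (1 - 1 / real (j + 2)) t \<omega>" if "j0 \<le> j" for j
    using that by (intro dyadic_good_mono[OF _ j0]) (simp add: frac_le)
  then show ?thesis using True by (intro tendsto_eventually) (auto simp: eventually_sequentially)
next
  case False
  then show ?thesis using stay_iff[OF assms] by simp
qed

lemma dyadic_good_measurable: "0 < t \<Longrightarrow> (\<lambda>\<omega>. if dyadic_good r t \<omega> then 1 else 0 :: real) \<in> borel_measurable M"
  by (rule borel_measurable_LIMSEQ_real[OF good_tendsto[of r t]]) auto

text \<open>The event involves uncountably many times. It becomes measurable as a limit of dyadic
  events, first along the grids and then along the radii.\<close>

lemma stay_measurable: "0 < t \<Longrightarrow> (\<lambda>\<omega>. if stay t \<omega> then 1 else 0 :: real) \<in> borel_measurable M"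
  by (rule borel_measurable_LIMSEQ_real[OF dyadic_good_tendsto dyadic_good_measurable])

lemma cospr_B_measurable: "0 \<le> t \<Longrightarrow> (\<lambda>\<omega>. cospr \<kappa> (\<lambda>i. B t \<omega> $ i)) \<in> borel_measurable M"
  unfolding cospr_def by (intro borel_measurable_prod) auto

text \<open>On a grid the path may touch the boundary unseen, so the martingale is stopped at the exit
  from the slightly smaller cube of radius r; there the product of cosines is of order 1 - r plus the
  oscillation over one grid step.\<close>

theorem stay_cospr:
  assumes t: "0 < t" and \<kappa>: "\<And>i. 0 \<le> \<kappa> i" "\<And>i. cos (\<kappa> i) = 0"
  shows "(\<integral>\<omega>. (if stay t \<omega> then 1 else 0) * cospr \<kappa> (\<lambda>i. B t \<omega> $ i) \<partial>M) = exp (- (\<Sum>i\<in>UNIV. (\<kappa> i)\<^sup>2) / 2 * t)"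
proof -
  define C where "C = Max (range \<kappa>)"
  have \<kappa>C: "\<kappa> i \<le> C" for i unfolding C_def by (rule Max_ge) auto
  have C: "0 \<le> C" using \<kappa>(1)[of undefined] \<kappa>C[of undefined] by linarith
  let ?e = "\<lambda>\<omega>. cospr \<kappa> (\<lambda>i. B t \<omega> $ i)" and ?E = "exp (- (\<Sum>i\<in>UNIV. (\<kappa> i)\<^sup>2) / 2 * t)"
  have t0: "0 \<le> t" using t by simp
  note [measurable] = good_measurable[OF t0] cospr_B_measurable[OF t0] osc_measurable[OF t0]
    dyadic_good_measurable[OF t] stay_measurable[OF t]
  have e1: "\<bar>?e \<omega>\<bar> \<le> 1" for \<omega> by (rule cospr_abs_le)
  have one: "\<bar>\<integral>\<omega>. (if dyadic_good r t \<omega> then 1 else 0) * ?e \<omega> \<partial>M - ?E\<bar> \<le> C * (1 - r)" if r: "0 < r" "r \<le> 1" for r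
  proof (rule LIMSEQ_le)
    have "(\<lambda>m. \<integral>\<omega>. good r t (2 ^ m) (2 ^ m) \<omega> * ?e \<omega> \<partial>M) \<longlonglongrightarrow> (\<integral>\<omega>. (if dyadic_good r t \<omega> then 1 else 0) * ?e \<omega> \<partial>M)"
    proof (rule integral_dominated_convergence[where w = "\<lambda>_. 1"])
      show "AE \<omega> in M. (\<lambda>m. good r t (2 ^ m) (2 ^ m) \<omega> * ?e \<omega>) \<longlonglongrightarrow> (if dyadic_good r t \<omega> then 1 else 0) * ?e \<omega>"
        by (intro AE_I2 tendsto_intros good_tendsto)
      show "AE \<omega> in M. norm (good r t (2 ^ m) (2 ^ m) \<omega> * ?e \<omega>) \<le> 1" for m
        using good_range[of r t "2 ^ m" "2 ^ m"] e1 by (intro AE_I2) (auto intro!: abs_mult_le_one)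
    qed auto
    then show "(\<lambda>m. \<bar>(\<integral>\<omega>. good r t (2 ^ m) (2 ^ m) \<omega> * ?e \<omega> \<partial>M) - ?E\<bar>) \<longlonglongrightarrow> \<bar>\<integral>\<omega>. (if dyadic_good r t \<omega> then 1 else 0) * ?e \<omega> \<partial>M - ?E\<bar>"
      by (intro tendsto_intros)
    have "(\<lambda>m. \<integral>\<omega>. min 1 (C * ((1 - r) + osc t (2 ^ m) \<omega>)) \<partial>M) \<longlonglongrightarrow> (\<integral>\<omega>. min 1 (C * ((1 - r) + 0)) \<partial>M)"
    proof (rule integral_dominated_convergence[where w = "\<lambda>_. 1"])
      show "AE \<omega> in M. (\<lambda>m. min 1 (C * ((1 - r) + osc t (2 ^ m) \<omega>))) \<longlonglongrightarrow> min 1 (C * ((1 - r) + 0))"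
        by (intro AE_I2 tendsto_intros osc_tendsto[OF t])
      show "AE \<omega> in M. norm (min 1 (C * ((1 - r) + osc t (2 ^ m) \<omega>))) \<le> 1" for m
        using C r osc_nonneg[of "2 ^ m" t] by (intro AE_I2) auto
    qed auto
    also have "(\<integral>\<omega>. min 1 (C * ((1 - r) + 0)) \<partial>M) = min 1 (C * (1 - r))" by (simp add: prob_space)
    finally show "(\<lambda>m. C * (1 - r) + ((\<integral>\<omega>. min 1 (C * ((1 - r) + osc t (2 ^ m) \<omega>)) \<partial>M) - min 1 (C * (1 - r)))) \<longlonglongrightarrow> C * (1 - r)"
      by (intro tendsto_eq_intros) (auto intro: refl)
    show "\<exists>N. \<forall>m\<ge>N. \<bar>(\<integral>\<omega>. good r t (2 ^ m) (2 ^ m) \<omega> * ?e \<omega> \<partial>M) - ?E\<bar> \<le>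
        C * (1 - r) + ((\<integral>\<omega>. min 1 (C * ((1 - r) + osc t (2 ^ m) \<omega>)) \<partial>M) - min 1 (C * (1 - r)))"
    proof (intro exI allI impI)
      fix m
      have "bpath t (2 ^ m) (2 ^ m) \<omega> = (\<lambda>i. B t \<omega> $ i)" for \<omega> by (rule ext) (simp add: bpath_def)
      then show "\<bar>(\<integral>\<omega>. good r t (2 ^ m) (2 ^ m) \<omega> * ?e \<omega> \<partial>M) - ?E\<bar> \<le>
        C * (1 - r) + ((\<integral>\<omega>. min 1 (C * ((1 - r) + osc t (2 ^ m) \<omega>)) \<partial>M) - min 1 (C * (1 - r)))"
        using grid_bound[of t "2 ^ m" \<kappa> C r] t \<kappa> \<kappa>C r min.cobounded2[of 1 "C * (1 - r)"] by simp
    qed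
  qed
  have "(\<lambda>j. \<integral>\<omega>. (if dyadic_good (1 - 1 / real (j + 2)) t \<omega> then 1 else 0) * ?e \<omega> \<partial>M) \<longlonglongrightarrow> (\<integral>\<omega>. (if stay t \<omega> then 1 else 0) * ?e \<omega> \<partial>M)"
  proof (rule integral_dominated_convergence[where w = "\<lambda>_. 1"])
    show "AE \<omega> in M. (\<lambda>j. (if dyadic_good (1 - 1 / real (j + 2)) t \<omega> then 1 else 0) * ?e \<omega>) \<longlonglongrightarrow> (if stay t \<omega> then 1 else 0) * ?e \<omega>"
      by (intro AE_I2 tendsto_mult tendsto_const dyadic_good_tendsto[OF t])
  qed (use e1 in auto)
  moreover have "(\<lambda>j. \<integral>\<omega>. (if dyadic_good (1 - 1 / real (j + 2)) t \<omega> then 1 else 0) * ?e \<omega> \<partial>M) \<longlonglongrightarrow> ?E"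
  proof (rule LIM_zero_cancel, rule Lim_null_comparison)
    show "\<forall>\<^sub>F j in sequentially. norm ((\<integral>\<omega>. (if dyadic_good (1 - 1 / real (j + 2)) t \<omega> then 1 else 0) * ?e \<omega> \<partial>M) - ?E) \<le> C * (1 / real (j + 2))"
    proof (intro always_eventually allI)
      fix j :: nat
      show "norm ((\<integral>\<omega>. (if dyadic_good (1 - 1 / real (j + 2)) t \<omega> then 1 else 0) * ?e \<omega> \<partial>M) - ?E) \<le> C * (1 / real (j + 2))"
        using one[of "1 - 1 / real (j + 2)"] by simp
    qed
    have "(\<lambda>j. 1 / real (j + 2)) \<longlonglongrightarrow> 0" by (rule LIMSEQ_ignore_initial_segment[OF lim_1_over_n])
    from tendsto_mult_right_zero[OF this] show "(\<lambda>j. C * (1 / real (j + 2))) \<longlonglongrightarrow> 0" .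
  qed
  ultimately show ?thesis by (rule LIMSEQ_unique)
qed


section \<open>The exit time and its Laplace transform\<close>

definition exit_set :: "'w \<Rightarrow> real set" where
  "exit_set \<omega> = {t. 0 \<le> t \<and> \<not> (\<forall>i. -1 < B t \<omega> $ i \<and> B t \<omega> $ i < 1)}"

lemma bm_exit_eq: "bm_exit B \<omega> = Inf (exit_set \<omega>)"
  by (simp add: bm_exit_def exit_set_def)

lemma stay_iff_exit_set: "stay t \<omega> \<longleftrightarrow> (\<forall>s\<in>exit_set \<omega>. t < s)"
proof
  assume st: "stay t \<omega>"
  show "\<forall>s\<in>exit_set \<omega>. t < s"
  proof (intro ballI, rule ccontr)
    fix s assume s: "s \<in> exit_set \<omega>" "\<not> t < s"
    then have "s \<in> {0..t}" by (simp add: exit_set_def)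
    then have "\<bar>B s \<omega> $ i\<bar> < 1" for i using st by (simp add: stay_def)
    then have "- 1 < B s \<omega> $ i \<and> B s \<omega> $ i < 1" for i by (auto simp: abs_less_iff minus_less_iff)
    then show False using s by (simp add: exit_set_def)
  qed
next
  assume ex: "\<forall>s\<in>exit_set \<omega>. t < s"
  show "stay t \<omega>"
    unfolding stay_def
  proof (intro ballI allI, rule ccontr)
    fix s i assume s: "s \<in> {0..t}" "\<not> \<bar>B s \<omega> $ i\<bar> < 1"
    then have "\<not> (- 1 < B s \<omega> $ i \<and> B s \<omega> $ i < 1)" by linarith
    then have "s \<in> exit_set \<omega>" using s by (auto simp: exit_set_def)
    then show False using ex s by force
  qed
qed

lemma closed_exit_set:
  assumes "\<omega> \<in> space M"
  shows "closed (exit_set \<omega>)"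
proof -
  have "closed {y :: real ^ 'd. y $ i \<le> -1 \<or> 1 \<le> y $ i}" for i
    by (intro closed_Collect_disj closed_Collect_le continuous_intros)
  then have "closed (\<Union>i. {y :: real ^ 'd. y $ i \<le> -1 \<or> 1 \<le> y $ i})" by (intro closed_UN) auto
  then have "closed ({0..} \<inter> (\<lambda>t. B t \<omega>) -` (\<Union>i. {y. y $ i \<le> -1 \<or> 1 \<le> y $ i}))"
    by (intro continuous_closed_preimage B_cont assms) auto
  also have "{0..} \<inter> (\<lambda>t. B t \<omega>) -` (\<Union>i. {y. y $ i \<le> -1 \<or> 1 \<le> y $ i}) = exit_set \<omega>"
    by (auto simp: exit_set_def not_less)
  finally show ?thesis .
qed

text \<open>The exit set is closed by continuity of the path, so its infimum is attained. Paths that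
  never exit are excluded, as \<open>Inf {}\<close> is an unspecified real.\<close>

lemma stay_iff_less_exit:
  assumes \<omega>: "\<omega> \<in> space M" and ne: "exit_set \<omega> \<noteq> {}"
  shows "stay t \<omega> \<longleftrightarrow> t < bm_exit B \<omega>"
proof -
  have bdd: "bdd_below (exit_set \<omega>)" by (rule bdd_belowI[of _ 0]) (auto simp: exit_set_def)
  have "Inf (exit_set \<omega>) \<in> exit_set \<omega>" by (rule closed_contains_Inf[OF ne bdd closed_exit_set[OF \<omega>]])
  then show ?thesis
    unfolding stay_iff_exit_set bm_exit_eq using cInf_lower[OF _ bdd] by force
qed

lemma exit_nonneg: "exit_set \<omega> \<noteq> {} \<Longrightarrow> 0 \<le> bm_exit B \<omega>"
  unfolding bm_exit_eq by (rule cInf_greatest) (auto simp: exit_set_def)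

lemma exit_set_empty_iff: "exit_set \<omega> = {} \<longleftrightarrow> (\<forall>n. stay (real (Suc n)) \<omega>)"
proof
  assume r: "\<forall>n. stay (real (Suc n)) \<omega>"
  show "exit_set \<omega> = {}"
  proof (rule ccontr)
    assume "exit_set \<omega> \<noteq> {}"
    then obtain s where s: "s \<in> exit_set \<omega>" by blast
    obtain n where "s < real n" using reals_Archimedean2 by blast
    moreover have "real (Suc n) < s" using r s unfolding stay_iff_exit_set by blast
    ultimately show False by simp
  qed
qed (simp add: stay_iff_exit_set)

lemma stay_pred [measurable]: "0 < t \<Longrightarrow> Measurable.pred M (stay t)"
proof -
  assume t: "0 < t"
  have "{\<omega> \<in> space M. stay t \<omega>} = (\<lambda>\<omega>. if stay t \<omega> then 1 else 0 :: real) -` {1} \<inter> space M"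
    by (auto split: if_splits)
  also have "\<dots> \<in> sets M" by (rule measurable_sets[OF stay_measurable[OF t]]) simp
  finally show ?thesis by (simp add: pred_def)
qed

text \<open>The density of a coordinate at time \<open>t\<close> is at most 1 / sqrt (2 pi t), and
  the coordinate has to lie in an interval of length 2. Letting \<open>t\<close> grow shows that
  almost every path exits.\<close>

lemma prob_stay_le:
  assumes t: "0 < t"
  shows "prob {\<omega> \<in> space M. stay t \<omega>} \<le> 2 / sqrt (2 * pi * t)"
proof -
  fix i :: 'd
  let ?c = "1 / sqrt (2 * pi * t)"
  have c0: "0 \<le> ?c" using t by simp
  have Bm: "(\<lambda>\<omega>. B t \<omega> $ i) \<in> borel_measurable M" using t by simp
  have "prob {\<omega> \<in> space M. stay t \<omega>} \<le> prob ((\<lambda>\<omega>. B t \<omega> $ i) -` {-1..1} \<inter> space M)"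
  proof (rule finite_measure_mono)
    have "-1 \<le> x \<and> x \<le> 1" if "\<bar>x\<bar> < 1" for x :: real using that by linarith
    moreover have "t \<in> {0..t}" using t by simp
    ultimately show "{\<omega> \<in> space M. stay t \<omega>} \<subseteq> (\<lambda>\<omega>. B t \<omega> $ i) -` {-1..1} \<inter> space M"
      unfolding stay_def by fastforce
    show "(\<lambda>\<omega>. B t \<omega> $ i) -` {-1..1} \<inter> space M \<in> events" by (rule measurable_sets[OF Bm]) simp
  qed
  moreover have "emeasure M ((\<lambda>\<omega>. B t \<omega> $ i) -` {-1..1} \<inter> space M) \<le> ennreal (2 * ?c)"
  proof -
    have "emeasure M ((\<lambda>\<omega>. B t \<omega> $ i) -` {-1..1} \<inter> space M) =
        (\<integral>\<^sup>+x. ennreal (normal_density 0 (sqrt t) x) * indicator {-1..1} x \<partial>lborel)"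
      by (rule distributed_emeasure[OF B_distributed[OF t]]) simp
    also have "\<dots> \<le> (\<integral>\<^sup>+x. ennreal ?c * indicator {-1..1::real} x \<partial>lborel)"
    proof (rule nn_integral_mono)
      fix x :: real
      have "normal_density 0 (sqrt t) x = ?c * exp (- (x\<^sup>2) / (2 * t))"
        using t by (simp add: normal_density_def)
      also have "\<dots> \<le> ?c * 1" using t c0 by (intro mult_left_mono) auto
      finally have "normal_density 0 (sqrt t) x \<le> ?c" by simp
      then show "ennreal (normal_density 0 (sqrt t) x) * indicator {-1..1} x \<le> ennreal ?c * indicator {-1..1} x"
        by (auto simp: indicator_def intro!: ennreal_leI)
    qed
    also have "\<dots> = ennreal ?c * ennreal 2"
      by (subst nn_integral_cmult_indicator) auto
    also have "\<dots> = ennreal (?c * 2)" by (rule ennreal_mult[OF c0, symmetric]) simp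
    also have "?c * 2 = 2 * ?c" by simp
    finally show ?thesis .
  qed
  then have "prob ((\<lambda>\<omega>. B t \<omega> $ i) -` {-1..1} \<inter> space M) \<le> 2 * ?c"
    unfolding emeasure_eq_measure using c0 by (subst (asm) ennreal_le_iff) auto
  ultimately show ?thesis by simp
qed

lemma AE_exits: "AE \<omega> in M. exit_set \<omega> \<noteq> {}"
proof -
  let ?N = "{\<omega> \<in> space M. \<forall>n. stay (real (Suc n)) \<omega>}"
  have Nm: "?N \<in> sets M" by measurable
  have "prob ?N \<le> 2 / sqrt (2 * pi * real (Suc n))" for n
    by (rule order_trans[OF finite_measure_mono prob_stay_le]) auto
  moreover have "(\<lambda>n. 2 / sqrt (2 * pi * real (Suc n))) \<longlonglongrightarrow> 0" by real_asymp
  ultimately have "prob ?N \<le> 0" by (intro LIMSEQ_le_const) auto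
  then have "prob ?N = 0" by (simp add: measure_le_0_iff)
  then have "?N \<in> null_sets M" using Nm by (auto simp: null_sets_def emeasure_eq_measure)
  then show ?thesis by (rule AE_I') (auto simp: exit_set_empty_iff)
qed

lemma bm_exit_measurable [measurable]: "bm_exit B \<in> borel_measurable M"
  unfolding borel_measurable_iff_greater
proof
  fix a :: real
  \<comment> \<open>On paths that never exit, the exit time has the constant value
    \<open>Inf {}\<close>. They form a null set but must be treated, since \<open>M\<close> need not
    be complete.\<close>
  let ?never = "\<lambda>\<omega>. \<forall>n. stay (real (Suc n)) \<omega>"
  have nm [measurable]: "Measurable.pred M ?never" by measurable
  have "{\<omega> \<in> space M. a < bm_exit B \<omega>} = {\<omega> \<in> space M. if ?never \<omega> then a < Inf {} else (a \<le> 0 \<and> (a = 0 \<longrightarrow> stay 0 \<omega>)) \<or> (0 < a \<and> stay a \<omega>)}"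
  proof (intro Collect_cong conj_cong refl)
    fix \<omega> assume \<omega>: "\<omega> \<in> space M"
    show "a < bm_exit B \<omega> \<longleftrightarrow> (if ?never \<omega> then a < Inf {} else (a \<le> 0 \<and> (a = 0 \<longrightarrow> stay 0 \<omega>)) \<or> (0 < a \<and> stay a \<omega>))"
    proof (cases "?never \<omega>")
      case True
      then have "exit_set \<omega> = {}" using exit_set_empty_iff by blast
      then show ?thesis using True by (simp add: bm_exit_eq)
    next
      case False
      then have ne: "exit_set \<omega> \<noteq> {}" using exit_set_empty_iff by blast
      have "a < bm_exit B \<omega> \<longleftrightarrow> (a \<le> 0 \<and> (a = 0 \<longrightarrow> stay 0 \<omega>)) \<or> (0 < a \<and> stay a \<omega>)"
        using stay_iff_less_exit[OF \<omega> ne, of a] exit_nonneg[OF ne] by (cases "a < 0") auto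
      then show ?thesis unfolding if_not_P[OF False] .
    qed
  qed
  also have "\<dots> = {\<omega> \<in> space M. if ?never \<omega> then a < Inf {} else a \<le> 0 \<or> (0 < a \<and> stay a \<omega>)}"
    by (intro Collect_cong conj_cong refl) (auto simp: stay_def B_0)
  also have "\<dots> \<in> sets M"
  proof (cases "0 < a")
    case True
    have [measurable]: "Measurable.pred M (stay a)" by (rule stay_pred[OF True])
    show ?thesis by measurable
  next
    case False
    then have "{\<omega> \<in> space M. if ?never \<omega> then a < Inf {} else a \<le> 0 \<or> (0 < a \<and> stay a \<omega>)} =
        {\<omega> \<in> space M. if ?never \<omega> then a < Inf {} else True}" by auto
    also have "\<dots> \<in> sets M" by measurable
    finally show ?thesis .
  qed
  finally show "{\<omega> \<in> space M. a < bm_exit B \<omega>} \<in> sets M" .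
qed

text \<open>For an exponential time T of rate \<open>c\<close> independent of the path, the right
  side is the probability that T precedes the exit, that is, the integral of the probability of
  \<open>stay t\<close> against the law of T. Inserting at time t the cosine approximation of 1,
  \<open>stay_cospr\<close> turns each term into exp (- rate t), whose integral is c / (c +
  rate).\<close>

theorem laplace_exit:
  fixes \<Lambda> :: "nat \<Rightarrow> ('d \<Rightarrow> nat) set" and b :: "nat \<Rightarrow> ('d \<Rightarrow> nat) \<Rightarrow> real"
  assumes c: "0 < c" and fin: "\<And>j. finite (\<Lambda> j)"
    and expn: "\<And>j u. (\<Prod>i\<in>UNIV. qpoly j (pi / 2 * u i)) = (\<Sum>k\<in>\<Lambda> j. b j k * (\<Prod>i\<in>UNIV. cos ((2 * real (k i) + 1) * pi / 2 * u i)))"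
  shows "(\<lambda>j. \<Sum>k\<in>\<Lambda> j. b j k * (c / (c + (\<Sum>i\<in>UNIV. ((2 * real (k i) + 1) * pi / 2)\<^sup>2) / 2)))
    \<longlonglongrightarrow> 1 - (\<integral>\<omega>. exp (- (c * bm_exit B \<omega>)) \<partial>M)"
proof -
  define \<nu> where "\<nu> = density lborel (exponential_density c)"
  interpret E: prob_space \<nu> unfolding \<nu>_def by (rule prob_space_exponential_density[OF c])
  interpret PM: pair_prob_space M \<nu> ..
  have sets_\<nu> [measurable_cong]: "sets \<nu> = sets borel" by (simp add: \<nu>_def)
  define rate where "rate k = (\<Sum>i\<in>UNIV. ((2 * real (k i) + 1) * pi / 2)\<^sup>2) / 2" for k :: "'d \<Rightarrow> nat"
  have rate0: "0 \<le> rate k" for k unfolding rate_def by (intro divide_nonneg_nonneg sum_nonneg) auto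
  define ind where "ind \<omega> t = (if t < bm_exit B \<omega> then 1 else 0 :: real)" for \<omega> t
  have ind_m [measurable]: "case_prod ind \<in> borel_measurable (M \<Otimes>\<^sub>M \<nu>)"
    unfolding ind_def by measurable
  have \<nu>_pos: "AE t in \<nu>. 0 < t"
  proof -
    have "AE t in lborel. t \<noteq> (0::real)" by (rule AE_lborel_singleton)
    then show ?thesis unfolding \<nu>_def by (subst AE_density) (auto simp: exponential_density_def elim!: eventually_mono)
  qed
  have cdf: "(\<integral>t. (if t < a then 1 else 0) \<partial>\<nu>) = 1 - exp (- (c * a))" if "0 \<le> a" for a
  proof -
    have em: "emeasure \<nu> {..a} = ennreal (erlang_CDF 0 c a)"
      unfolding \<nu>_def by (rule emeasure_erlang_density[OF c])
    have "0 \<le> erlang_CDF 0 c a" using that c by (simp add: erlang_CDF_def)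
    then have me: "measure \<nu> {..a} = erlang_CDF 0 c a" using em by (simp add: measure_def)
    have "(\<integral>t. (if t < a then 1 else 0) \<partial>\<nu>) = (\<integral>t. indicat_real {..a} t \<partial>\<nu>)"
    proof (rule integral_cong_AE)
      have "AE t in lborel. t \<noteq> a" by (rule AE_lborel_singleton)
      then have "AE t in \<nu>. t \<noteq> a" unfolding \<nu>_def by (subst AE_density) auto
      then show "AE t in \<nu>. (if t < a then 1 else 0) = indicat_real {..a} t"
        by (rule AE_mp) (rule AE_I2, auto simp: indicator_def)
    qed measurable
    also have "\<dots> = measure \<nu> {..a}" by (simp add: \<nu>_def)
    finally show ?thesis using that unfolding me by (simp add: erlang_CDF_def)
  qed
  define P where "P t = (\<integral>\<omega>. ind \<omega> t \<partial>M)" for t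
  have Pm [measurable]: "P \<in> borel_measurable \<nu>"
    unfolding P_def ind_def by (rule borel_measurable_lebesgue_integral) measurable
  have P_eq: "P t = (\<integral>\<omega>. (if stay t \<omega> then 1 else 0) \<partial>M)" if "0 < t" for t
    unfolding P_def
  proof (rule integral_cong_AE)
    have [measurable]: "Measurable.pred M (stay t)" by (rule stay_pred[OF that])
    show "(\<lambda>\<omega>. if stay t \<omega> then 1 else 0 :: real) \<in> borel_measurable M" by measurable
    show "(\<lambda>\<omega>. ind \<omega> t) \<in> borel_measurable M" unfolding ind_def by measurable
    show "AE \<omega> in M. ind \<omega> t = (if stay t \<omega> then 1 else 0)"
      using AE_exits by (rule AE_mp) (rule AE_I2, auto simp: ind_def stay_iff_less_exit)
  qed
  have total: "(\<integral>t. P t \<partial>\<nu>) = 1 - (\<integral>\<omega>. exp (- (c * bm_exit B \<omega>)) \<partial>M)"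
  proof -
    have "(\<integral>t. P t \<partial>\<nu>) = (\<integral>\<omega>. \<integral>t. ind \<omega> t \<partial>\<nu> \<partial>M)"
      unfolding P_def by (rule PM.Fubini_integral) (rule PM.integrable_const_bound[of _ 1], auto simp: ind_def)
    also have "\<dots> = (\<integral>\<omega>. 1 - exp (- (c * bm_exit B \<omega>)) \<partial>M)"
    proof (rule integral_cong_AE)
      show "(\<lambda>\<omega>. \<integral>t. ind \<omega> t \<partial>\<nu>) \<in> borel_measurable M"
        by (rule E.borel_measurable_lebesgue_integral) measurable
      show "AE \<omega> in M. (\<integral>t. ind \<omega> t \<partial>\<nu>) = 1 - exp (- (c * bm_exit B \<omega>))"
        using AE_exits by (rule AE_mp) (rule AE_I2, simp add: ind_def cdf exit_nonneg)
    qed measurable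
    also have "\<dots> = (\<integral>\<omega>. 1 \<partial>M) - (\<integral>\<omega>. exp (- (c * bm_exit B \<omega>)) \<partial>M)"
    proof (rule Bochner_Integration.integral_diff)
      show "integrable M (\<lambda>\<omega>. exp (- (c * bm_exit B \<omega>)))"
      proof (rule integrable_const_bound[of _ 1])
        show "AE \<omega> in M. norm (exp (- (c * bm_exit B \<omega>))) \<le> 1"
          using AE_exits by (rule AE_mp) (rule AE_I2, use c in \<open>simp add: exit_nonneg\<close>)
      qed measurable
    qed simp
    finally show ?thesis by (simp add: prob_space)
  qed
  define F where "F j t = (\<Sum>k\<in>\<Lambda> j. b j k * exp (- rate k * t))" for j t
  have F_eq: "F j t = (\<integral>\<omega>. (if stay t \<omega> then 1 else 0) * (\<Prod>i\<in>UNIV. qpoly j (pi / 2 * (B t \<omega> $ i))) \<partial>M)" if t: "0 < t" for j t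
  proof -
    have \<kappa>: "0 \<le> (2 * real m + 1) * pi / 2" "cos ((2 * real m + 1) * pi / 2) = 0" for m
      using cos_odd_multiple[of m] by auto
    have sm [measurable]: "Measurable.pred M (stay t)" by (rule stay_pred[OF t])
    have "(\<integral>\<omega>. (if stay t \<omega> then 1 else 0) * (\<Prod>i\<in>UNIV. qpoly j (pi / 2 * (B t \<omega> $ i))) \<partial>M) =
        (\<integral>\<omega>. (\<Sum>k\<in>\<Lambda> j. b j k * ((if stay t \<omega> then 1 else 0) * cospr (\<lambda>i. (2 * real (k i) + 1) * pi / 2) (\<lambda>i. B t \<omega> $ i))) \<partial>M)"
      unfolding expn cospr_def sum_distrib_left by (simp add: mult.left_commute)
    also have "\<dots> = (\<Sum>k\<in>\<Lambda> j. \<integral>\<omega>. b j k * ((if stay t \<omega> then 1 else 0) * cospr (\<lambda>i. (2 * real (k i) + 1) * pi / 2) (\<lambda>i. B t \<omega> $ i)) \<partial>M)"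
    proof (intro Bochner_Integration.integral_sum integrable_mult_right)
      fix k
      have [measurable]: "(\<lambda>\<omega>. cospr (\<lambda>i. (2 * real (k i) + 1) * pi / 2) (\<lambda>i. B t \<omega> $ i)) \<in> borel_measurable M"
        using t by (intro cospr_B_measurable) simp
      show "integrable M (\<lambda>\<omega>. (if stay t \<omega> then 1 else 0) * cospr (\<lambda>i. (2 * real (k i) + 1) * pi / 2) (\<lambda>i. B t \<omega> $ i))"
      proof (rule integrable_bounded[of _ 1])
        fix \<omega> show "\<bar>(if stay t \<omega> then 1 else 0) * cospr (\<lambda>i. (2 * real (k i) + 1) * pi / 2) (\<lambda>i. B t \<omega> $ i)\<bar> \<le> 1"
          by (intro abs_mult_le_one cospr_abs_le) auto
      qed measurable
    qed
    also have "\<dots> = F j t"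
      unfolding F_def rate_def using stay_cospr[OF t \<kappa>] by (intro sum.cong refl) simp
    finally show ?thesis by simp
  qed
  have qb: "0 \<le> (\<Prod>i\<in>UNIV. qpoly j (pi / 2 * (B t \<omega> $ i)))" "(\<Prod>i\<in>UNIV. qpoly j (pi / 2 * (B t \<omega> $ i))) \<le> 1"
    "(\<lambda>j. \<Prod>i\<in>UNIV. qpoly j (pi / 2 * (B t \<omega> $ i))) \<longlonglongrightarrow> 1" if t: "0 < t" and st: "stay t \<omega>" for j t \<omega>
  proof -
    have pos: "0 < cos (pi / 2 * (B t \<omega> $ i))" for i
    proof (rule cos_gt_zero_pi)
      have "\<bar>B t \<omega> $ i\<bar> < 1" using st t by (simp add: stay_def)
      then have "-1 < B t \<omega> $ i" "B t \<omega> $ i < 1" by linarith+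
      then have "pi / 2 * (-1) < pi / 2 * (B t \<omega> $ i)" "pi / 2 * (B t \<omega> $ i) < pi / 2 * 1"
        by (intro mult_strict_left_mono; simp)+
      then show "- (pi / 2) < pi / 2 * (B t \<omega> $ i)" "pi / 2 * (B t \<omega> $ i) < pi / 2" by simp_all
    qed
    show "0 \<le> (\<Prod>i\<in>UNIV. qpoly j (pi / 2 * (B t \<omega> $ i)))"
      by (intro prod_nonneg qpoly_nonneg less_imp_le pos)
    show "(\<Prod>i\<in>UNIV. qpoly j (pi / 2 * (B t \<omega> $ i))) \<le> 1"
      by (intro prod_le_1 conjI qpoly_nonneg qpoly_le_1 less_imp_le pos)
    have "(\<lambda>j. \<Prod>i\<in>UNIV. qpoly j (pi / 2 * (B t \<omega> $ i))) \<longlonglongrightarrow> (\<Prod>i\<in>(UNIV::'d set). 1)"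
      by (intro tendsto_prod qpoly_tendsto pos)
    then show "(\<lambda>j. \<Prod>i\<in>UNIV. qpoly j (pi / 2 * (B t \<omega> $ i))) \<longlonglongrightarrow> 1" by simp
  qed
  have qm: "(\<lambda>\<omega>. \<Prod>i\<in>UNIV. qpoly j (pi / 2 * (B t \<omega> $ i))) \<in> borel_measurable M" if "0 < t" for j t
  proof -
    have [measurable]: "(\<lambda>\<omega>. B t \<omega> $ i) \<in> borel_measurable M" for i using that by simp
    have "qpoly j \<in> borel_measurable borel" unfolding qpoly_def[abs_def] by measurable
    then have [measurable]: "(\<lambda>\<omega>. qpoly j (pi / 2 * (B t \<omega> $ i))) \<in> borel_measurable M" for i
      by (rule measurable_compose[rotated]) measurable
    show ?thesis by measurable
  qed
  have F_lim: "(\<lambda>j. F j t) \<longlonglongrightarrow> P t" if t: "0 < t" for t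
  proof -
    have sm [measurable]: "Measurable.pred M (stay t)" by (rule stay_pred[OF t])
    have "(\<lambda>j. \<integral>\<omega>. (if stay t \<omega> then 1 else 0) * (\<Prod>i\<in>UNIV. qpoly j (pi / 2 * (B t \<omega> $ i))) \<partial>M) \<longlonglongrightarrow> (\<integral>\<omega>. (if stay t \<omega> then 1 else 0) \<partial>M)"
    proof (rule integral_dominated_convergence[where w = "\<lambda>_. 1"])
      show "(\<lambda>\<omega>. (if stay t \<omega> then 1 else 0) * (\<Prod>i\<in>UNIV. qpoly j (pi / 2 * (B t \<omega> $ i)))) \<in> borel_measurable M" for j
        using qm[OF t] by measurable
      show "AE \<omega> in M. (\<lambda>j. (if stay t \<omega> then 1 else 0) * (\<Prod>i\<in>UNIV. qpoly j (pi / 2 * (B t \<omega> $ i)))) \<longlonglongrightarrow> (if stay t \<omega> then 1 else 0)"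
        by (rule AE_I2) (use qb(3)[OF t] in simp)
      show "AE \<omega> in M. norm ((if stay t \<omega> then 1 else 0) * (\<Prod>i\<in>UNIV. qpoly j (pi / 2 * (B t \<omega> $ i)))) \<le> 1" for j
        by (rule AE_I2) (use qb(1,2)[OF t] in simp)
    qed auto
    then show ?thesis by (simp add: F_eq[OF t] P_eq[OF t])
  qed
  \<comment> \<open>The signed sum of exponentials hides this bound. It comes from the
    representation as an expectation of values in [0, 1].\<close>
  have F_bd: "\<bar>F j t\<bar> \<le> 1" if t: "0 < t" for j t
  proof -
    have sm [measurable]: "Measurable.pred M (stay t)" by (rule stay_pred[OF t])
    have "\<bar>F j t\<bar> \<le> (\<integral>\<omega>. \<bar>(if stay t \<omega> then 1 else 0) * (\<Prod>i\<in>UNIV. qpoly j (pi / 2 * (B t \<omega> $ i)))\<bar> \<partial>M)"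
      unfolding F_eq[OF t] by (rule integral_abs_bound)
    also have "\<dots> \<le> (\<integral>\<omega>. 1 \<partial>M)"
    proof (rule integral_mono')
      show "\<bar>(if stay t \<omega> then 1 else 0) * (\<Prod>i\<in>UNIV. qpoly j (pi / 2 * (B t \<omega> $ i)))\<bar> \<le> 1" for \<omega>
        using qb(1,2)[OF t] by simp
    qed auto
    finally show ?thesis by (simp add: prob_space)
  qed
  have "(\<lambda>j. \<integral>t. F j t \<partial>\<nu>) \<longlonglongrightarrow> (\<integral>t. P t \<partial>\<nu>)"
  proof (rule integral_dominated_convergence[where w = "\<lambda>_. 1"])
    show "F j \<in> borel_measurable \<nu>" for j unfolding F_def[abs_def] by measurable
    show "AE t in \<nu>. (\<lambda>j. F j t) \<longlonglongrightarrow> P t" using \<nu>_pos by (rule AE_mp) (rule AE_I2, simp add: F_lim)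
    show "AE t in \<nu>. norm (F j t) \<le> 1" for j using \<nu>_pos by (rule AE_mp) (rule AE_I2, simp add: F_bd)
  qed auto
  moreover have "(\<integral>t. F j t \<partial>\<nu>) = (\<Sum>k\<in>\<Lambda> j. b j k * (c / (c + rate k)))" for j
  proof -
    have ex: "integrable \<nu> (\<lambda>t. exp (- rate k * t))" "(\<integral>t. exp (- rate k * t) \<partial>\<nu>) = c / (c + rate k)" for k
    proof -
      have cr: "0 < c + rate k" using c rate0[of k] by simp
      interpret E': prob_space "density lborel (exponential_density (c + rate k))"
        by (rule prob_space_exponential_density[OF cr])
      have eq: "exponential_density c t * exp (- (rate k * t)) = c / (c + rate k) * exponential_density (c + rate k) t" for t
        using cr by (simp add: exponential_density_def exp_add[symmetric] field_simps)
      have "integrable (density lborel (exponential_density (c + rate k))) (\<lambda>_. 1 :: real)" by simp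
      then have I: "integrable lborel (exponential_density (c + rate k))"
        by (subst (asm) integrable_density) (use cr in auto)
      have "(\<integral>t. (1::real) \<partial>density lborel (exponential_density (c + rate k))) = 1" using E'.prob_space by simp
      then have V: "(\<integral>t. exponential_density (c + rate k) t \<partial>lborel) = 1"
        by (subst (asm) integral_density) (use cr in auto)
      show "integrable \<nu> (\<lambda>t. exp (- rate k * t))"
        unfolding \<nu>_def by (subst integrable_density) (use c I in \<open>auto simp: eq intro!: integrable_mult_right\<close>)
      show "(\<integral>t. exp (- rate k * t) \<partial>\<nu>) = c / (c + rate k)"
        unfolding \<nu>_def by (subst integral_density) (use c I V in \<open>auto simp: eq\<close>)
    qed
    have "(\<integral>t. F j t \<partial>\<nu>) = (\<Sum>k\<in>\<Lambda> j. \<integral>t. b j k * exp (- rate k * t) \<partial>\<nu>)"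
      unfolding F_def by (intro Bochner_Integration.integral_sum integrable_mult_right ex(1))
    then show ?thesis by (simp only: integral_mult_right_zero ex(2))
  qed
  ultimately show ?thesis unfolding total rate_def by simp
qed

end

section \<open>Asymptotics of the hitting rate\<close>

text \<open>A form suited to double limits: an auxiliary horizon, degree or scale can be fixed
  before N grows, with \<open>c\<close> depending on it.\<close>

lemma tendsto_approx:
  fixes q :: "'a \<Rightarrow> real"
  assumes "\<And>e. 0 < e \<Longrightarrow> \<exists>c. \<bar>c - L\<bar> \<le> e \<and> (\<forall>\<^sub>F x in F. \<bar>q x - c\<bar> \<le> e)"
  shows "(q \<longlongrightarrow> L) F"
proof (rule tendstoI)
  fix e :: real assume "0 < e"
  then have "0 < e / 3" by simp
  then obtain c where c: "\<bar>c - L\<bar> \<le> e / 3" "\<forall>\<^sub>F x in F. \<bar>q x - c\<bar> \<le> e / 3" using assms by blast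
  show "\<forall>\<^sub>F x in F. dist (q x) L < e"
    using c(2)
  proof eventually_elim
    fix x assume "\<bar>q x - c\<bar> \<le> e / 3"
    then show "dist (q x) L < e" using c(1) \<open>0 < e\<close> unfolding dist_real_def by linarith
  qed
qed

text \<open>With q = \<open>quarter_root N\<close>, the time N^2 q exceeds the mixing time N^2 of the torus but is
  negligible against N^d and against the square of N q, while N q is negligible against L.\<close>

definition quarter_root :: "nat \<Rightarrow> nat" where "quarter_root N = nat \<lfloor>real N powr (1 / 4)\<rfloor>"

definition mix_time :: "nat \<Rightarrow> nat" where "mix_time N = N\<^sup>2 * quarter_root N"

lemma quarter_root_bounds: "real (quarter_root N) \<le> real N powr (1 / 4)" "real N powr (1 / 4) - 1 \<le> real (quarter_root N)"
proof -
  have "real (quarter_root N) = of_int \<lfloor>real N powr (1 / 4)\<rfloor>" unfolding quarter_root_def by (simp add: of_nat_nat)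
  then show "real (quarter_root N) \<le> real N powr (1 / 4)" "real N powr (1 / 4) - 1 \<le> real (quarter_root N)" by linarith+
qed

lemma quarter_root_at_top: "filterlim (\<lambda>N. real (quarter_root N)) at_top sequentially"
proof (rule filterlim_at_top_mono)
  show "filterlim (\<lambda>N. real N powr (1 / 4) - 1) at_top sequentially" by real_asymp
qed (use quarter_root_bounds(2) in auto)

lemma mix_time_small:
  assumes "3 \<le> d"
  shows "(\<lambda>N. real (mix_time N) / real N ^ d) \<longlonglongrightarrow> 0"
proof (rule tendsto_sandwich[of "\<lambda>_. 0"])
  show "(\<lambda>N. real N powr (1 / 4) / real N) \<longlonglongrightarrow> 0" by real_asymp
  show "\<forall>\<^sub>F N in sequentially. real (mix_time N) / real N ^ d \<le> real N powr (1 / 4) / real N"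
  proof (rule eventually_mono[OF eventually_gt_at_top[of 0]])
    fix N :: nat assume N: "0 < N"
    have "real N ^ 3 \<le> real N ^ d" using N assms by (intro power_increasing) auto
    then have "real (mix_time N) / real N ^ d \<le> real (mix_time N) / real N ^ 3"
      using N by (intro divide_left_mono) auto
    also have "\<dots> = real (quarter_root N) / real N" using N by (simp add: mix_time_def power2_eq_square power3_eq_cube)
    also have "\<dots> \<le> real N powr (1 / 4) / real N" by (intro divide_right_mono quarter_root_bounds) simp
    finally show "real (mix_time N) / real N ^ d \<le> real N powr (1 / 4) / real N" .
  qed
qed auto

lemma mix_time_at_top: "filterlim mix_time at_top sequentially"
proof -
  have "filterlim (\<lambda>N. real (mix_time N)) at_top sequentially"
  proof (rule filterlim_at_top_mono[OF quarter_root_at_top])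
    show "\<forall>\<^sub>F N in sequentially. real (quarter_root N) \<le> real (mix_time N)"
      using eventually_gt_at_top[of 0]
    proof eventually_elim
      fix N :: nat assume "0 < N"
      then have "1 * quarter_root N \<le> N\<^sup>2 * quarter_root N" by (intro mult_right_mono) (auto simp: Suc_le_eq)
      then have "quarter_root N \<le> mix_time N" by (simp add: mix_time_def)
      then show "real (quarter_root N) \<le> real (mix_time N)" by (simp only: of_nat_le_iff)
    qed
  qed
  then show ?thesis unfolding filterlim_sequentially_iff_filterlim_real .
qed

lemma heat_bound_mix_time: "(\<lambda>N. heat_bound d N (mix_time N)) \<longlonglongrightarrow> 1"
proof -
  have "(\<lambda>N. (1 + 4 * sqrt (real d) / sqrt (real (quarter_root N))) ^ d) \<longlonglongrightarrow> (1 + 0) ^ d"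
    by (intro tendsto_intros real_tendsto_divide_at_top[OF tendsto_const]
        filterlim_compose[OF sqrt_at_top quarter_root_at_top])
  moreover have "\<forall>\<^sub>F N in sequentially. (1 + 4 * sqrt (real d) / sqrt (real (quarter_root N))) ^ d = heat_bound d N (mix_time N)"
    using eventually_gt_at_top[of 0]
    by eventually_elim (simp add: heat_bound_def mix_time_def real_sqrt_mult)
  ultimately show ?thesis by (simp add: tendsto_cong)
qed

lemma finite_zball: "finite (zball (0 :: int ^ 'd) R)"
proof -
  define n where "n = nat \<lceil>R\<rceil>"
  have "zball (0 :: int ^ 'd) R \<subseteq> (\<lambda>y. y - (\<chi> i. int n)) ` pcell (2 * n + 1)"
  proof
    fix y :: "int ^ 'd" assume "y \<in> zball 0 R"
    then have "inorm y < R" by (simp add: zball_def)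
    then have "\<bar>real_of_int (y $ i)\<bar> < R" for i using component_le_inorm[of y i] by linarith
    moreover have "R \<le> real n" unfolding n_def by linarith
    ultimately have "\<bar>real_of_int (y $ i)\<bar> \<le> real n" for i by (meson less_le_trans less_imp_le)
    then have yb: "\<bar>y $ i\<bar> \<le> int n" for i using of_int_le_iff[of "\<bar>y $ i\<bar>" "int n", where 'a = real] by simp
    have "0 \<le> y $ i + int n \<and> y $ i + int n < int (2 * n + 1)" for i using yb[of i] by linarith
    then have "y + (\<chi> i. int n) \<in> pcell (2 * n + 1)"
      unfolding pcell_def by simp
    then show "y \<in> (\<lambda>y. y - (\<chi> i. int n)) ` pcell (2 * n + 1)"
      by (intro image_eqI[where x = "y + (\<chi> i. int n)"]) auto
  qed
  then show ?thesis by (rule finite_subset) simp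
qed

section \<open>Translated obstacles along a filter\<close>

text \<open>The filter is left free so that limits can be taken along exceptional values of N with a
  translate \<open>a N\<close> chosen for each of them. Uniformity in the translate then follows by
  contradiction.\<close>

locale homog =
  fixes K :: "(int ^ 'd) set" and F :: "nat filter" and a :: "nat \<Rightarrow> int ^ 'd" and R :: real and g :: "nat \<Rightarrow> real"
  assumes d3: "3 \<le> CARD('d)" and KR: "K \<subseteq> zball 0 R" and Fle: "F \<le> sequentially"
    and far: "\<forall>\<^sub>F N in F. obst N (a N) K \<inter> zball 0 (g N) = {}"
    and ginf: "filterlim g at_top sequentially"
begin


definition D :: "nat \<Rightarrow> (int ^ 'd) set" where "D N = obst N (a N) K"

lemma ev: "eventually P sequentially \<Longrightarrow> eventually P F"
  by (rule filter_leD[OF Fle])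

lemma lim: "f \<longlonglongrightarrow> l \<Longrightarrow> (f \<longlongrightarrow> l) F"
  by (rule tendsto_mono[OF Fle])

lemma finite_K [simp]: "finite K"
  by (rule finite_subset[OF KR finite_zball])

lemma K_bound: "k \<in> K \<Longrightarrow> \<bar>real_of_int (k $ i)\<bar> < R"
  using KR component_le_inorm[of k i] by (auto simp: zball_def)

lemma congruent_close_eq:
  fixes u v :: int
  assumes "u mod int N = v mod int N" "\<bar>u - v\<bar> < int N"
  shows "u = v"
proof -
  have dv: "int N dvd u - v" using assms(1) by (simp add: mod_eq_dvd_iff)
  show ?thesis
  proof (rule ccontr)
    assume "u \<noteq> v"
    then have "\<bar>int N\<bar> \<le> \<bar>u - v\<bar>" using dvd_imp_le_int[OF _ dv] by simp
    then show False using assms(2) by simp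
  qed
qed

lemma ev_sep: "\<forall>\<^sub>F N in F. 0 < N \<and> separated N K"
proof (rule ev)
  obtain N0 :: nat where N0: "2 * R < real N0" using reals_Archimedean2 by blast
  show "\<forall>\<^sub>F N in sequentially. 0 < N \<and> separated N K"
    using eventually_ge_at_top[of "Suc N0"]
  proof eventually_elim
    fix N assume N: "Suc N0 \<le> N"
    have "k = k'" if k: "k \<in> K" "k' \<in> K" "\<forall>i. k $ i mod int N = k' $ i mod int N" for k k'
      unfolding vec_eq_iff
    proof
      fix i
      have "\<bar>real_of_int (k $ i - k' $ i)\<bar> < real N"
      proof -
        have "real N0 < real N" using N by simp
        then show ?thesis using K_bound[OF k(1), of i] K_bound[OF k(2), of i] N0 unfolding of_int_diff by linarith
      qed
      then have "\<bar>k $ i - k' $ i\<bar> < int N" by linarith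
      then show "k $ i = k' $ i" using k(3) congruent_close_eq by blast
    qed
    then show "0 < N \<and> separated N K" using N by (auto simp: separated_def)
  qed
qed

text \<open>The loss between times \<open>m\<close> and \<open>n\<close> is at most the expected
  number of visits to the obstacles in between, which the heat kernel bounds uniformly in the
  starting point.\<close>

lemma avoid_D_lower:
  assumes "heat_C \<ge> 0"
    and tail: "\<And>N m n. N > 0 \<Longrightarrow> (\<Sum>t=m..<n. heat_bound CARD('d) N (Suc t) / real N ^ CARD('d)) \<le> heat_C * (real n / real N ^ CARD('d)) + z m"
    and N: "0 < N" "separated N K" and mn: "m \<le> n"
  shows "avoid (D N) m y - real (card K) * (heat_C * (real n / real N ^ CARD('d)) + z m) \<le> avoid (D N) n y"
proof -
  have "(\<Sum>t=m..<n. surv UNIV (Suc t) (indicator (D N)) y) \<le> (\<Sum>t=m..<n. real (card K) * (heat_bound CARD('d) N (Suc t) / real N ^ CARD('d)))"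
  proof (rule sum_mono)
    fix t
    have "surv UNIV (Suc t) (indicator (D N)) y \<le> heat_bound CARD('d) N (Suc t) * cell_avg N (indicator (D N))"
      unfolding D_def by (rule surv_periodic_le) (use N in \<open>auto simp: periodic_indicator\<close>)
    then show "surv UNIV (Suc t) (indicator (D N)) y \<le> real (card K) * (heat_bound CARD('d) N (Suc t) / real N ^ CARD('d))"
      unfolding D_def cell_avg_indicator[OF N(1) finite_K N(2)] by (simp add: mult.commute)
  qed
  also have "\<dots> = real (card K) * (\<Sum>t=m..<n. heat_bound CARD('d) N (Suc t) / real N ^ CARD('d))" by (simp add: sum_distrib_left)
  also have "\<dots> \<le> real (card K) * (heat_C * (real n / real N ^ CARD('d)) + z m)"
    by (intro mult_left_mono tail N) simp
  finally show ?thesis using avoid_diff_le[OF mn, of "D N" y] by linarith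
qed

text \<open>For a fixed number of steps and large N, only one periodic copy of \<open>K\<close> is
  within reach.\<close>

lemma lazy_avoid_K:
  fixes m :: nat
  shows "\<forall>\<^sub>F N in F. \<forall>k\<in>K. lazy_op (avoid (D N) m) (k + a N) = lazy_op (avoid K m) k"
proof (rule ev)
  \<comment> \<open>2 R bounds coordinate differences inside \<open>K\<close>, \<open>m\<close> is
    the range of \<open>avoid\<close>, and 1 that of the additional step.\<close>
  obtain N0 :: nat where N0: "2 * R + real m + 1 < real N0" using reals_Archimedean2 by blast
  show "\<forall>\<^sub>F N in sequentially. \<forall>k\<in>K. lazy_op (avoid (D N) m) (k + a N) = lazy_op (avoid K m) k"
    using eventually_ge_at_top[of "Suc N0"]
  proof eventually_elim
    fix N assume N: "Suc N0 \<le> N"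
    let ?K = "(\<lambda>k. k + a N) ` K"
    show "\<forall>k\<in>K. lazy_op (avoid (D N) m) (k + a N) = lazy_op (avoid K m) k"
    proof
      fix k assume k: "k \<in> K"
      have near: "avoid (D N) m y = avoid ?K m y" if y: "\<forall>i. \<bar>y $ i - (k + a N) $ i\<bar> \<le> 1" for y
      proof (rule avoid_local)
        fix y' :: "int ^ 'd" assume y': "\<forall>i. \<bar>y' $ i - y $ i\<bar> \<le> int m"
        show "y' \<in> D N \<longleftrightarrow> y' \<in> ?K"
        proof
          assume "y' \<in> D N"
          then obtain k' where k': "k' \<in> K" "\<forall>i. y' $ i mod int N = (k' + a N) $ i mod int N"
            by (auto simp: D_def obst_def)
          have "y' $ i = (k' + a N) $ i" for i
          proof (rule congruent_close_eq)
            have "\<bar>real_of_int (y' $ i - (k' + a N) $ i)\<bar> < real N"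
            proof -
              have "\<bar>real_of_int (y' $ i - y $ i)\<bar> \<le> real m" using y'[rule_format, of i] by linarith
              moreover have "\<bar>real_of_int (y $ i - (k + a N) $ i)\<bar> \<le> 1" using y[rule_format, of i] by linarith
              moreover have "y' $ i - (k' + a N) $ i = (y' $ i - y $ i) + (y $ i - (k + a N) $ i) + (k $ i - k' $ i)" by simp
              ultimately show ?thesis
                using K_bound[OF k, of i] K_bound[OF k'(1), of i] N0 N by (simp only: of_int_add of_int_diff)
            qed
            then show "\<bar>y' $ i - (k' + a N) $ i\<bar> < int N" by linarith
          qed (use k'(2) in blast)
          then have "y' = k' + a N" by (simp add: vec_eq_iff)
          then show "y' \<in> ?K" using k'(1) by blast
        qed (auto simp: D_def obst_def)
      qed
      have "lazy_op (avoid (D N) m) (k + a N) = lazy_op (avoid ?K m) (k + a N)"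
        by (rule lazy_op_cong_local; rule near) (auto simp: axis_def)
      also have "\<dots> = lazy_op (\<lambda>y. avoid ?K m (y + a N)) k" by (rule lazy_op_shift[symmetric])
      finally show "lazy_op (avoid (D N) m) (k + a N) = lazy_op (avoid K m) k" by (simp only: avoid_shift)
    qed
  qed
qed

text \<open>For a fixed horizon \<open>m\<close> the sum in \<open>cell_avg_hit\<close> eventually
  is that of \<open>K\<close> alone, which tends to \<open>Cap K / 2\<close> as \<open>m\<close>
  grows. Extending the horizon from \<open>m\<close> to \<open>n N\<close> changes little, because
  late visits are rare.\<close>

theorem hit_rate_tendsto_Cap:
  assumes small: "(\<lambda>N. real (n N) / real N ^ CARD('d)) \<longlonglongrightarrow> 0" and ninf: "filterlim n at_top sequentially"
  shows "((\<lambda>N. real N ^ CARD('d) * cell_avg N (hit (D N) (n N))) \<longlongrightarrow> Cap K / 2) F"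
proof (rule tendsto_approx)
  fix e :: real assume e: "0 < e"
  obtain C :: real and z where C: "0 \<le> C" "z \<longlonglongrightarrow> 0"
    and tail: "\<And>N m n. N > 0 \<Longrightarrow> (\<Sum>t=m..<n. heat_bound CARD('d) N (Suc t) / real N ^ CARD('d)) \<le> C * (real n / real N ^ CARD('d)) + z m"
    using heat_tail[OF d3] by metis
  \<comment> \<open>One factor counts the summands over \<open>K\<close>, the other the obstacle
    points per period cell.\<close>
  define q where "q = real (card K) * real (card K)"
  have "(\<lambda>m. q * z m) \<longlonglongrightarrow> q * 0" by (intro tendsto_intros C)
  then have "\<forall>\<^sub>F m in sequentially. q * z m < e / 2" using e by (intro order_tendstoD(2)) auto
  moreover have "\<forall>\<^sub>F m in sequentially. dist (\<Sum>k\<in>K. lazy_op (avoid K m) k) (Cap K / 2) < e"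
    using lazy_avoid_tendsto_Cap[of K] e by (rule tendstoD)
  ultimately have "\<forall>\<^sub>F m in sequentially. q * z m < e / 2 \<and> dist (\<Sum>k\<in>K. lazy_op (avoid K m) k) (Cap K / 2) < e"
    by (rule eventually_conj)
  then obtain m where m: "q * z m < e / 2" "dist (\<Sum>k\<in>K. lazy_op (avoid K m) k) (Cap K / 2) < e"
    by (auto simp: eventually_sequentially)
  have "(\<lambda>N. q * (C * (real (n N) / real N ^ CARD('d)))) \<longlonglongrightarrow> q * (C * 0)" by (intro tendsto_intros small)
  then have ev1: "\<forall>\<^sub>F N in sequentially. q * (C * (real (n N) / real N ^ CARD('d))) < e / 2"
    using e by (intro order_tendstoD(2)) auto
  have ev2: "\<forall>\<^sub>F N in sequentially. m \<le> n N" using ninf by (simp add: filterlim_at_top)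
  show "\<exists>c. \<bar>c - Cap K / 2\<bar> \<le> e \<and> (\<forall>\<^sub>F N in F. \<bar>real N ^ CARD('d) * cell_avg N (hit (D N) (n N)) - c\<bar> \<le> e)"
  proof (intro exI conjI)
    show "\<bar>(\<Sum>k\<in>K. lazy_op (avoid K m) k) - Cap K / 2\<bar> \<le> e" using m(2) by (simp add: dist_real_def)
    show "\<forall>\<^sub>F N in F. \<bar>real N ^ CARD('d) * cell_avg N (hit (D N) (n N)) - (\<Sum>k\<in>K. lazy_op (avoid K m) k)\<bar> \<le> e"
      using ev[OF ev1] ev[OF ev2] ev_sep lazy_avoid_K[of m]
    proof eventually_elim
      fix N assume N: "q * (C * (real (n N) / real N ^ CARD('d))) < e / 2" "m \<le> n N" "0 < N \<and> separated N K"
        "\<forall>k\<in>K. lazy_op (avoid (D N) m) (k + a N) = lazy_op (avoid K m) k"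
      let ?t = "real (card K) * (C * (real (n N) / real N ^ CARD('d)) + z m)"
      have eq: "real N ^ CARD('d) * cell_avg N (hit (D N) (n N)) = (\<Sum>k\<in>K. lazy_op (avoid (D N) (n N)) (k + a N))"
        unfolding D_def by (rule cell_avg_hit) (use N in auto)
      have up: "lazy_op (avoid (D N) (n N)) (k + a N) \<le> lazy_op (avoid K m) k" if "k \<in> K" for k
      proof -
        have "lazy_op (avoid (D N) (n N)) (k + a N) \<le> lazy_op (avoid (D N) m) (k + a N)"
          by (rule lazy_op_mono) (rule avoid_antimono[OF N(2)])
        then show ?thesis using N(4) that by simp
      qed
      have lo: "lazy_op (avoid K m) k - ?t \<le> lazy_op (avoid (D N) (n N)) (k + a N)" if "k \<in> K" for k
      proof -
        have "lazy_op (\<lambda>y. avoid (D N) m y - ?t) (k + a N) \<le> lazy_op (avoid (D N) (n N)) (k + a N)"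
          by (rule lazy_op_mono) (rule avoid_D_lower[OF C(1) tail], use N in auto)
        then show ?thesis using N(4) that by (simp add: lazy_op_diff)
      qed
      have "(\<Sum>k\<in>K. lazy_op (avoid (D N) (n N)) (k + a N)) \<le> (\<Sum>k\<in>K. lazy_op (avoid K m) k)" by (intro sum_mono up)
      moreover have "(\<Sum>k\<in>K. lazy_op (avoid K m) k - ?t) \<le> (\<Sum>k\<in>K. lazy_op (avoid (D N) (n N)) (k + a N))" by (intro sum_mono lo)
      moreover have "(\<Sum>k\<in>K. lazy_op (avoid K m) k - ?t) = (\<Sum>k\<in>K. lazy_op (avoid K m) k) - q * (C * (real (n N) / real N ^ CARD('d))) - q * z m"
        by (simp add: sum_subtractf q_def algebra_simps)
      moreover have "\<bar>S - T\<bar> \<le> e" if "S \<le> T" "T0 \<le> S" "T0 = T - u - v" "u < e / 2" "v < e / 2" for S T T0 u v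
        using that by linarith
      ultimately show "\<bar>real N ^ CARD('d) * cell_avg N (hit (D N) (n N)) - (\<Sum>k\<in>K. lazy_op (avoid K m) k)\<bar> \<le> e"
        unfolding eq using N(1) m(1) by blast
    qed
  qed
qed

text \<open>During the first \<open>m\<close> steps the walk stays in the obstacle-free ball once
  \<open>g N\<close> exceeds sqrt d times \<open>m\<close>; later visits are rare, as in
  \<open>avoid_D_lower\<close>.\<close>

lemma avoid_origin_tendsto:
  assumes small: "(\<lambda>N. real (n N) / real N ^ CARD('d)) \<longlonglongrightarrow> 0" and ninf: "filterlim n at_top sequentially"
  shows "((\<lambda>N. avoid (D N) (n N) 0) \<longlongrightarrow> 1) F"
proof (rule tendsto_approx)
  fix e :: real assume e: "0 < e"
  obtain C :: real and z where C: "0 \<le> C" "z \<longlonglongrightarrow> 0"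
    and tail: "\<And>N m n. N > 0 \<Longrightarrow> (\<Sum>t=m..<n. heat_bound CARD('d) N (Suc t) / real N ^ CARD('d)) \<le> C * (real n / real N ^ CARD('d)) + z m"
    using heat_tail[OF d3] by metis
  define q where "q = real (card K)"
  have "(\<lambda>m. q * z m) \<longlonglongrightarrow> q * 0" by (intro tendsto_intros C)
  then have "\<forall>\<^sub>F m in sequentially. q * z m < e / 2" using e by (intro order_tendstoD(2)) auto
  then obtain m where m: "q * z m < e / 2" by (auto simp: eventually_sequentially)
  have "(\<lambda>N. q * (C * (real (n N) / real N ^ CARD('d)))) \<longlonglongrightarrow> q * (C * 0)" by (intro tendsto_intros small)
  then have ev1: "\<forall>\<^sub>F N in sequentially. q * (C * (real (n N) / real N ^ CARD('d))) < e / 2"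
    using e by (intro order_tendstoD(2)) auto
  have ev2: "\<forall>\<^sub>F N in sequentially. m \<le> n N" using ninf by (simp add: filterlim_at_top)
  have ev3: "\<forall>\<^sub>F N in sequentially. sqrt (real CARD('d)) * real m < g N" using ginf by (simp add: filterlim_at_top_dense)
  show "\<exists>c. \<bar>c - 1\<bar> \<le> e \<and> (\<forall>\<^sub>F N in F. \<bar>avoid (D N) (n N) 0 - c\<bar> \<le> e)"
  proof (intro exI[of _ 1] conjI)
    show "\<forall>\<^sub>F N in F. \<bar>avoid (D N) (n N) 0 - 1\<bar> \<le> e"
      using ev[OF ev1] ev[OF ev2] ev[OF ev3] ev_sep far
    proof eventually_elim
      fix N assume N: "q * (C * (real (n N) / real N ^ CARD('d))) < e / 2" "m \<le> n N" "sqrt (real CARD('d)) * real m < g N"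
        "0 < N \<and> separated N K" "obst N (a N) K \<inter> zball 0 (g N) = {}"
      have "avoid (D N) m 0 = avoid ({} :: (int ^ 'd) set) m 0"
      proof (rule avoid_local)
        fix y :: "int ^ 'd" assume "\<forall>i. \<bar>y $ i - 0 $ i\<bar> \<le> int m"
        then have "inorm y \<le> sqrt (real CARD('d)) * real m" by (intro inorm_le) auto
        then have "y \<in> zball 0 (g N)" using N(3) by (simp add: zball_def)
        then show "y \<in> D N \<longleftrightarrow> y \<in> {}" using N(5) by (auto simp: D_def)
      qed
      then have "avoid (D N) m 0 = 1" by (simp add: avoid_empty)
      moreover have "avoid (D N) m 0 - q * (C * (real (n N) / real N ^ CARD('d)) + z m) \<le> avoid (D N) (n N) 0"
        unfolding q_def by (rule avoid_D_lower[OF C(1) tail]) (use N in auto)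
      ultimately show "\<bar>avoid (D N) (n N) 0 - 1\<bar> \<le> e"
        using N(1) m avoid_le_1[of "D N" "n N" 0] by (simp add: distrib_left)
    qed
  qed (use e in simp)
qed

end

section \<open>Occupation of the box outside the obstacles\<close>

lemma one_minus_prod_le:
  fixes q :: "'a \<Rightarrow> real"
  assumes "finite I" "\<And>i. i \<in> I \<Longrightarrow> 0 \<le> q i" "\<And>i. i \<in> I \<Longrightarrow> q i \<le> 1"
  shows "1 - (\<Prod>i\<in>I. q i) \<le> (\<Sum>i\<in>I. 1 - q i)"
  using assms
proof (induction I rule: finite_induct)
  case (insert i I)
  have "0 \<le> (\<Prod>j\<in>I. q j)" "(\<Prod>j\<in>I. q j) \<le> 1" using insert by (auto intro!: prod_nonneg prod_le_1)
  moreover have "0 \<le> q i" "q i \<le> 1" using insert by auto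
  ultimately have "0 \<le> (1 - q i) * (1 - (\<Prod>j\<in>I. q j))" by simp
  then have "1 - q i * (\<Prod>j\<in>I. q j) \<le> (1 - q i) + (1 - (\<Prod>j\<in>I. q j))" by (simp add: algebra_simps)
  then show ?case using insert by simp
qed simp

context homog
begin

definition w :: "nat \<Rightarrow> int ^ 'd \<Rightarrow> real" where "w N = avoid (D N) (2 * mix_time N)"
definition f :: "nat \<Rightarrow> int ^ 'd \<Rightarrow> real" where "f N = hit (D N) (2 * mix_time N)"
definition HB :: "nat \<Rightarrow> real" where "HB N = heat_bound CARD('d) N (mix_time N)"
text \<open>A pointwise upper bound for \<open>f\<close>. The mixing time is doubled in
  \<open>f\<close> so that hitting can be averaged by the free walk over one mixing time while the
  average is taken at the other. After multiplication by N^d both \<gamma> and the mean of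
  \<open>f\<close> tend to \<open>Cap K / 2\<close>, hence the non-negative \<gamma> - f is small in
  mean.\<close>

definition \<gamma> :: "nat \<Rightarrow> real" where "\<gamma> N = HB N * cell_avg N (hit (D N) (mix_time N))"

lemma double_mix_time_small: "(\<lambda>N. real (2 * mix_time N) / real N ^ CARD('d)) \<longlonglongrightarrow> 0"
  using tendsto_mult_right_zero[OF mix_time_small[OF d3], of 2] by simp

lemma double_mix_time_at_top: "filterlim (\<lambda>N. 2 * mix_time N) at_top sequentially"
  by (rule filterlim_at_top_mono[OF mix_time_at_top]) simp

lemma HB_tendsto: "(HB \<longlongrightarrow> 1) F"
  unfolding HB_def[abs_def] by (rule lim[OF heat_bound_mix_time])

lemma HB_nonneg: "0 \<le> HB N"
  by (simp add: HB_def heat_bound_def)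

lemma rate_tendsto: "((\<lambda>N. real N ^ CARD('d) * \<gamma> N) \<longlongrightarrow> Cap K / 2) F"
proof -
  have "((\<lambda>N. HB N * (real N ^ CARD('d) * cell_avg N (hit (D N) (mix_time N)))) \<longlongrightarrow> 1 * (Cap K / 2)) F"
    by (intro tendsto_mult HB_tendsto hit_rate_tendsto_Cap mix_time_small d3 mix_time_at_top)
  then show ?thesis by (simp add: \<gamma>_def mult_ac)
qed

lemma avg_f_tendsto: "((\<lambda>N. real N ^ CARD('d) * cell_avg N (f N)) \<longlongrightarrow> Cap K / 2) F"
  unfolding f_def by (intro hit_rate_tendsto_Cap double_mix_time_small double_mix_time_at_top)

lemma ev_good: "\<forall>\<^sub>F N in F. 0 < N \<and> separated N K \<and> 0 < mix_time N"
proof -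
  have "\<forall>\<^sub>F N in sequentially. 1 \<le> mix_time N" using mix_time_at_top by (simp add: filterlim_at_top)
  from ev_sep ev[OF this] show ?thesis by eventually_elim simp
qed

lemma f_nonneg: "0 \<le> f N y"
  by (simp add: f_def hit_nonneg)

lemma f_le:
  assumes "0 < N" "0 < mix_time N"
  shows "f N y \<le> \<gamma> N"
proof -
  have "f N y \<le> surv UNIV (mix_time N) (hit (D N) (mix_time N)) y"
    using hit_le_surv[of "D N" "mix_time N" "mix_time N" y] by (simp add: f_def mult_2)
  also have "\<dots> \<le> \<gamma> N"
    unfolding \<gamma>_def HB_def D_def by (rule surv_periodic_le) (use assms in \<open>auto simp: periodic_hit hit_nonneg\<close>)
  finally show ?thesis .
qed

lemma w_props: "0 \<le> w N y" "w N y \<le> 1" "y \<in> D N \<Longrightarrow> w N y = 0" "y \<notin> D N \<Longrightarrow> lazy_op (w N) y = w N y - f N y"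
  by (simp_all add: w_def f_def avoid_nonneg avoid_le_1 avoid_inside lazy_op_avoid)

lemma w_origin: "((\<lambda>N. w N 0) \<longlongrightarrow> 1) F"
  unfolding w_def by (rule avoid_origin_tendsto[OF double_mix_time_small double_mix_time_at_top])

lemma \<gamma>_nonneg:
  assumes "0 < N" "0 < mix_time N"
  shows "0 \<le> \<gamma> N"
  using f_le[OF assms, of 0] f_nonneg[of N 0] by linarith

lemma \<gamma>_tendsto: "(\<gamma> \<longlongrightarrow> 0) F"
proof -
  have "(\<lambda>N. 1 / real N ^ CARD('d)) \<longlonglongrightarrow> 0"
  proof -
    have "(\<lambda>N. (1 / real N) ^ CARD('d)) \<longlonglongrightarrow> 0 ^ CARD('d)" by (intro tendsto_power lim_1_over_n)
    moreover have "(0::real) ^ CARD('d) = 0" using d3 by simp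
    ultimately show ?thesis by (simp add: power_one_over)
  qed
  from tendsto_mult[OF rate_tendsto lim[OF this]]
  have "((\<lambda>N. real N ^ CARD('d) * \<gamma> N * (1 / real N ^ CARD('d))) \<longlongrightarrow> 0) F" by simp
  moreover have "\<forall>\<^sub>F N in F. real N ^ CARD('d) * \<gamma> N * (1 / real N ^ CARD('d)) = \<gamma> N"
    using ev_good by eventually_elim simp
  ultimately show ?thesis by (simp add: tendsto_cong)
qed

end

text \<open>The radius is a parameter because the estimates are needed both for the given box and
  for a slightly smaller one.\<close>

locale homog_box = homog K F a R g for K :: "(int ^ 'd) set" and F a R g +
  fixes l :: "nat \<Rightarrow> int" and A :: real
  assumes A: "0 < A" and hl: "((\<lambda>N. (real_of_int (l N))\<^sup>2 / real N ^ CARD('d)) \<longlongrightarrow> A) F"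
    and lpos: "\<forall>\<^sub>F N in F. 0 < l N"
begin

text \<open>A horizon longer by a factor N than the order l^2 of the exit time, so that survival has
  probability O(1/N) while all occupation sums remain finite sums.\<close>

definition n :: "nat \<Rightarrow> nat" where "n N = N * nat ((l N)\<^sup>2)"
definition U :: "nat \<Rightarrow> (int ^ 'd) set" where "U N = zbox (l N) - D N"
definition box_occ :: "nat \<Rightarrow> (int ^ 'd \<Rightarrow> real) \<Rightarrow> real" where "box_occ N \<phi> = occ (U N) (n N) \<phi> 0"

lemma ev_all: "\<forall>\<^sub>F N in F. 0 < N \<and> separated N K \<and> 0 < mix_time N \<and> 0 < l N"
  using ev_good lpos by eventually_elim simp

lemma box_occ_one_le: "0 < l N \<Longrightarrow> box_occ N (\<lambda>_. 1) \<le> 2 * real CARD('d) * (real_of_int (l N))\<^sup>2"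
  unfolding box_occ_def U_def by (rule occ_one_le) (simp add: czbox_def)

lemma box_occ_nonneg: "(\<And>y. y \<in> U N \<Longrightarrow> 0 \<le> \<phi> y) \<Longrightarrow> 0 \<le> box_occ N \<phi>"
  unfolding box_occ_def by (rule occ_nonneg)

lemma scale_tendsto: "(q \<longlongrightarrow> c) F \<Longrightarrow> ((\<lambda>N. q N / ((real_of_int (l N))\<^sup>2 / real N ^ CARD('d))) \<longlongrightarrow> c / A) F"
  using A by (intro tendsto_divide hl) auto

lemma mix_time_over_box: "((\<lambda>N. real (mix_time N) / (real_of_int (l N))\<^sup>2) \<longlongrightarrow> 0) F"
proof -
  have "((\<lambda>N. (real (mix_time N) / real N ^ CARD('d)) / ((real_of_int (l N))\<^sup>2 / real N ^ CARD('d))) \<longlongrightarrow> 0 / A) F"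
    by (rule scale_tendsto[OF lim[OF mix_time_small[OF d3]]])
  moreover have "\<forall>\<^sub>F N in F. (real (mix_time N) / real N ^ CARD('d)) / ((real_of_int (l N))\<^sup>2 / real N ^ CARD('d)) = real (mix_time N) / (real_of_int (l N))\<^sup>2"
    using ev_all by eventually_elim simp
  ultimately have "((\<lambda>N. real (mix_time N) / (real_of_int (l N))\<^sup>2) \<longlongrightarrow> 0 / A) F" by (rule Lim_transform_eventually)
  then show ?thesis by simp
qed

lemma \<gamma>_l: "((\<lambda>N. \<gamma> N * (real_of_int (l N))\<^sup>2) \<longlongrightarrow> A * Cap K / 2) F"
proof -
  have "((\<lambda>N. (real_of_int (l N))\<^sup>2 / real N ^ CARD('d) * (real N ^ CARD('d) * \<gamma> N)) \<longlongrightarrow> A * (Cap K / 2)) F"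
    by (intro tendsto_mult hl rate_tendsto)
  moreover have "\<forall>\<^sub>F N in F. (real_of_int (l N))\<^sup>2 / real N ^ CARD('d) * (real N ^ CARD('d) * \<gamma> N) = \<gamma> N * (real_of_int (l N))\<^sup>2"
    using ev_all by eventually_elim simp
  ultimately show ?thesis by (simp add: tendsto_cong)
qed

lemma box_occ_le_mixing:
  assumes "0 < N" "0 < mix_time N" "0 < l N" "periodic N \<phi>" "\<And>y. 0 \<le> \<phi> y" "\<And>y. \<phi> y \<le> c"
  shows "box_occ N \<phi> \<le> real (mix_time N) * c + HB N * cell_avg N \<phi> * (2 * real CARD('d) * (real_of_int (l N))\<^sup>2)"
proof -
  have h0: "0 \<le> HB N * cell_avg N \<phi>"
    unfolding cell_avg_def by (intro mult_nonneg_nonneg HB_nonneg divide_nonneg_nonneg sum_nonneg assms) simp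
  have "box_occ N \<phi> \<le> real (mix_time N) * c + HB N * cell_avg N \<phi> * box_occ N (\<lambda>_. 1)"
    unfolding box_occ_def by (rule occ_le_mixing) (use assms in \<open>auto simp: HB_def intro!: surv_periodic_le\<close>)
  also have "HB N * cell_avg N \<phi> * box_occ N (\<lambda>_. 1) \<le> HB N * cell_avg N \<phi> * (2 * real CARD('d) * (real_of_int (l N))\<^sup>2)"
    by (intro mult_left_mono box_occ_one_le assms h0)
  finally show ?thesis by simp
qed

text \<open>A uniform start meets the obstacles within the doubled mixing time with probability of
  order at most mix_time / N^d, up to a constant, and mixing transfers this to the walk in the
  box.\<close>

lemma occ_not_avoid_tendsto: "((\<lambda>N. box_occ N (\<lambda>y. 1 - w N y) / (real_of_int (l N))\<^sup>2) \<longlongrightarrow> 0) F"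
proof (rule tendsto_sandwich[of "\<lambda>_. 0"])
  let ?c = "\<lambda>N. (real (2 * mix_time N) / real N ^ CARD('d) + 1 / real N ^ CARD('d)) * real (card K)"
  have inv: "(\<lambda>N. 1 / real N ^ CARD('d)) \<longlonglongrightarrow> 0"
  proof -
    have "(\<lambda>N. (1 / real N) ^ CARD('d)) \<longlonglongrightarrow> 0 ^ CARD('d)" by (intro tendsto_power lim_1_over_n)
    moreover have "(0::real) ^ CARD('d) = 0" using d3 by simp
    ultimately show ?thesis by (simp add: power_one_over)
  qed
  have "((\<lambda>N. real (mix_time N) / (real_of_int (l N))\<^sup>2 + HB N * ?c N * (2 * real CARD('d))) \<longlongrightarrow> 0 + 1 * ((0 + 0) * real (card K)) * (2 * real CARD('d))) F"
    by (intro tendsto_add tendsto_mult mix_time_over_box HB_tendsto tendsto_const lim[OF double_mix_time_small] lim[OF inv])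
  then show "((\<lambda>N. real (mix_time N) / (real_of_int (l N))\<^sup>2 + HB N * ?c N * (2 * real CARD('d))) \<longlongrightarrow> 0) F" by simp
  show "\<forall>\<^sub>F N in F. box_occ N (\<lambda>y. 1 - w N y) / (real_of_int (l N))\<^sup>2 \<le> real (mix_time N) / (real_of_int (l N))\<^sup>2 + HB N * ?c N * (2 * real CARD('d))"
    using ev_all
  proof eventually_elim
    fix N assume N: "0 < N \<and> separated N K \<and> 0 < mix_time N \<and> 0 < l N"
    have per: "periodic N (\<lambda>y. 1 - w N y)" unfolding w_def D_def by (intro periodic_diff periodic_const periodic_avoid)
    have avg: "cell_avg N (\<lambda>y. 1 - w N y) \<le> ?c N"
    proof -
      have "cell_avg N (\<lambda>y. 1 - w N y) \<le> real (Suc (2 * mix_time N)) * real (card K) / real N ^ CARD('d)"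
        unfolding w_def D_def by (rule cell_avg_not_avoid) (use N in auto)
      also have "\<dots> = ?c N" by (simp add: add_divide_distrib distrib_right)
      finally show ?thesis .
    qed
    have "box_occ N (\<lambda>y. 1 - w N y) \<le> real (mix_time N) * 1 + HB N * cell_avg N (\<lambda>y. 1 - w N y) * (2 * real CARD('d) * (real_of_int (l N))\<^sup>2)"
      by (rule box_occ_le_mixing) (use N per w_props in auto)
    also have "\<dots> \<le> real (mix_time N) * 1 + HB N * ?c N * (2 * real CARD('d) * (real_of_int (l N))\<^sup>2)"
      by (intro add_left_mono mult_right_mono mult_left_mono avg HB_nonneg) auto
    finally have "box_occ N (\<lambda>y. 1 - w N y) / (real_of_int (l N))\<^sup>2 \<le>
        (real (mix_time N) * 1 + HB N * ?c N * (2 * real CARD('d) * (real_of_int (l N))\<^sup>2)) / (real_of_int (l N))\<^sup>2"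
      by (intro divide_right_mono) auto
    also have "\<dots> = real (mix_time N) / (real_of_int (l N))\<^sup>2 + HB N * ?c N * (2 * real CARD('d))"
      using N by (simp add: add_divide_distrib)
    finally show "box_occ N (\<lambda>y. 1 - w N y) / (real_of_int (l N))\<^sup>2 \<le> real (mix_time N) / (real_of_int (l N))\<^sup>2 + HB N * ?c N * (2 * real CARD('d))" .
  qed
  show "\<forall>\<^sub>F N in F. 0 \<le> box_occ N (\<lambda>y. 1 - w N y) / (real_of_int (l N))\<^sup>2"
    using w_props by (intro always_eventually allI divide_nonneg_nonneg box_occ_nonneg) auto
qed simp

text \<open>No division by l^2 occurs here: the mean of \<gamma> - f is o(N^(-d)), as the two rates
  have the same limit, and the walk spends O(l^2) = O(N^d) steps in the box.\<close>

lemma occ_rate_defect_tendsto: "((\<lambda>N. box_occ N (\<lambda>y. \<gamma> N - f N y)) \<longlongrightarrow> 0) F"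
proof (rule tendsto_sandwich[of "\<lambda>_. 0"])
  let ?b = "\<lambda>N. real (mix_time N) / real N ^ CARD('d) * (real N ^ CARD('d) * \<gamma> N) +
    HB N * (real N ^ CARD('d) * \<gamma> N - real N ^ CARD('d) * cell_avg N (f N)) * (2 * real CARD('d) * ((real_of_int (l N))\<^sup>2 / real N ^ CARD('d)))"
  have "(?b \<longlongrightarrow> 0 * (Cap K / 2) + 1 * (Cap K / 2 - Cap K / 2) * (2 * real CARD('d) * A)) F"
    by (intro tendsto_add tendsto_mult tendsto_diff rate_tendsto avg_f_tendsto HB_tendsto hl tendsto_const lim[OF mix_time_small[OF d3]])
  then show "(?b \<longlongrightarrow> 0) F" by simp
  show "\<forall>\<^sub>F N in F. box_occ N (\<lambda>y. \<gamma> N - f N y) \<le> ?b N"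
    using ev_all
  proof eventually_elim
    fix N assume N: "0 < N \<and> separated N K \<and> 0 < mix_time N \<and> 0 < l N"
    have per: "periodic N (\<lambda>y. \<gamma> N - f N y)" unfolding f_def D_def by (intro periodic_diff periodic_const periodic_hit)
    have "box_occ N (\<lambda>y. \<gamma> N - f N y) \<le> real (mix_time N) * \<gamma> N + HB N * cell_avg N (\<lambda>y. \<gamma> N - f N y) * (2 * real CARD('d) * (real_of_int (l N))\<^sup>2)"
      by (rule box_occ_le_mixing) (use N per f_le[of N] f_nonneg[of N] in auto)
    also have "cell_avg N (\<lambda>y. \<gamma> N - f N y) = \<gamma> N - cell_avg N (f N)"
      using N by (simp add: cell_avg_diff cell_avg_const)
    also have "real (mix_time N) * \<gamma> N + HB N * (\<gamma> N - cell_avg N (f N)) * (2 * real CARD('d) * (real_of_int (l N))\<^sup>2) = ?b N"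
      using N by (simp add: field_simps)
    finally show "box_occ N (\<lambda>y. \<gamma> N - f N y) \<le> ?b N" .
  qed
  show "\<forall>\<^sub>F N in F. 0 \<le> box_occ N (\<lambda>y. \<gamma> N - f N y)"
    using ev_all by eventually_elim (rule box_occ_nonneg, simp add: f_le)
qed simp

lemma occ_hit_tendsto: "((\<lambda>N. box_occ N (f N) / (real_of_int (l N))\<^sup>2) \<longlongrightarrow> 0) F"
proof (rule tendsto_sandwich[of "\<lambda>_. 0"])
  show "((\<lambda>N. \<gamma> N * (2 * real CARD('d))) \<longlongrightarrow> 0) F" using tendsto_mult_left_zero[OF \<gamma>_tendsto] .
  show "\<forall>\<^sub>F N in F. box_occ N (f N) / (real_of_int (l N))\<^sup>2 \<le> \<gamma> N * (2 * real CARD('d))"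
    using ev_all
  proof eventually_elim
    fix N assume N: "0 < N \<and> separated N K \<and> 0 < mix_time N \<and> 0 < l N"
    have "box_occ N (f N) \<le> box_occ N (\<lambda>_. \<gamma> N)" unfolding box_occ_def using N by (intro occ_mono f_le) auto
    also have "\<dots> = \<gamma> N * box_occ N (\<lambda>_. 1)" unfolding box_occ_def by (rule occ_const)
    also have "\<dots> \<le> \<gamma> N * (2 * real CARD('d) * (real_of_int (l N))\<^sup>2)"
      using N by (intro mult_left_mono box_occ_one_le \<gamma>_nonneg) auto
    finally show "box_occ N (f N) / (real_of_int (l N))\<^sup>2 \<le> \<gamma> N * (2 * real CARD('d))" using N by (simp add: field_simps)
  qed
  show "\<forall>\<^sub>F N in F. 0 \<le> box_occ N (f N) / (real_of_int (l N))\<^sup>2"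
    by (intro always_eventually allI divide_nonneg_nonneg box_occ_nonneg f_nonneg) auto
qed simp

lemma surv_le: "\<forall>\<^sub>F N in F. surv (U N) (n N) (\<lambda>_. 1) 0 \<le> 2 * real CARD('d) / real N"
  using ev_all
proof eventually_elim
  fix N assume N: "0 < N \<and> separated N K \<and> 0 < mix_time N \<and> 0 < l N"
  let ?l = "(real_of_int (l N))\<^sup>2"
  have l0: "0 < ?l" using N by simp
  have nn: "real (n N) = real N * ?l" by (simp add: n_def of_nat_nat)
  have "real (n N) * surv (U N) (n N) (\<lambda>_. 1) 0 \<le> 2 * real CARD('d) * ?l"
    using order_trans[OF surv_one_le_occ box_occ_one_le[unfolded box_occ_def]] N by blast
  then have "?l * (real N * surv (U N) (n N) (\<lambda>_. 1) 0) \<le> ?l * (2 * real CARD('d))" unfolding nn by (simp add: mult_ac)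
  then have "real N * surv (U N) (n N) (\<lambda>_. 1) 0 \<le> 2 * real CARD('d)" using l0 by (simp only: mult_le_cancel_left_pos)
  then show "surv (U N) (n N) (\<lambda>_. 1) 0 \<le> 2 * real CARD('d) / real N" using N by (simp add: field_simps)
qed

lemma surv_tendsto: "((\<lambda>N. surv (U N) (n N) (\<lambda>_. 1) 0) \<longlongrightarrow> 0) F"
proof (rule tendsto_sandwich[of "\<lambda>_. 0"])
  have "(\<lambda>N. 2 * real CARD('d) * (1 / real N)) \<longlonglongrightarrow> 2 * real CARD('d) * 0" by (intro tendsto_intros lim_1_over_n)
  then show "((\<lambda>N. 2 * real CARD('d) / real N) \<longlongrightarrow> 0) F" by (intro lim) simp
  show "\<forall>\<^sub>F N in F. 0 \<le> surv (U N) (n N) (\<lambda>_. 1) 0" by (intro always_eventually allI surv_nonneg) simp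
qed (use surv_le in auto)

lemma inverse_l: "filterlim (\<lambda>N. 1 / real_of_int (l N)) (at_right 0) F"
proof -
  have "filterlim (\<lambda>N. real N ^ CARD('d)) at_top sequentially"
    using d3 by (intro filterlim_pow_at_top filterlim_real_sequentially) simp
  then have Ninf: "filterlim (\<lambda>N. real N ^ CARD('d)) at_top F" by (rule filterlim_mono[OF _ order_refl Fle])
  have "filterlim (\<lambda>N. (real_of_int (l N))\<^sup>2 / real N ^ CARD('d) * real N ^ CARD('d)) at_top F"
    by (rule filterlim_tendsto_pos_mult_at_top[OF hl A Ninf])
  then have "filterlim (\<lambda>N. sqrt ((real_of_int (l N))\<^sup>2 / real N ^ CARD('d) * real N ^ CARD('d))) at_top F"
    by (rule filterlim_compose[OF sqrt_at_top])
  moreover have "\<forall>\<^sub>F N in F. sqrt ((real_of_int (l N))\<^sup>2 / real N ^ CARD('d) * real N ^ CARD('d)) = real_of_int (l N)"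
    using ev_all by eventually_elim simp
  ultimately have "filterlim (\<lambda>N. real_of_int (l N)) at_top F" by (simp add: filterlim_cong[OF refl refl])
  then have "filterlim (\<lambda>N. inverse (real_of_int (l N))) (at_right 0) F"
    by (rule filterlim_compose[OF filterlim_inverse_at_right_top])
  then show ?thesis by (simp add: inverse_eq_divide)
qed

lemma eig_rate_tendsto:
  fixes k :: "'d \<Rightarrow> nat"
  shows
  "((\<lambda>N. eig_rate (odd_freq k (l N)) * (real_of_int (l N))\<^sup>2) \<longlongrightarrow> (\<Sum>i\<in>UNIV. ((2 * real (k i) + 1) * pi / 2)\<^sup>2) / (4 * real CARD('d))) F"
proof -
  have base: "((\<lambda>h. (1 - cos (c * h)) / h\<^sup>2) \<longlongrightarrow> c\<^sup>2 / 2) (at_right 0)" for c :: real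
  proof -
    have "((\<lambda>h. (1 - cos (c * h)) / h\<^sup>2) \<longlongrightarrow> c * c / 2) (at_right 0)" by real_asymp
    then show ?thesis by (simp add: power2_eq_square)
  qed
  have each: "((\<lambda>N. (1 - cos (odd_freq k (l N) i)) * (real_of_int (l N))\<^sup>2) \<longlongrightarrow> ((2 * real (k i) + 1) * pi / 2)\<^sup>2 / 2) F" for i
  proof -
    have "((\<lambda>N. (1 - cos ((2 * real (k i) + 1) * pi / 2 * (1 / real_of_int (l N)))) / (1 / real_of_int (l N))\<^sup>2) \<longlongrightarrow> ((2 * real (k i) + 1) * pi / 2)\<^sup>2 / 2) F"
      by (rule filterlim_compose[OF base inverse_l])
    moreover have "(1 - cos (C * (1 / L))) / (1 / L)\<^sup>2 = (1 - cos (C / L)) * L\<^sup>2" for C L :: real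
      by (simp add: power_one_over)
    ultimately show ?thesis by (simp only: odd_freq_def)
  qed
  have "((\<lambda>N. (\<Sum>i\<in>UNIV. (1 - cos (odd_freq k (l N) i)) * (real_of_int (l N))\<^sup>2) / (2 * real CARD('d))) \<longlongrightarrow>
      (\<Sum>i\<in>UNIV. ((2 * real (k i) + 1) * pi / 2)\<^sup>2 / 2) / (2 * real CARD('d))) F"
    by (intro tendsto_divide tendsto_sum each tendsto_const) simp
  then show ?thesis
    by (simp add: eig_rate_def sum_distrib_right[symmetric] sum_divide_distrib[symmetric])
qed

text \<open>\<open>box_main\<close> with q = \<theta> L and \<eta> = \<theta>^2. The leading error
  is then at most \<kappa> \<theta> (1 + 2 d), which the choice of \<theta> makes equal to e / 2.
  For fixed \<theta> all remaining terms tend to zero, so \<theta> is chosen before N grows.\<close>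

lemma eig_defect_tendsto:
  "((\<lambda>N. w N 0 - (\<gamma> N + eig_rate (odd_freq k (l N))) * box_occ N (eig (odd_freq k (l N)))) \<longlongrightarrow> 0) F"
proof (rule tendsto_approx)
  fix e :: real assume e: "0 < e"
  define \<kappa> where "\<kappa> = (\<Sum>i\<in>UNIV. (2 * real (k i) + 1) * pi / 2)"
  have \<kappa>_ge: "(2 * real (k i) + 1) * pi / 2 \<le> \<kappa>" for i unfolding \<kappa>_def by (rule member_le_sum) auto
  have \<kappa>0: "0 < \<kappa>" using \<kappa>_ge[of undefined] by (rule less_le_trans[rotated]) simp
  define Q where "Q = 1 + 2 * real CARD('d)"
  have Q0: "0 < Q" by (simp add: Q_def)
  define \<theta> where "\<theta> = e / (2 * \<kappa> * Q)"
  have \<theta>0: "0 < \<theta>" using e \<kappa>0 Q0 by (simp add: \<theta>_def)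
  have "\<kappa> * \<theta> * Q = e / 2" using \<kappa>0 Q0 by (simp add: \<theta>_def)
  then have \<theta>e: "\<kappa> * \<theta> * (1 + 2 * real CARD('d)) = e / 2" by (simp only: Q_def)
  let ?v = "\<lambda>N. box_occ N (\<lambda>y. 1 - w N y) / (real_of_int (l N))\<^sup>2"
  let ?\<mu> = "\<lambda>N. eig_rate (odd_freq k (l N)) * (real_of_int (l N))\<^sup>2"
  let ?rest = "\<lambda>N. box_occ N (\<lambda>y. \<gamma> N - f N y) + ?\<mu> N * ?v N + \<kappa> / (8 * \<theta> ^ 3) * (2 * ?v N + box_occ N (f N) / (real_of_int (l N))\<^sup>2) + surv (U N) (n N) (\<lambda>_. 1) 0"
  have "(?rest \<longlongrightarrow> 0 + (\<Sum>i\<in>UNIV. ((2 * real (k i) + 1) * pi / 2)\<^sup>2) / (4 * real CARD('d)) * 0 + \<kappa> / (8 * \<theta> ^ 3) * (2 * 0 + 0) + 0) F"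
    by (intro tendsto_add tendsto_mult tendsto_const occ_rate_defect_tendsto occ_not_avoid_tendsto occ_hit_tendsto eig_rate_tendsto surv_tendsto)
  then have "(?rest \<longlongrightarrow> 0) F" by simp
  then have small: "\<forall>\<^sub>F N in F. ?rest N < e / 2" using e by (intro order_tendstoD(2)) auto
  show "\<exists>c. \<bar>c - 0\<bar> \<le> e \<and> (\<forall>\<^sub>F N in F. \<bar>w N 0 - (\<gamma> N + eig_rate (odd_freq k (l N))) * box_occ N (eig (odd_freq k (l N))) - c\<bar> \<le> e)"
  proof (intro exI[of _ 0] conjI)
    show "\<forall>\<^sub>F N in F. \<bar>w N 0 - (\<gamma> N + eig_rate (odd_freq k (l N))) * box_occ N (eig (odd_freq k (l N))) - 0\<bar> \<le> e"
      using small ev_all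
    proof eventually_elim
      fix N assume r: "?rest N < e / 2" and N: "0 < N \<and> separated N K \<and> 0 < mix_time N \<and> 0 < l N"
      define L where "L = real_of_int (l N)"
      have L0: "0 < L" using N by (simp add: L_def)
      define c where "c = odd_freq k (l N)"
      have \<delta>: "\<bar>c i\<bar> \<le> \<kappa> / L" for i
      proof -
        have eq: "c i = (2 * real (k i) + 1) * pi / 2 / L" by (simp add: c_def odd_freq_def L_def)
        have "0 \<le> (2 * real (k i) + 1) * pi / 2 / L" using L0 by simp
        moreover have "(2 * real (k i) + 1) * pi / 2 / L \<le> \<kappa> / L" using L0 by (intro divide_right_mono \<kappa>_ge) simp
        ultimately show ?thesis unfolding eq by linarith
      qed
      define V where "V = box_occ N (\<lambda>y. 1 - w N y)"
      define G where "G = box_occ N (f N)"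
      have main: "\<bar>w N 0 - (\<gamma> N + eig_rate c) * box_occ N (eig c)\<bar> \<le> box_occ N (\<lambda>y. \<gamma> N - f N y) + eig_rate c * V
          + \<kappa> / L * (\<theta> * L + (2 * \<theta>\<^sup>2 * box_occ N (\<lambda>_. 1) + (2 * V + G) / (4 * \<theta>\<^sup>2)) / (2 * (\<theta> * L))) + surv (U N) (n N) (\<lambda>_. 1) 0"
        unfolding box_occ_def U_def V_def G_def c_def
        by (rule box_main) (use N w_props f_nonneg[of N] f_le[of N] \<theta>0 L0 \<delta> in \<open>auto simp: c_def\<close>)
      have "\<kappa> / L * (\<theta> * L + (2 * \<theta>\<^sup>2 * box_occ N (\<lambda>_. 1) + (2 * V + G) / (4 * \<theta>\<^sup>2)) / (2 * (\<theta> * L))) =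
          \<kappa> * \<theta> + \<kappa> * \<theta> * (box_occ N (\<lambda>_. 1) / L\<^sup>2) + \<kappa> / (8 * \<theta> ^ 3) * (2 * (V / L\<^sup>2) + G / L\<^sup>2)"
      proof -
        have "\<kappa> / L * (\<theta> * L) = \<kappa> * \<theta>" using L0 by simp
        moreover have "\<kappa> / L * (2 * \<theta>\<^sup>2 * O1 / (2 * (\<theta> * L))) = \<kappa> * \<theta> * (O1 / L\<^sup>2)" for O1
          using L0 \<theta>0 by (simp add: power2_eq_square)
        moreover have "\<kappa> / L * (Y / (4 * \<theta>\<^sup>2) / (2 * (\<theta> * L))) = \<kappa> / (8 * \<theta> ^ 3) * (Y / L\<^sup>2)" for Y
          using L0 \<theta>0 by (simp add: power2_eq_square power3_eq_cube)
        ultimately show ?thesis by (simp only: distrib_left add_divide_distrib)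
      qed
      moreover have "\<kappa> * \<theta> * (box_occ N (\<lambda>_. 1) / L\<^sup>2) \<le> \<kappa> * \<theta> * (2 * real CARD('d))"
        using box_occ_one_le[of N] N L0 \<kappa>0 \<theta>0 by (intro mult_left_mono) (auto simp: L_def field_simps)
      moreover have "\<kappa> * \<theta> + \<kappa> * \<theta> * (2 * real CARD('d)) = e / 2" using \<theta>e by (simp add: distrib_left)
      moreover have "eig_rate c * V = eig_rate c * L\<^sup>2 * (V / L\<^sup>2)" using L0 by simp
      moreover have "box_occ N (\<lambda>y. \<gamma> N - f N y) + eig_rate c * L\<^sup>2 * (V / L\<^sup>2) + \<kappa> / (8 * \<theta> ^ 3) * (2 * (V / L\<^sup>2) + G / L\<^sup>2)
          + surv (U N) (n N) (\<lambda>_. 1) 0 < e / 2"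
        using r unfolding c_def V_def G_def L_def .
      moreover have "X \<le> e" if "X \<le> P + S + T + Z" "T = t1 + t2 + t3" "t2 \<le> t2'" "t1 + t2' = e / 2" "S = S'" "P + S' + t3 + Z < e / 2"
        for X P S T Z t1 t2 t3 t2' S' using that by linarith
      ultimately have "\<bar>w N 0 - (\<gamma> N + eig_rate c) * box_occ N (eig c)\<bar> \<le> e" using main by blast
      then show "\<bar>w N 0 - (\<gamma> N + eig_rate (odd_freq k (l N))) * box_occ N (eig (odd_freq k (l N))) - 0\<bar> \<le> e"
        unfolding c_def by simp
    qed
  qed (use e in simp)
qed

text \<open>The relation of \<open>eig_defect_tendsto\<close>, solved for the occupation sum; both
  rates are of the form constant times l^(-2) in the limit.\<close>

lemma eig_occ_tendsto:
  "((\<lambda>N. box_occ N (eig (odd_freq k (l N))) / (real_of_int (l N))\<^sup>2) \<longlongrightarrow>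
     1 / (A * Cap K / 2 + (\<Sum>i\<in>UNIV. ((2 * real (k i) + 1) * pi / 2)\<^sup>2) / (4 * real CARD('d)))) F"
proof -
  let ?s = "(\<Sum>i\<in>UNIV. ((2 * real (k i) + 1) * pi / 2)\<^sup>2) / (4 * real CARD('d))"
  let ?den = "\<lambda>N. \<gamma> N * (real_of_int (l N))\<^sup>2 + eig_rate (odd_freq k (l N)) * (real_of_int (l N))\<^sup>2"
  let ?X = "\<lambda>N. w N 0 - (\<gamma> N + eig_rate (odd_freq k (l N))) * box_occ N (eig (odd_freq k (l N)))"
  have spos: "0 < ?s" by (intro divide_pos_pos sum_pos) (auto simp: zero_less_power)
  have "0 \<le> A * Cap K / 2" using A Cap_nonneg[of K] by simp
  then have pos: "0 < A * Cap K / 2 + ?s" using spos by linarith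
  have den: "(?den \<longlongrightarrow> A * Cap K / 2 + ?s) F" by (intro tendsto_add \<gamma>_l eig_rate_tendsto)
  have "((\<lambda>N. (w N 0 - ?X N) / ?den N) \<longlongrightarrow> (1 - 0) / (A * Cap K / 2 + ?s)) F"
    using pos by (intro tendsto_divide tendsto_diff w_origin eig_defect_tendsto den) auto
  moreover have "\<forall>\<^sub>F N in F. (w N 0 - ?X N) / ?den N = box_occ N (eig (odd_freq k (l N))) / (real_of_int (l N))\<^sup>2"
    using order_tendstoD(1)[OF den pos] ev_all
  proof eventually_elim
    fix N assume d: "0 < ?den N" and N: "0 < N \<and> separated N K \<and> 0 < mix_time N \<and> 0 < l N"
    have "?den N = (\<gamma> N + eig_rate (odd_freq k (l N))) * (real_of_int (l N))\<^sup>2" by (simp add: distrib_right)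
    then show "(w N 0 - ?X N) / ?den N = box_occ N (eig (odd_freq k (l N))) / (real_of_int (l N))\<^sup>2"
      using d N by auto
  qed
  ultimately show ?thesis by (simp add: tendsto_cong)
qed

end

section \<open>Comparison with the escape probability\<close>

lemma lazy_op_excess_le:
  fixes x :: "int ^ 'd"
  assumes "0 \<le> l"
  shows "lazy_op (\<lambda>x. \<Sum>i\<in>UNIV. excess l (x $ i)) x \<le> (\<Sum>i\<in>UNIV. excess l (x $ i)) + 1 / 2"
proof -
  have "lazy_op (\<lambda>x. excess l (x $ i)) x \<le> excess l (x $ i) + 2 / (4 * real CARD('d))" for i
    unfolding lazy_op_coord[of "excess l"] using excess_second_difference(2)[OF assms, of "x $ i"]
    by (intro add_left_mono divide_right_mono) auto
  then have "(\<Sum>i\<in>UNIV. lazy_op (\<lambda>x. excess l (x $ i)) x) \<le> (\<Sum>i\<in>(UNIV::'d set). excess l (x $ i) + 2 / (4 * real CARD('d)))"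
    by (intro sum_mono)
  then show ?thesis by (simp add: lazy_op_sum sum.distrib)
qed

text \<open>A Chebyshev bound by induction on the number of steps: the total excess divided by r^2
  is at least one outside the large box and rises by at most 1 / (2 r^2) per step on average. A walk
  that escapes without leaving the large box in \<open>n\<close> steps has avoided \<open>D\<close>
  for these steps.\<close>

lemma escape_le_avoid:
  fixes x :: "int ^ 'd"
  assumes l: "0 \<le> l" and r: "0 < r" "real_of_int l + r \<le> real_of_int L"
  shows "escape L D x \<le> avoid D n x + ((\<Sum>i\<in>UNIV. excess l (x $ i)) + real n / 2) / r\<^sup>2"
proof -
  let ?\<zeta> = "\<lambda>x::int ^ 'd. \<Sum>i\<in>UNIV. excess l (x $ i)"
  have \<zeta>0: "0 \<le> ?\<zeta> x" for x by (intro sum_nonneg) (simp add: excess_def)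
  have outside: "1 \<le> ?\<zeta> x / r\<^sup>2" if x: "x \<notin> zbox L" for x
  proof -
    obtain i where "\<not> (- L < x $ i \<and> x $ i < L)" using x by (auto simp: zbox_def)
    then have "L \<le> \<bar>x $ i\<bar>" by linarith
    then have "r \<le> real_of_int (max 0 (\<bar>x $ i\<bar> - l))" using r by linarith
    then have "r\<^sup>2 \<le> excess l (x $ i)" unfolding excess_def using r by (intro power_mono) auto
    also have "\<dots> \<le> ?\<zeta> x" by (rule member_le_sum) (auto simp: excess_def)
    finally show ?thesis using r by (simp add: field_simps)
  qed
  show ?thesis
  proof (induction n arbitrary: x)
    case 0
    show ?case
    proof (cases "x \<in> zbox L")
      case True
      have "0 \<le> ?\<zeta> x / r\<^sup>2" using \<zeta>0[of x] by simp
      then show ?thesis using True escape_bounds(2)[of L D x] escape_step[of L D x] by (auto simp: avoid_0)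
    next
      case False
      then show ?thesis using outside[OF False] escape_bounds(2)[of L D x] avoid_nonneg[of D 0 x] by simp
    qed
  next
    case (Suc n)
    have nn: "0 \<le> real (Suc n) / 2 / r\<^sup>2" by simp
    have split: "(?\<zeta> x + real k / 2) / r\<^sup>2 = ?\<zeta> x / r\<^sup>2 + real k / 2 / r\<^sup>2" for x k by (rule add_divide_distrib)
    consider "x \<notin> zbox L" | "x \<in> zbox L" "x \<in> D" | "x \<in> zbox L" "x \<notin> D" by blast
    then show ?case
    proof cases
      case 1
      then show ?thesis
        using outside[OF 1] escape_bounds(2)[of L D x] avoid_nonneg[of D "Suc n" x] nn unfolding split by linarith
    next
      case 2
      have "0 \<le> ?\<zeta> x / r\<^sup>2" using \<zeta>0[of x] by simp
      then show ?thesis using 2 escape_step[of L D x] avoid_nonneg[of D "Suc n" x] nn unfolding split by simp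
    next
      case 3
      have "escape L D x = lazy_op (escape L D) x" using 3 escape_step[of L D x] by simp
      also have "\<dots> \<le> lazy_op (\<lambda>y. avoid D n y + (1 / r\<^sup>2 * ?\<zeta> y + real n / 2 / r\<^sup>2)) x"
      proof (rule lazy_op_mono)
        fix y
        show "escape L D y \<le> avoid D n y + (1 / r\<^sup>2 * ?\<zeta> y + real n / 2 / r\<^sup>2)"
          using Suc[of y] unfolding split by simp
      qed
      also have "\<dots> = avoid D (Suc n) x + (1 / r\<^sup>2 * lazy_op ?\<zeta> x + real n / 2 / r\<^sup>2)"
        using 3 by (simp only: lazy_op_add lazy_op_cmult lazy_op_const avoid_Suc if_False)
      also have "\<dots> \<le> avoid D (Suc n) x + (1 / r\<^sup>2 * (?\<zeta> x + 1 / 2) + real n / 2 / r\<^sup>2)"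
        by (intro add_left_mono add_right_mono mult_left_mono lazy_op_excess_le l) simp
      also have "1 / r\<^sup>2 * (?\<zeta> x + 1 / 2) + real n / 2 / r\<^sup>2 = (?\<zeta> x + real (Suc n) / 2) / r\<^sup>2"
        by (simp add: add_divide_distrib)
      finally show ?thesis .
    qed
  qed
qed

context homog_box
begin

text \<open>The difference of \<open>w\<close> and the escape probability has drift
  \<open>- f\<close> in \<open>U\<close>. It is at most zero elsewhere: on the obstacles
  \<open>w\<close> vanishes, and outside the box the escape probability is one.\<close>

lemma escape_lower:
  "\<forall>\<^sub>F N in F. w N 0 - \<gamma> N * box_occ N (\<lambda>_. 1) - surv (U N) (n N) (\<lambda>_. 1) 0 \<le> escape (l N) (D N) 0"
  using ev_all
proof eventually_elim
  fix N assume N: "0 < N \<and> separated N K \<and> 0 < mix_time N \<and> 0 < l N"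
  let ?h = "escape (l N) (D N)"
  have "w N 0 - ?h 0 \<le> occ (U N) (n N) (f N) 0 + surv (U N) (n N) (\<lambda>_. 1) 0"
  proof (rule subsolution_le_occ[of "U N" "czbox (l N)"])
    show "nbr_closed (U N) (czbox (l N))" unfolding U_def by (rule nbr_closed_zbox)
    show "0 \<in> czbox (l N)" using N by (simp add: czbox_def)
    show "w N y - ?h y \<le> 0" if "y \<notin> U N" for y
    proof (cases "y \<in> zbox (l N)")
      case True
      then have "y \<in> D N" using that by (simp add: U_def)
      then show ?thesis using escape_bounds(1)[of "l N" "D N" y] by (simp add: w_props)
    next
      case False
      then show ?thesis using escape_step[of "l N" "D N" y] w_props(2)[of N y] by simp
    qed
    show "w N y - ?h y \<le> 1" for y using w_props(2)[of N y] escape_bounds(1)[of "l N" "D N" y] by linarith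
    show "w N y - ?h y \<le> lazy_op (\<lambda>y. w N y - ?h y) y + f N y" if "y \<in> U N" for y
      using that w_props(4)[of y N] escape_step[of "l N" "D N" y] by (simp add: U_def lazy_op_diff)
  qed
  moreover have "occ (U N) (n N) (f N) 0 \<le> \<gamma> N * box_occ N (\<lambda>_. 1)"
  proof -
    have "occ (U N) (n N) (f N) 0 \<le> occ (U N) (n N) (\<lambda>_. \<gamma> N) 0" using N by (intro occ_mono f_le) auto
    then show ?thesis unfolding box_occ_def occ_const[of _ _ "\<gamma> N"] .
  qed
  ultimately show "w N 0 - \<gamma> N * box_occ N (\<lambda>_. 1) - surv (U N) (n N) (\<lambda>_. 1) 0 \<le> ?h 0" by linarith
qed

text \<open>The exit point of the box could lie near an obstacle, where w is small. Therefore the walk is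
  stopped at a smaller box: from there it typically mixes before it reaches the boundary of the large
  one, so that the escape probability is at most w plus a small error.\<close>

lemma escape_upper:
  assumes L: "\<And>N. L N = l N + int (N * quarter_root N)"
  shows "\<forall>\<^sub>F N in F. escape (L N) (D N) 0 \<le>
    w N 0 + 1 / real (quarter_root N) - (\<gamma> N * box_occ N (\<lambda>_. 1) - box_occ N (\<lambda>y. \<gamma> N - f N y)) + surv (U N) (n N) (\<lambda>_. 1) 0"
  using ev_all
proof eventually_elim
  fix N assume N: "0 < N \<and> separated N K \<and> 0 < mix_time N \<and> 0 < l N"
  let ?h = "escape (L N) (D N)"
  have b0: "0 < quarter_root N" using N by (simp add: mix_time_def)
  let ?r = "real (N * quarter_root N)"
  have r: "0 < ?r" "real_of_int (l N) + ?r \<le> real_of_int (L N)" using N b0 by (auto simp: L)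
  have hw: "?h y - w N y - 1 / real (quarter_root N) \<le> 0" if "y \<in> czbox (l N)" for y
  proof -
    have "excess (l N) (y $ i) = 0" for i
    proof -
      have "\<bar>y $ i\<bar> \<le> l N" using that[unfolded czbox_def, simplified, rule_format, of i] by linarith
      then show ?thesis by (simp add: excess_def)
    qed
    then have "?h y \<le> w N y + (real (2 * mix_time N) / 2) / ?r\<^sup>2"
      using escape_le_avoid[OF _ r, of "D N" y "2 * mix_time N"] N by (simp add: w_def)
    \<comment> \<open>The margin N q is chosen against the mixing time N^2 q so that this ratio is
      only 1 / q.\<close>
    also have "(real (2 * mix_time N) / 2) / ?r\<^sup>2 = 1 / real (quarter_root N)"
      using N b0 by (simp add: mix_time_def power2_eq_square)
    finally show ?thesis by simp
  qed
  have sub: "czbox (l N) \<subseteq> (zbox (L N) :: (int ^ 'd) set)"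
  proof
    fix y :: "int ^ 'd" assume "y \<in> czbox (l N)"
    moreover have "l N < L N" using N b0 by (simp add: L)
    ultimately have "- L N < y $ i \<and> y $ i < L N" for i
      using \<open>y \<in> czbox (l N)\<close>[unfolded czbox_def, simplified, rule_format, of i] by linarith
    then show "y \<in> zbox (L N)" by (simp add: zbox_def)
  qed
  have "?h 0 - w N 0 - 1 / real (quarter_root N) \<le> occ (U N) (n N) (\<lambda>y. - f N y) 0 + surv (U N) (n N) (\<lambda>_. 1) 0"
  proof (rule subsolution_le_occ[of "U N" "czbox (l N)" "\<lambda>y. ?h y - w N y - 1 / real (quarter_root N)"])
    show cl: "nbr_closed (U N) (czbox (l N))" unfolding U_def by (rule nbr_closed_zbox)
    show "0 \<in> czbox (l N)" using N by (simp add: czbox_def)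
    show "?h y - w N y - 1 / real (quarter_root N) \<le> 0" if "y \<in> czbox (l N)" for y by (rule hw[OF that])
    have UC: "y \<in> czbox (l N)" if "y \<in> U N" for y using cl that by (auto simp: nbr_closed_def)
    show "?h y - w N y - 1 / real (quarter_root N) \<le> 1" if "y \<in> U N" for y using hw[OF UC[OF that]] by linarith
    show "?h y - w N y - 1 / real (quarter_root N) \<le> lazy_op (\<lambda>y. ?h y - w N y - 1 / real (quarter_root N)) y + - f N y" if "y \<in> U N" for y
    proof -
      have "y \<in> zbox (L N)" "y \<notin> D N" using UC[OF that] sub that by (auto simp: U_def)
      then have "?h y = lazy_op ?h y" "lazy_op (w N) y = w N y - f N y"
        using escape_step[of "L N" "D N" y] w_props(4)[of y N] by auto
      then show ?thesis by (simp add: lazy_op_diff)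
    qed
  qed
  moreover have "occ (U N) (n N) (\<lambda>y. - f N y) 0 = - (\<gamma> N * box_occ N (\<lambda>_. 1) - box_occ N (\<lambda>y. \<gamma> N - f N y))"
    unfolding box_occ_def occ_diff occ_minus occ_const[of _ _ "\<gamma> N"] by simp
  ultimately show "?h 0 \<le> w N 0 + 1 / real (quarter_root N) - (\<gamma> N * box_occ N (\<lambda>_. 1) - box_occ N (\<lambda>y. \<gamma> N - f N y)) + surv (U N) (n N) (\<lambda>_. 1) 0"
    by linarith
qed

definition poly :: "nat \<Rightarrow> nat \<Rightarrow> int ^ 'd \<Rightarrow> real" where
  "poly j N x = (\<Prod>i\<in>UNIV. qpoly j (pi / 2 * (real_of_int (x $ i) / real_of_int (l N))))"

text \<open>Outside a layer of relative width \<open>dl\<close> along the faces, each factor is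
  within \<open>\<zeta> j\<close> of 1. In the layer the error is at most one, and the walk spends
  there a time of order \<open>dl\<close>^2 l^2 only. Both bounds are uniform in N, and so is
  \<open>j0\<close>.\<close>

lemma poly_close:
  assumes e: "0 < e"
  shows "\<exists>j0. \<forall>j\<ge>j0. \<forall>\<^sub>F N in F. \<bar>box_occ N (\<lambda>_. 1) - box_occ N (poly j N)\<bar> \<le> e * (real_of_int (l N))\<^sup>2"
proof -
  define d where "d = real CARD('d)"
  have d1: "1 \<le> d" using d3 by (simp add: d_def)
  \<comment> \<open>The layers contribute 4 d^2 \<open>dl\<close>^2, which is at most 4 d^2
    \<open>dl\<close>; this gives the constant e / (8 d^2).\<close>
  define dl where "dl = min (1 / 2) (e / (8 * d\<^sup>2))"
  have dl: "0 < dl" "dl \<le> 1 / 2" "dl \<le> e / (8 * d\<^sup>2)" using e d1 by (auto simp: dl_def)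
  have dl2: "4 * d\<^sup>2 * dl\<^sup>2 \<le> e / 2"
  proof -
    have "dl\<^sup>2 \<le> dl * 1" unfolding power2_eq_square using dl by (intro mult_left_mono) auto
    then have "4 * d\<^sup>2 * dl\<^sup>2 \<le> 4 * d\<^sup>2 * (e / (8 * d\<^sup>2))" using dl by (intro mult_left_mono) auto
    also have "\<dots> = e / 2" using d1 by simp
    finally show ?thesis .
  qed
  define \<theta>0 where "\<theta>0 = pi / 2 * (1 - dl)"
  have \<theta>0: "0 \<le> \<theta>0" "\<theta>0 < pi / 2" using dl by (auto simp: \<theta>0_def)
  have c0: "0 < cos \<theta>0" using \<theta>0 by (intro cos_gt_zero_pi) auto
  define \<zeta> where "\<zeta> j = (1 - qpoly j \<theta>0) / cos \<theta>0" for j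
  have \<zeta>0: "0 \<le> \<zeta> j" for j using qpoly_le_1[of \<theta>0 j] c0 by (simp add: \<zeta>_def)
  have "(\<lambda>j. 2 * d\<^sup>2 * \<zeta> j) \<longlonglongrightarrow> 2 * d\<^sup>2 * ((1 - 1) / cos \<theta>0)"
    unfolding \<zeta>_def using c0 by (intro tendsto_intros qpoly_tendsto) auto
  then have "\<forall>\<^sub>F j in sequentially. 2 * d\<^sup>2 * \<zeta> j < e / 2" using e by (intro order_tendstoD(2)) auto
  then obtain j0 where j0: "\<And>j. j \<ge> j0 \<Longrightarrow> 2 * d\<^sup>2 * \<zeta> j < e / 2" by (auto simp: eventually_sequentially)
  show ?thesis
  proof (intro exI allI impI)
    fix j assume j: "j0 \<le> j"
    show "\<forall>\<^sub>F N in F. \<bar>box_occ N (\<lambda>_. 1) - box_occ N (poly j N)\<bar> \<le> e * (real_of_int (l N))\<^sup>2"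
      using lpos
    proof eventually_elim
      fix N assume N: "0 < l N"
      define L where "L = real_of_int (l N)"
      have L0: "0 < L" using N by (simp add: L_def)
      \<comment> \<open>Rounding up keeps the layer no wider than \<open>dl * L\<close>.\<close>
      define k0 where "k0 = \<lceil>(1 - dl) * L\<rceil>"
      have k0: "0 \<le> k0" "k0 \<le> l N" "real_of_int (l N - k0) \<le> dl * L"
      proof -
        have "0 \<le> (1 - dl) * L" using dl L0 by simp
        then show "0 \<le> k0" unfolding k0_def by linarith
        have "(1 - dl) * L \<le> 1 * L" using dl L0 by (intro mult_right_mono) auto
        then show "k0 \<le> l N" unfolding k0_def L_def by (simp add: ceiling_le_iff)
        have "(1 - dl) * L \<le> real_of_int k0" unfolding k0_def by (rule le_of_int_ceiling)
        then show "real_of_int (l N - k0) \<le> dl * L" by (simp add: L_def algebra_simps)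
      qed
      let ?q = "\<lambda>x i. qpoly j (pi / 2 * (real_of_int (x $ i) / L))"
      let ?lay = "\<lambda>i (x::int ^ 'd). if k0 \<le> \<bar>x $ i\<bar> then 1 else 0 :: real"
      have pt: "0 \<le> 1 - poly j N x \<and> 1 - poly j N x \<le> (\<Sum>i\<in>UNIV. \<zeta> j * 1 + ?lay i x)" if x: "x \<in> U N" for x
      proof -
        have u: "\<bar>real_of_int (x $ i) / L\<bar> < 1" for i
        proof -
          have "\<bar>x $ i\<bar> < l N" using x by (simp add: U_def zbox_def abs_less_iff minus_less_iff)
          then have "\<bar>real_of_int (x $ i)\<bar> < L" unfolding L_def by linarith
          then show ?thesis using L0 by (simp add: abs_divide)
        qed
        have pos: "0 < cos (pi / 2 * (real_of_int (x $ i) / L))" for i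
        proof (rule cos_gt_zero_pi)
          have "- 1 < real_of_int (x $ i) / L" "real_of_int (x $ i) / L < 1" using u[of i] by linarith+
          then have "pi / 2 * (-1) < pi / 2 * (real_of_int (x $ i) / L)" "pi / 2 * (real_of_int (x $ i) / L) < pi / 2 * 1"
            by (intro mult_strict_left_mono; simp)+
          then show "- (pi / 2) < pi / 2 * (real_of_int (x $ i) / L)" "pi / 2 * (real_of_int (x $ i) / L) < pi / 2" by simp_all
        qed
        have q01: "0 \<le> ?q x i" "?q x i \<le> 1" for i using pos[of i] by (auto intro: qpoly_nonneg qpoly_le_1)
        have each: "1 - ?q x i \<le> \<zeta> j * 1 + ?lay i x" for i
        proof (cases "k0 \<le> \<bar>x $ i\<bar>")
          case True
          then show ?thesis using q01[of i] \<zeta>0[of j] by simp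
        next
          case False
          then have "real_of_int \<bar>x $ i\<bar> < (1 - dl) * L" unfolding k0_def by (simp add: less_ceiling_iff not_le)
          then have "\<bar>real_of_int (x $ i) / L\<bar> \<le> 1 - dl" using L0 by (simp add: abs_divide field_simps)
          then have "\<bar>pi / 2 * (real_of_int (x $ i) / L)\<bar> \<le> \<theta>0"
            unfolding \<theta>0_def abs_mult using mult_left_mono[of "\<bar>real_of_int (x $ i) / L\<bar>" "1 - dl" "pi / 2"] by simp
          then have "cos \<theta>0 \<le> cos \<bar>pi / 2 * (real_of_int (x $ i) / L)\<bar>"
            using \<theta>0 by (intro cos_monotone_0_pi_le) auto
          then have "cos \<theta>0 \<le> cos (pi / 2 * (real_of_int (x $ i) / L))" by (simp only: cos_abs_real)
          from qpoly_uniform[OF c0 this, of j] show ?thesis using False by (simp add: \<zeta>_def)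
        qed
        have "poly j N x \<le> 1" unfolding poly_def L_def[symmetric] by (intro prod_le_1 conjI q01)
        moreover have "1 - poly j N x \<le> (\<Sum>i\<in>UNIV. 1 - ?q x i)"
          unfolding poly_def L_def[symmetric] by (rule one_minus_prod_le, simp, rule q01(1), rule q01(2))
        moreover have "\<dots> \<le> (\<Sum>i\<in>UNIV. \<zeta> j * 1 + ?lay i x)" by (intro sum_mono each)
        ultimately show ?thesis by linarith
      qed
      have diff: "box_occ N (\<lambda>_. 1) - box_occ N (poly j N) = box_occ N (\<lambda>x. 1 - poly j N x)" unfolding box_occ_def by (rule occ_diff[symmetric])
      have "0 \<le> box_occ N (\<lambda>x. 1 - poly j N x)" using pt by (intro box_occ_nonneg) auto
      moreover have "box_occ N (\<lambda>x. 1 - poly j N x) \<le> e * L\<^sup>2"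
      proof -
        have "box_occ N (\<lambda>x. 1 - poly j N x) \<le> box_occ N (\<lambda>x. \<Sum>i\<in>UNIV. \<zeta> j * 1 + ?lay i x)"
          unfolding box_occ_def using pt by (intro occ_mono) auto
        also have "\<dots> = (\<Sum>i\<in>(UNIV::'d set). \<zeta> j * box_occ N (\<lambda>_. 1) + box_occ N (?lay i))"
          unfolding box_occ_def by (simp only: occ_sum occ_add occ_cmult)
        also have "\<dots> \<le> (\<Sum>i\<in>(UNIV::'d set). \<zeta> j * (2 * d * L\<^sup>2) + 4 * d * (dl * L)\<^sup>2)"
        proof (intro sum_mono add_mono mult_left_mono \<zeta>0)
          show "box_occ N (\<lambda>_. 1) \<le> 2 * d * L\<^sup>2" using box_occ_one_le[OF N] by (simp add: d_def L_def)
          fix i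
          have "box_occ N (?lay i) \<le> 4 * d * (real_of_int (l N - k0))\<^sup>2"
            unfolding box_occ_def U_def d_def using N k0 by (intro occ_layer_le) (auto simp: czbox_def)
          also have "\<dots> \<le> 4 * d * (dl * L)\<^sup>2" using k0 d1 by (intro mult_left_mono power_mono) auto
          finally show "box_occ N (?lay i) \<le> 4 * d * (dl * L)\<^sup>2" .
        qed
        also have "\<dots> = (2 * d\<^sup>2 * \<zeta> j + 4 * d\<^sup>2 * dl\<^sup>2) * L\<^sup>2"
          by (simp add: d_def power2_eq_square algebra_simps)
        also have "\<dots> \<le> e * L\<^sup>2" using j0[OF j] dl2 by (intro mult_right_mono) auto
        finally show ?thesis .
      qed
      ultimately show "\<bar>box_occ N (\<lambda>_. 1) - box_occ N (poly j N)\<bar> \<le> e * (real_of_int (l N))\<^sup>2" unfolding diff L_def by simp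
    qed
  qed
qed

text \<open>The constant 1 is replaced by \<open>poly j\<close>, whose occupation sum combines those
  of eigenfunctions and has the limit \<open>I j\<close> after multiplication by \<gamma>. The
  replacement is harmless because \<gamma> l^2 stays bounded. Positive capacity makes
  \<open>c\<close> an admissible rate for the exponential time in
  \<open>laplace_exit\<close>.\<close>

theorem killed_rate_tendsto:
  fixes B :: "real \<Rightarrow> 'w \<Rightarrow> real ^ 'd"
  assumes BM: "std_BM M B" and Cap: "0 < Cap K"
  shows "((\<lambda>N. \<gamma> N * box_occ N (\<lambda>_. 1)) \<longlongrightarrow> 1 - (\<integral>\<omega>. exp (- (real CARD('d) * A * bm_exit B \<omega> * Cap K)) \<partial>M)) F"
proof (rule tendsto_approx)
  fix e :: real assume e: "0 < e"
  have "prob_space M" using BM unfolding std_BM_def by blast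
  then interpret BM: bm M B by (intro bm.intro bm_axioms.intro BM)
  define c where "c = real CARD('d) * A * Cap K"
  have c: "0 < c" using A Cap by (simp add: c_def)
  have "\<forall>j. \<exists>p. finite (fst p) \<and> (\<forall>u. (\<Prod>i\<in>UNIV. qpoly j (pi / 2 * u i)) =
      (\<Sum>k\<in>fst p. snd p k * (\<Prod>i\<in>(UNIV::'d set). cos ((2 * real (k i) + 1) * pi / 2 * u i))))"
  proof
    fix j
    obtain \<Lambda> :: "('d \<Rightarrow> nat) set" and b where "finite \<Lambda>"
      "\<And>u. (\<Prod>i\<in>UNIV. qpoly j (pi / 2 * u i)) = (\<Sum>k\<in>\<Lambda>. b k * (\<Prod>i\<in>UNIV. cos ((2 * real (k i) + 1) * pi / 2 * u i)))"
      by (rule prod_qpoly_expansion[where 'd = 'd, of j]) (rule that)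
    then show "\<exists>p. finite (fst p) \<and> (\<forall>u. (\<Prod>i\<in>UNIV. qpoly j (pi / 2 * u i)) =
      (\<Sum>k\<in>fst p. snd p k * (\<Prod>i\<in>(UNIV::'d set). cos ((2 * real (k i) + 1) * pi / 2 * u i))))"
      by (intro exI[of _ "(\<Lambda>, b)"]) (simp only: fst_conv snd_conv, blast)
  qed
  from choice[OF this] obtain p where p: "\<forall>j. finite (fst (p j)) \<and> (\<forall>u. (\<Prod>i\<in>UNIV. qpoly j (pi / 2 * u i)) =
      (\<Sum>k\<in>fst (p j). snd (p j) k * (\<Prod>i\<in>(UNIV::'d set). cos ((2 * real (k i) + 1) * pi / 2 * u i))))"
    by (rule exE)
  define \<Lambda> where "\<Lambda> j = fst (p j)" for j
  define b where "b j = snd (p j)" for j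
  have fin: "finite (\<Lambda> j)" for j using p unfolding \<Lambda>_def by blast
  have expn: "(\<Prod>i\<in>UNIV. qpoly j (pi / 2 * u i)) = (\<Sum>k\<in>\<Lambda> j. b j k * (\<Prod>i\<in>UNIV. cos ((2 * real (k i) + 1) * pi / 2 * u i)))" for j u
    using p unfolding \<Lambda>_def b_def by blast
  define S where "S k = (\<Sum>i\<in>UNIV. ((2 * real (k i) + 1) * pi / 2)\<^sup>2)" for k :: "'d \<Rightarrow> nat"
  define I where "I j = (\<Sum>k\<in>\<Lambda> j. b j k * (c / (c + S k / 2)))" for j
  let ?L = "1 - (\<integral>\<omega>. exp (- (real CARD('d) * A * bm_exit B \<omega> * Cap K)) \<partial>M)"
  have "I \<longlonglongrightarrow> 1 - (\<integral>\<omega>. exp (- (c * bm_exit B \<omega>)) \<partial>M)"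
    unfolding I_def[abs_def] S_def by (rule BM.laplace_exit[OF c fin expn])
  then have lap: "I \<longlonglongrightarrow> ?L" by (simp add: c_def mult_ac)
  have polylim: "((\<lambda>N. \<gamma> N * box_occ N (poly j N)) \<longlongrightarrow> I j) F" for j
  proof -
    have t1: "((\<lambda>N. \<Sum>k\<in>\<Lambda> j. b j k * (\<gamma> N * (real_of_int (l N))\<^sup>2 * (box_occ N (eig (odd_freq k (l N))) / (real_of_int (l N))\<^sup>2))) \<longlongrightarrow>
        (\<Sum>k\<in>\<Lambda> j. b j k * (A * Cap K / 2 * (1 / (A * Cap K / 2 + S k / (4 * real CARD('d))))))) F"
      unfolding S_def by (intro tendsto_sum tendsto_mult tendsto_const \<gamma>_l eig_occ_tendsto)
    \<comment> \<open>Multiplication by 2d passes from the walk, whose coordinates have variance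
      1/(2d) per step, to standard Brownian motion.\<close>
    have e1: "A * Cap K / 2 * (1 / (A * Cap K / 2 + S k / (4 * real CARD('d)))) = c / (c + S k / 2)" for k
    proof -
      have "0 \<le> S k" unfolding S_def by (intro sum_nonneg) simp
      moreover have "0 < A * Cap K" using A Cap by simp
      ultimately have "0 < A * Cap K / 2 + S k / (4 * real CARD('d))"
        by (intro add_pos_nonneg) auto
      moreover have "c = 2 * real CARD('d) * (A * Cap K / 2)" "S k / 2 = 2 * real CARD('d) * (S k / (4 * real CARD('d)))"
        by (simp_all add: c_def)
      then have "c / (c + S k / 2) = (2 * real CARD('d) * (A * Cap K / 2)) / (2 * real CARD('d) * (A * Cap K / 2 + S k / (4 * real CARD('d))))"
        by (simp only: distrib_left)
      ultimately show ?thesis by simp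
    qed
    have ev1: "\<forall>\<^sub>F N in F. (\<Sum>k\<in>\<Lambda> j. b j k * (\<gamma> N * (real_of_int (l N))\<^sup>2 * (box_occ N (eig (odd_freq k (l N))) / (real_of_int (l N))\<^sup>2))) = \<gamma> N * box_occ N (poly j N)"
      using lpos
    proof eventually_elim
      fix N assume N: "0 < l N"
      have "poly j N = (\<lambda>x. \<Sum>k\<in>\<Lambda> j. b j k * eig (odd_freq k (l N)) x)"
        unfolding poly_def[abs_def] expn eig_def odd_freq_def by (simp add: mult_ac)
      then have "box_occ N (poly j N) = (\<Sum>k\<in>\<Lambda> j. b j k * box_occ N (eig (odd_freq k (l N))))"
        unfolding box_occ_def by (simp only: occ_sum occ_cmult)
      then show "(\<Sum>k\<in>\<Lambda> j. b j k * (\<gamma> N * (real_of_int (l N))\<^sup>2 * (box_occ N (eig (odd_freq k (l N))) / (real_of_int (l N))\<^sup>2))) = \<gamma> N * box_occ N (poly j N)"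
        using N by (simp add: sum_distrib_left mult_ac)
    qed
    show ?thesis unfolding I_def using Lim_transform_eventually[OF t1[unfolded e1] ev1] .
  qed
  define G where "G = A * Cap K / 2 + 1"
  have G: "0 < G" using A Cap by (simp add: G_def add_pos_pos)
  have evG: "\<forall>\<^sub>F N in F. \<gamma> N * (real_of_int (l N))\<^sup>2 < G" by (rule order_tendstoD(2)[OF \<gamma>_l]) (simp add: G_def)
  have "0 < e / (2 * G)" using e G by simp
  then obtain j0 where j0: "\<And>j. j \<ge> j0 \<Longrightarrow> \<forall>\<^sub>F N in F. \<bar>box_occ N (\<lambda>_. 1) - box_occ N (poly j N)\<bar> \<le> e / (2 * G) * (real_of_int (l N))\<^sup>2"
    using poly_close by blast
  have "\<forall>\<^sub>F j in sequentially. dist (I j) ?L < e" using lap e by (rule tendstoD)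
  then obtain j1 where j1: "\<And>j. j \<ge> j1 \<Longrightarrow> dist (I j) ?L < e" by (auto simp: eventually_sequentially)
  define j where "j = max j0 j1"
  have jj: "j0 \<le> j" by (simp add: j_def)
  show "\<exists>c. \<bar>c - ?L\<bar> \<le> e \<and> (\<forall>\<^sub>F N in F. \<bar>\<gamma> N * box_occ N (\<lambda>_. 1) - c\<bar> \<le> e)"
  proof (intro exI[of _ "I j"] conjI)
    show "\<bar>I j - ?L\<bar> \<le> e" using j1[of j] by (simp add: j_def dist_real_def)
    have "\<forall>\<^sub>F N in F. dist (\<gamma> N * box_occ N (poly j N)) (I j) < e / 2" using polylim e by (intro tendstoD) auto
    then show "\<forall>\<^sub>F N in F. \<bar>\<gamma> N * box_occ N (\<lambda>_. 1) - I j\<bar> \<le> e"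
      using evG j0[OF jj] ev_all
    proof eventually_elim
      case (elim N)
      have \<gamma>0: "0 \<le> \<gamma> N" using elim by (intro \<gamma>_nonneg) auto
      have "\<bar>\<gamma> N * (box_occ N (\<lambda>_. 1) - box_occ N (poly j N))\<bar> \<le> \<gamma> N * (e / (2 * G) * (real_of_int (l N))\<^sup>2)"
        unfolding abs_mult abs_of_nonneg[OF \<gamma>0] by (rule mult_left_mono[OF elim(3) \<gamma>0])
      also have "\<dots> = e / (2 * G) * (\<gamma> N * (real_of_int (l N))\<^sup>2)" by simp
      also have "\<dots> \<le> e / (2 * G) * G" using elim e G by (intro mult_left_mono) auto
      also have "\<dots> = e / 2" using G by simp
      finally have "\<bar>\<gamma> N * box_occ N (\<lambda>_. 1) - \<gamma> N * box_occ N (poly j N)\<bar> \<le> e / 2" by (simp add: right_diff_distrib)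
      moreover have "\<bar>\<gamma> N * box_occ N (poly j N) - I j\<bar> < e / 2" using elim by (simp add: dist_real_def)
      ultimately show ?case by linarith
    qed
  qed
qed

end

section \<open>The limit theorem\<close>

text \<open>The lengths are compared after division by sqrt (N^d), before squaring, since
  subtraction is linear there. The margin N q is negligible because (N q)^2 / N^3 = q^2 / N \<le> N
  powr (-1/2).\<close>

lemma inner_box_scaling:
  fixes m :: "nat \<Rightarrow> nat"
  assumes d: "3 \<le> d" and A: "0 < A" and L: "(\<lambda>N. (real (m N * N))\<^sup>2 / real N ^ d) \<longlonglongrightarrow> A"
  shows "(\<lambda>N. (real_of_int (int (m N * N) - int (N * quarter_root N)))\<^sup>2 / real N ^ d) \<longlonglongrightarrow> A"
    and "\<forall>\<^sub>F N in sequentially. 0 < int (m N * N) - int (N * quarter_root N)"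
proof -
  define X where "X N = real (m N * N) / sqrt (real N ^ d)" for N
  define Y where "Y N = real (N * quarter_root N) / sqrt (real N ^ d)" for N
  have X2: "(X N)\<^sup>2 = (real (m N * N))\<^sup>2 / real N ^ d" for N unfolding X_def power_divide by simp
  have "(\<lambda>N. sqrt ((X N)\<^sup>2)) \<longlonglongrightarrow> sqrt A" unfolding X2 by (intro tendsto_real_sqrt L)
  moreover have "sqrt ((X N)\<^sup>2) = X N" for N by (simp add: X_def)
  ultimately have X: "X \<longlonglongrightarrow> sqrt A" by (simp only:)
  have "(\<lambda>N. (Y N)\<^sup>2) \<longlonglongrightarrow> 0"
  proof (rule tendsto_sandwich[of "\<lambda>_. 0"])
    show "(\<lambda>N. (real N powr (1 / 4))\<^sup>2 / real N) \<longlonglongrightarrow> 0" by real_asymp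
    show "\<forall>\<^sub>F N in sequentially. (Y N)\<^sup>2 \<le> (real N powr (1 / 4))\<^sup>2 / real N"
      using eventually_gt_at_top[of 0]
    proof eventually_elim
      fix N :: nat assume N: "0 < N"
      have "real N ^ 3 \<le> real N ^ d" using N d by (intro power_increasing) auto
      have "(Y N)\<^sup>2 = (real (N * quarter_root N))\<^sup>2 / real N ^ d" unfolding Y_def power_divide by simp
      also have "\<dots> \<le> (real (N * quarter_root N))\<^sup>2 / real N ^ 3"
        using N \<open>real N ^ 3 \<le> real N ^ d\<close> by (intro divide_left_mono) auto
      also have "\<dots> = (real (quarter_root N))\<^sup>2 / real N" using N by (simp add: power2_eq_square power3_eq_cube)
      also have "\<dots> \<le> (real N powr (1 / 4))\<^sup>2 / real N" by (intro divide_right_mono power_mono quarter_root_bounds) auto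
      finally show "(Y N)\<^sup>2 \<le> (real N powr (1 / 4))\<^sup>2 / real N" .
    qed
  qed auto
  then have "(\<lambda>N. sqrt ((Y N)\<^sup>2)) \<longlonglongrightarrow> sqrt 0" by (rule tendsto_real_sqrt)
  moreover have "sqrt ((Y N)\<^sup>2) = Y N" for N by (simp add: Y_def)
  ultimately have Y: "Y \<longlonglongrightarrow> 0" by (simp only: real_sqrt_zero)
  have XY: "(\<lambda>N. X N - Y N) \<longlonglongrightarrow> sqrt A - 0" by (intro tendsto_diff X Y)
  have eq: "X N - Y N = real_of_int (int (m N * N) - int (N * quarter_root N)) / sqrt (real N ^ d)" for N
    by (simp add: X_def Y_def diff_divide_distrib)
  have "(\<lambda>N. (X N - Y N)\<^sup>2) \<longlonglongrightarrow> (sqrt A - 0)\<^sup>2" by (intro tendsto_power XY)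
  then show "(\<lambda>N. (real_of_int (int (m N * N) - int (N * quarter_root N)))\<^sup>2 / real N ^ d) \<longlonglongrightarrow> A"
    unfolding eq power_divide using A by simp
  have "\<forall>\<^sub>F N in sequentially. 0 < X N - Y N" by (rule order_tendstoD(1)[OF XY]) (use A in simp)
  then show "\<forall>\<^sub>F N in sequentially. 0 < int (m N * N) - int (N * quarter_root N)"
    using eventually_gt_at_top[of 0]
  proof eventually_elim
    fix N :: nat assume "0 < X N - Y N" "0 < N"
    then have "0 < real_of_int (int (m N * N) - int (N * quarter_root N))" unfolding eq by (simp add: zero_less_divide_iff)
    then show "0 < int (m N * N) - int (N * quarter_root N)" by linarith
  qed
qed

context homog
begin

text \<open>The lower bound is taken in the given box and the upper bound in the inner one. The
  limit of the killed rate depends on the box only through \<open>A\<close>, so the two bounds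
  meet.\<close>

theorem escape_tendsto:
  fixes B :: "real \<Rightarrow> 'w \<Rightarrow> real ^ 'd" and m :: "nat \<Rightarrow> nat"
  assumes A: "0 < A" and L: "(\<lambda>N. (real (m N * N))\<^sup>2 / real N ^ CARD('d)) \<longlonglongrightarrow> A" and BM: "std_BM M B"
  shows "((\<lambda>N. escape (int (m N * N)) (D N) 0) \<longlongrightarrow> (\<integral>\<omega>. exp (- (real CARD('d) * A * bm_exit B \<omega> * Cap K)) \<partial>M)) F"
proof -
  note inner = inner_box_scaling[OF d3 A L]
  have Lpos: "\<forall>\<^sub>F N in sequentially. 0 < int (m N * N)" using inner(2) by eventually_elim linarith
  interpret outer: homog_box K F a R g "\<lambda>N. int (m N * N)" A
    by unfold_locales (use A lim[OF L] ev[OF Lpos] in auto)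
  interpret inner: homog_box K F a R g "\<lambda>N. int (m N * N) - int (N * quarter_root N)" A
    by unfold_locales (use A lim[OF inner(1)] ev[OF inner(2)] in auto)
  let ?I = "\<integral>\<omega>. exp (- (real CARD('d) * A * bm_exit B \<omega> * Cap K)) \<partial>M"
  have ps: "prob_space M" using BM by (simp add: std_BM_def)
  show ?thesis
  proof (cases "Cap K = 0")
    \<comment> \<open>With zero capacity the exponential time of \<open>laplace_exit\<close> would
      have rate zero. The limit is 1, and since a probability is at most 1 the lower bound
      suffices.\<close>
    case True
    have I1: "?I = 1" using prob_space.prob_space[OF ps] True by simp
    show ?thesis
      unfolding I1
    proof (rule tendsto_sandwich)
      have "((\<lambda>N. w N 0 - \<gamma> N * (real_of_int (int (m N * N)))\<^sup>2 * (2 * real CARD('d)) - surv (outer.U N) (outer.n N) (\<lambda>_. 1) 0)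
          \<longlongrightarrow> 1 - A * Cap K / 2 * (2 * real CARD('d)) - 0) F"
        by (intro tendsto_diff tendsto_mult w_origin outer.\<gamma>_l tendsto_const outer.surv_tendsto)
      then show "((\<lambda>N. w N 0 - \<gamma> N * (real_of_int (int (m N * N)))\<^sup>2 * (2 * real CARD('d)) - surv (outer.U N) (outer.n N) (\<lambda>_. 1) 0) \<longlongrightarrow> 1) F"
        using True by simp
      show "\<forall>\<^sub>F N in F. w N 0 - \<gamma> N * (real_of_int (int (m N * N)))\<^sup>2 * (2 * real CARD('d)) - surv (outer.U N) (outer.n N) (\<lambda>_. 1) 0
          \<le> escape (int (m N * N)) (D N) 0"
        using outer.escape_lower outer.ev_all
      proof eventually_elim
        case (elim N)
        have "\<gamma> N * outer.box_occ N (\<lambda>_. 1) \<le> \<gamma> N * (2 * real CARD('d) * (real_of_int (int (m N * N)))\<^sup>2)"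
          using elim by (intro mult_left_mono outer.box_occ_one_le \<gamma>_nonneg) auto
        then show ?case using elim(1) by (simp add: mult_ac)
      qed
    qed (auto simp: escape_bounds)
  next
    case False
    then have Cap: "0 < Cap K" using Cap_nonneg[of K] by simp
    have invb: "(\<lambda>N. 1 / real (quarter_root N)) \<longlonglongrightarrow> 0"
      by (rule real_tendsto_divide_at_top[OF tendsto_const quarter_root_at_top])
    show ?thesis
    proof (rule tendsto_sandwich)
      show "\<forall>\<^sub>F N in F. w N 0 - \<gamma> N * outer.box_occ N (\<lambda>_. 1) - surv (outer.U N) (outer.n N) (\<lambda>_. 1) 0 \<le> escape (int (m N * N)) (D N) 0"
        by (rule outer.escape_lower)
      show "\<forall>\<^sub>F N in F. escape (int (m N * N)) (D N) 0 \<le>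
          w N 0 + 1 / real (quarter_root N) - (\<gamma> N * inner.box_occ N (\<lambda>_. 1) - inner.box_occ N (\<lambda>y. \<gamma> N - f N y)) + surv (inner.U N) (inner.n N) (\<lambda>_. 1) 0"
        by (rule inner.escape_upper) simp
      have "((\<lambda>N. w N 0 - \<gamma> N * outer.box_occ N (\<lambda>_. 1) - surv (outer.U N) (outer.n N) (\<lambda>_. 1) 0) \<longlongrightarrow> 1 - (1 - ?I) - 0) F"
        by (intro tendsto_diff w_origin outer.killed_rate_tendsto[OF BM Cap] outer.surv_tendsto)
      then show "((\<lambda>N. w N 0 - \<gamma> N * outer.box_occ N (\<lambda>_. 1) - surv (outer.U N) (outer.n N) (\<lambda>_. 1) 0) \<longlongrightarrow> ?I) F" by simp
      have "((\<lambda>N. w N 0 + 1 / real (quarter_root N) - (\<gamma> N * inner.box_occ N (\<lambda>_. 1) - inner.box_occ N (\<lambda>y. \<gamma> N - f N y)) + surv (inner.U N) (inner.n N) (\<lambda>_. 1) 0)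
          \<longlongrightarrow> 1 + 0 - ((1 - ?I) - 0) + 0) F"
        by (intro tendsto_add tendsto_diff w_origin lim[OF invb] inner.killed_rate_tendsto[OF BM Cap] inner.occ_rate_defect_tendsto inner.surv_tendsto)
      then show "((\<lambda>N. w N 0 + 1 / real (quarter_root N) - (\<gamma> N * inner.box_occ N (\<lambda>_. 1) - inner.box_occ N (\<lambda>y. \<gamma> N - f N y)) + surv (inner.U N) (inner.n N) (\<lambda>_. 1) 0) \<longlongrightarrow> ?I) F"
        by simp
    qed
  qed
qed

end

theorem theorem1p1:
  fixes R A :: real and g :: "nat \<Rightarrow> real" and m :: "nat \<Rightarrow> nat"
    and M :: "'w measure" and B :: "real \<Rightarrow> 'w \<Rightarrow> real ^ 'd"
  assumes "CARD('d) \<ge> 3"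
    and "0 < R"
    and "\<forall>N. 0 < g N"
    and "filterlim g at_top sequentially"
    and "0 < A"
    and "(\<lambda>N. (real (m N * N))\<^sup>2 / real N ^ CARD('d)) \<longlonglongrightarrow> A"
    and "std_BM M B"
  shows "\<forall>\<epsilon>>0. \<exists>N0. \<forall>N\<ge>N0. \<forall>K \<subseteq> zball (0 :: int ^ 'd) R. \<forall>x \<in> torus N.
           tau N x ` phi N ` zball 0 R \<inter> phi N ` zball 0 (g N) = {} \<longrightarrow>
           \<bar>avoid_prob N (int (m N * N)) (tau N x ` phi N ` K)
             - (\<integral>\<omega>. exp (- (real CARD('d) * A * bm_exit B \<omega> * Cap K)) \<partial>M)\<bar> \<le> \<epsilon>"
proof (intro allI impI)
  fix \<epsilon> :: real assume \<epsilon>: "0 < \<epsilon>"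
  let ?I = "\<lambda>K. \<integral>\<omega>. exp (- (real CARD('d) * A * bm_exit B \<omega> * Cap K)) \<partial>M"
  let ?P = "\<lambda>N K x. \<bar>avoid_prob N (int (m N * N)) (tau N x ` phi N ` K) - ?I K\<bar> \<le> \<epsilon>"
  let ?far = "\<lambda>N (x :: int ^ 'd). tau N x ` phi N ` zball 0 R \<inter> phi N ` zball 0 (g N) = {}"
  have each: "\<forall>\<^sub>F N in sequentially. \<forall>x. ?far N x \<longrightarrow> ?P N K x" if K: "K \<subseteq> zball (0 :: int ^ 'd) R" for K
  proof (rule ccontr)
    assume "\<not> (\<forall>\<^sub>F N in sequentially. \<forall>x. ?far N x \<longrightarrow> ?P N K x)"
    \<comment> \<open>The filter of large bad N, with a bad translate chosen for each, makes the limit uniform.\<close>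
    define Bad where "Bad = {N. 0 < N \<and> (\<exists>x. ?far N x \<and> \<not> ?P N K x)}"
    define F where "F = inf sequentially (principal Bad)"
    have "F \<noteq> bot"
    proof
      assume "F = bot"
      then have "\<forall>\<^sub>F N in sequentially. N \<notin> Bad" unfolding F_def trivial_limit_def[symmetric]
        using eventually_inf_principal[of "\<lambda>_. False" sequentially Bad] by (simp add: F_def[symmetric] \<open>F = bot\<close>)
      with eventually_gt_at_top[of 0] have "\<forall>\<^sub>F N in sequentially. \<forall>x. ?far N x \<longrightarrow> ?P N K x"
        by eventually_elim (auto simp: Bad_def)
      then show False using \<open>\<not> (\<forall>\<^sub>F N in sequentially. \<forall>x. ?far N x \<longrightarrow> ?P N K x)\<close> by blast
    qed
    define a where "a N = (SOME x. ?far N x \<and> \<not> ?P N K x)" for N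
    have a: "?far N (a N)" "\<not> ?P N K (a N)" "0 < N" if "N \<in> Bad" for N
    proof -
      have "\<exists>x. ?far N x \<and> \<not> ?P N K x" using that by (simp add: Bad_def)
      from someI_ex[OF this] show "?far N (a N)" "\<not> ?P N K (a N)" unfolding a_def by blast+
      show "0 < N" using that by (simp add: Bad_def)
    qed
    have evBad: "\<forall>\<^sub>F N in F. N \<in> Bad" unfolding F_def by (simp add: eventually_inf_principal)
    interpret H: homog K F a R g
    proof
      show "3 \<le> CARD('d)" "K \<subseteq> zball 0 R" "filterlim g at_top sequentially" using assms K by auto
      show "F \<le> sequentially" by (simp add: F_def)
      show "\<forall>\<^sub>F N in F. obst N (a N) K \<inter> zball 0 (g N) = {}"
        using evBad
      proof eventually_elim
        fix N assume N: "N \<in> Bad"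
        show "obst N (a N) K \<inter> zball 0 (g N) = {}"
        proof (rule ccontr)
          assume "obst N (a N) K \<inter> zball 0 (g N) \<noteq> {}"
          then obtain y where y: "y \<in> obst N (a N) K" "y \<in> zball 0 (g N)" by blast
          have "phi N y \<in> tau N (a N) ` phi N ` K" using y(1) a(3)[OF N] by (simp add: phi_mem_obst)
          then have "phi N y \<in> tau N (a N) ` phi N ` zball 0 R" using K by blast
          then show False using y(2) a(1)[OF N] by blast
        qed
      qed
    qed
    have "((\<lambda>N. escape (int (m N * N)) (H.D N) 0) \<longlongrightarrow> ?I K) F"
      by (rule H.escape_tendsto) (use assms in auto)
    then have "\<forall>\<^sub>F N in F. dist (escape (int (m N * N)) (H.D N) 0) (?I K) < \<epsilon>" using \<epsilon> by (rule tendstoD)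
    with evBad have "\<forall>\<^sub>F N in F. False"
    proof eventually_elim
      case (elim N)
      have "{y. phi N y \<in> tau N (a N) ` phi N ` K} = H.D N"
        using a(3)[OF elim(1)] by (auto simp: H.D_def phi_mem_obst)
      then have "avoid_prob N (int (m N * N)) (tau N (a N) ` phi N ` K) = escape (int (m N * N)) (H.D N) 0"
        by (simp only: avoid_prob_eq)
      then have "?P N K (a N)" using elim(2) by (simp add: dist_real_def)
      then show False using a(2)[OF elim(1)] by blast
    qed
    then show False using \<open>F \<noteq> bot\<close> by (simp add: eventually_False)
  qed
  \<comment> \<open>The ball is finite, so there are finitely many sets \<open>K\<close> and one
    threshold serves all of them.\<close>
  have "\<forall>\<^sub>F N in sequentially. \<forall>K\<in>Pow (zball (0 :: int ^ 'd) R). \<forall>x. ?far N x \<longrightarrow> ?P N K x"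
    by (rule eventually_ball_finite) (use each finite_zball in auto)
  then obtain N0 where "\<And>N. N \<ge> N0 \<Longrightarrow> \<forall>K\<in>Pow (zball (0 :: int ^ 'd) R). \<forall>x. ?far N x \<longrightarrow> ?P N K x"
    by (auto simp: eventually_sequentially)
  then show "\<exists>N0. \<forall>N\<ge>N0. \<forall>K \<subseteq> zball (0 :: int ^ 'd) R. \<forall>x \<in> torus N. ?far N x \<longrightarrow> ?P N K x"
    by blast
qed

end
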